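(* The Banach space $\mathcal{X}_{(4)}$ is quasi-minimal.
   Context: A Banach space $X$ is quasi-minimal if any two infinite-dimensional closed subspaces $Y,Z$ of $X$ contain further infinite-dimensional closed subspaces $Y'\subset Y$ and $Z'\subset Z$ which are isomorphic. Notation. $c_{00}(\mathbb{N})$ is the space of finitely supported real sequences, with usual basis $(e_n)$ (written $(e_n^* )$ when its elements are viewed as functionals), and $f(x)=\sum_i f_ix_i$ for $f,x\in c_{00}(\mathbb{N})$. The support of $x=\sum_i x_ie_i$ is $\operatorname{supp}x=\{i:x_i\ne0\}$, its range is the smallest interval containing $\operatorname{supp}x$, $|x|=\sum_i|x_i|e_i$, and $Ex=\sum_{i\in E}x_ie_i$ for $E\subset\mathbb{N}$. We write $x<y$ if $\max\operatorname{supp}x<\min\operatorname{supp}y$. Parameters. $m_1=2$, $m_{j+1}=m_j^5$; $n_1=4$, $n_{j+1}=(5n_j)^{s_j}$ with $s_j=\log_2(m_{j+1}^3)$. Fix a partition of $\mathbb{N}$ into two infinite sets $N_1,N_2$, and an injective coding function $\sigma$ from the set of finite sequences $\varphi_1<\dots<\varphi_i$ of nonzero vectors of $c_{00}(\mathbb{N})$ with nonnegative rational coordinates into $N_2$ such that $m_{2\sigma(\varphi_1,\dots,\varphi_i)}>\max\operatorname{supp}\varphi_i\cdot\max\{1/\varphi_i(e_l): l\in\operatorname{supp}\varphi_i\}$. The norming set. $W$ is the smallest subset of $c_{00}(\mathbb{N})$ (built inductively from the $\pm e_n^*$ by the operations below) such that: ($\alpha$) if $f\in W$, $g\in c_{00}(\mathbb{N})$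 and $|g|=|f|$, then $g\in W$; ($\beta$) $\pm e_n^*\in W$ for all $n$; ($\gamma$) if $f\in W$ and $E$ is an interval of $\mathbb{N}$, then $Ef\in W$; ($\delta$) if $f_1<\dots<f_{n_{2j}}$ are in $W$, then $\frac1{m_{2j}}\sum_{i=1}^{n_{2j}}f_i\in W$; ($\varepsilon$) if $f_1<\dots<f_{n_{2j+1}}$ in $W$ is a $(2j+1)$-special sequence, then $\frac1{m_{2j+1}}\sum_{i=1}^{n_{2j+1}}f_i\in W$; ($\zeta$) if $f\in W$ and $F=\{k_1<\dots<k_{2q}\}\subset\mathbb{N}$ satisfies $2q\le k_1$, then $\frac12S_Ff\in W$, where $S_Ff=\chi_{\bigcup_{p=1}^q[k_{2p-1},k_{2p})}f$ is the restriction of $f$ to $\bigcup_{p=1}^q[k_{2p-1},k_{2p})$. A functional $f\in W$ has weight $w(f)=m_j$ if, up to changing signs of coordinates, it is of the form $f=E\frac1{m_j}\sum_{i=1}^{n_j}f_i$ with $E$ an interval and $\frac1{m_j}\sum_{i=1}^{n_j}f_i$ obtained by ($\delta$) ($j$ even) or ($\varepsilon$) ($j$ odd); a functional may admit more than one weight, and a condition $w(f)=m$ means that $f$ admits the weight $m$. A sequence $f_1<\dots<f_{n_{2j+1}}$ in $W$ is $(2j+1)$-special if $w(f_i)=m_{2j_i}$ for every $i$ with $n_{2j+1}<m_{2j_1}<\dots<m_{2j_{n_{2j+1}}}$, $j_1\in N_1$, and $j_i=\sigma(|f_1|,\dots,|f_{i-1}|)$ for $1<i\le n_{2j+1}$ (so,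 $\sigma$ being injective, $w(f_i)$ determines $(|f_1|,\dots,|f_{i-1}|)$). The space $\mathcal{X}_{(4)}$ is the completion of $c_{00}(\mathbb{N})$ under the norm $\|x\|=\sup\{f(x):f\in W\}$. *)

theory Defs
  imports "HOL-Analysis.Analysis"
begin

section \<open>Quasi-minimality\<close>

definition infinite_dimensional :: "'a::real_vector set \<Rightarrow> bool" where
  "infinite_dimensional Y \<longleftrightarrow> \<not> (\<exists>B. finite B \<and> Y \<subseteq> span B)"

text \<open>Normed spaces are subspaces \<open>X\<close> of an ambient normed type, because the space
  studied below depends on parameters and so cannot be a type of its own.\<close>

definition inf_closed_subspace :: "'a::real_normed_vector set \<Rightarrow> 'a set \<Rightarrow> bool" where
  "inf_closed_subspace X Y \<longleftrightarrow>
     subspace Y \<and> closedin (top_of_set X) Y \<and> infinite_dimensional Y"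

definition linear_map_on ::
    "'a::real_vector set \<Rightarrow> ('a \<Rightarrow> 'b::real_vector) \<Rightarrow> bool" where
  "linear_map_on Y T \<longleftrightarrow>
     (\<forall>x\<in>Y. \<forall>y\<in>Y. \<forall>a b. T (a *\<^sub>R x + b *\<^sub>R y) = a *\<^sub>R T x + b *\<^sub>R T y)"

definition isomorphic_subspaces ::
    "'a::real_normed_vector set \<Rightarrow> 'b::real_normed_vector set \<Rightarrow> bool" where
  "isomorphic_subspaces Y Z \<longleftrightarrow> (\<exists>T S. linear_map_on Y T \<and> homeomorphism Y Z T S)"

definition quasi_minimal :: "'a::real_normed_vector set \<Rightarrow> bool" where
  "quasi_minimal X \<longleftrightarrow>
     (\<forall>Y Z. inf_closed_subspace X Y \<longrightarrow> inf_closed_subspace X Z \<longrightarrow>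
       (\<exists>Y' Z'. inf_closed_subspace X Y' \<and> Y' \<subseteq> Y \<and>
                inf_closed_subspace X Z' \<and> Z' \<subseteq> Z \<and> isomorphic_subspaces Y' Z'))"


section \<open>Finitely supported sequences\<close>

text \<open>The natural numbers of the construction are \<open>{1..}\<close>; a sequence is a function on
  \<^typ>\<open>nat\<close> that vanishes at \<open>0\<close>.\<close>

type_synonym vec = "nat \<Rightarrow> real"

definition supp :: "vec \<Rightarrow> nat set" where
  "supp x = {i. x i \<noteq> 0}"

definition c00 :: "vec set" where
  "c00 = {x. finite (supp x) \<and> x 0 = 0}"

definition unit_vec :: "nat \<Rightarrow> vec" where
  "unit_vec n = (\<lambda>i. if i = n then 1 else 0)"

definition abs_vec :: "vec \<Rightarrow> vec" where
  "abs_vec x = (\<lambda>i. \<bar>x i\<bar>)"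

definition restr :: "nat set \<Rightarrow> vec \<Rightarrow> vec" where
  "restr E x = (\<lambda>i. if i \<in> E then x i else 0)"

definition pairing :: "vec \<Rightarrow> vec \<Rightarrow> real" where
  "pairing f x = (\<Sum>i\<in>supp x. f i * x i)"

text \<open>Both vectors must be nonzero, since the extrema of an empty support are undefined.\<close>

definition block_less :: "vec \<Rightarrow> vec \<Rightarrow> bool" where
  "block_less x y \<longleftrightarrow> supp x \<noteq> {} \<and> supp y \<noteq> {} \<and> Max (supp x) < Min (supp y)"

definition nat_interval :: "nat set \<Rightarrow> bool" where
  "nat_interval E \<longleftrightarrow> (\<forall>a\<in>E. \<forall>b\<in>E. {a..b} \<subseteq> E)"


section \<open>Parameters\<close>

text \<open>Both sequences start at index \<open>1\<close>; the values at \<open>0\<close> are never used.\<close>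

fun mseq :: "nat \<Rightarrow> nat" where
  "mseq 0 = 0"
| "mseq (Suc 0) = 2"
| "mseq (Suc (Suc j)) = mseq (Suc j) ^ 5"

text \<open>The logarithm is an integer, so the floor is exact; see \<open>real_sseq\<close>.\<close>

definition sseq :: "nat \<Rightarrow> nat" where
  "sseq j = nat \<lfloor>log 2 (real (mseq (j + 1) ^ 3))\<rfloor>"

fun nseq :: "nat \<Rightarrow> nat" where
  "nseq 0 = 0"
| "nseq (Suc 0) = 4"
| "nseq (Suc (Suc j)) = (5 * nseq (Suc j)) ^ sseq (Suc j)"

lemma mseq_Suc: "mseq (Suc j) = 2 ^ (5 ^ j)"
  by (induction j) (simp_all add: power_mult[symmetric] mult.commute)

lemma real_sseq: "real (sseq j) = log 2 (real (mseq (j + 1) ^ 3))"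
proof -
  have "log 2 (real (mseq (j + 1) ^ 3)) = real (5 ^ j * 3)"
    by (simp add: mseq_Suc log_nat_power power_mult[symmetric] del: of_nat_mult of_nat_power)
      (simp add: log_nat_power)
  then show ?thesis
    by (simp add: sseq_def del: of_nat_mult of_nat_power)
qed


section \<open>The coding function\<close>

definition coding_domain :: "vec list set" where
  "coding_domain =
     {\<phi>s. \<phi>s \<noteq> [] \<and> sorted_wrt block_less \<phi>s \<and>
          (\<forall>\<phi>\<in>set \<phi>s. \<phi> \<in> c00 \<and> supp \<phi> \<noteq> {} \<and> (\<forall>i. \<phi> i \<in> \<rat> \<and> 0 \<le> \<phi> i))}"

definition coding_function :: "nat set \<Rightarrow> (vec list \<Rightarrow> nat) \<Rightarrow> bool" where
  "coding_function N2 \<sigma> \<longleftrightarrow>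
     inj_on \<sigma> coding_domain \<and> \<sigma> ` coding_domain \<subseteq> N2 \<and>
     (\<forall>\<phi>s\<in>coding_domain.
        real (mseq (2 * \<sigma> \<phi>s)) >
          real (Max (supp (last \<phi>s))) * Max ((\<lambda>l. 1 / last \<phi>s l) ` supp (last \<phi>s)))"


section \<open>The norming set\<close>

definition scaled_sum :: "nat \<Rightarrow> vec list \<Rightarrow> vec" where
  "scaled_sum k fs = (\<lambda>i. (\<Sum>f\<leftarrow>fs. f i) / real (mseq k))"

text \<open>\<open>switch F\<close> is the operator $S_F$; the list of elements of \<open>F\<close> is indexed from \<open>0\<close>,
  so that $k_{2p-1}$ and $k_{2p}$ sit at the positions \<open>2 * p\<close> and \<open>2 * p + 1\<close> for
  \<open>p < q\<close>.\<close>

definition switch :: "nat set \<Rightarrow> vec \<Rightarrow> vec" where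
  "switch F f =
     restr (\<Union>p<card F div 2. {sorted_list_of_set F ! (2 * p)..<sorted_list_of_set F ! (2 * p + 1)}) f"

text \<open>The norming set, the relation ``\<open>f\<close> admits the weight $m_k$'' and the
  \<open>(2 * j + 1)\<close>-special sequences depend on one another, so they are defined by simultaneous
  induction. In the rule \<open>special\<close>, \<open>js i\<close> and \<open>fs ! i\<close> stand for
  $j_{i+1}$ and $f_{i+1}$.\<close>

inductive norming :: "nat set \<Rightarrow> (vec list \<Rightarrow> nat) \<Rightarrow> vec \<Rightarrow> bool"
  and weight :: "nat set \<Rightarrow> (vec list \<Rightarrow> nat) \<Rightarrow> vec \<Rightarrow> nat \<Rightarrow> bool"
  and special :: "nat set \<Rightarrow> (vec list \<Rightarrow> nat) \<Rightarrow> nat \<Rightarrow> vec list \<Rightarrow> bool"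
  for N1 :: "nat set" and \<sigma> :: "vec list \<Rightarrow> nat" where
  alpha: "norming N1 \<sigma> f \<Longrightarrow> g \<in> c00 \<Longrightarrow> abs_vec g = abs_vec f \<Longrightarrow> norming N1 \<sigma> g"
| beta_pos: "1 \<le> n \<Longrightarrow> norming N1 \<sigma> (unit_vec n)"
| beta_neg: "1 \<le> n \<Longrightarrow> norming N1 \<sigma> (\<lambda>i. - unit_vec n i)"
| gamma: "norming N1 \<sigma> f \<Longrightarrow> nat_interval E \<Longrightarrow> norming N1 \<sigma> (restr E f)"
| delta: "1 \<le> j \<Longrightarrow> length fs = nseq (2 * j) \<Longrightarrow> sorted_wrt block_less fs \<Longrightarrow>
    (\<forall>f\<in>set fs. norming N1 \<sigma> f) \<Longrightarrow>
    norming N1 \<sigma> (scaled_sum (2 * j) fs)"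
| epsilon: "1 \<le> j \<Longrightarrow> special N1 \<sigma> j fs \<Longrightarrow> norming N1 \<sigma> (scaled_sum (2 * j + 1) fs)"
| zeta: "norming N1 \<sigma> f \<Longrightarrow> finite F \<Longrightarrow> card F = 2 * q \<Longrightarrow> 1 \<le> q \<Longrightarrow> 2 * q \<le> Min F \<Longrightarrow>
    norming N1 \<sigma> (\<lambda>i. switch F f i / 2)"
| weight_even: "norming N1 \<sigma> f \<Longrightarrow> 1 \<le> j \<Longrightarrow> length fs = nseq (2 * j) \<Longrightarrow>
    sorted_wrt block_less fs \<Longrightarrow> (\<forall>g\<in>set fs. norming N1 \<sigma> g) \<Longrightarrow>
    nat_interval E \<Longrightarrow> abs_vec f = abs_vec (restr E (scaled_sum (2 * j) fs)) \<Longrightarrow>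
    weight N1 \<sigma> f (2 * j)"
| weight_odd: "norming N1 \<sigma> f \<Longrightarrow> 1 \<le> j \<Longrightarrow> special N1 \<sigma> j fs \<Longrightarrow>
    nat_interval E \<Longrightarrow> abs_vec f = abs_vec (restr E (scaled_sum (2 * j + 1) fs)) \<Longrightarrow>
    weight N1 \<sigma> f (2 * j + 1)"
| special: "length fs = nseq (2 * j + 1) \<Longrightarrow> sorted_wrt block_less fs \<Longrightarrow>
    (\<forall>f\<in>set fs. norming N1 \<sigma> f) \<Longrightarrow>
    (\<forall>i<length fs. weight N1 \<sigma> (fs ! i) (2 * js i)) \<Longrightarrow>
    nseq (2 * j + 1) < mseq (2 * js 0) \<Longrightarrow>
    (\<forall>i. i + 1 < length fs \<longrightarrow> mseq (2 * js i) < mseq (2 * js (i + 1))) \<Longrightarrow>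
    js 0 \<in> N1 \<Longrightarrow>
    (\<forall>i. 0 < i \<and> i < length fs \<longrightarrow> js i = \<sigma> (map abs_vec (take i fs))) \<Longrightarrow>
    special N1 \<sigma> j fs"

definition W_norm :: "nat set \<Rightarrow> (vec list \<Rightarrow> nat) \<Rightarrow> vec \<Rightarrow> real" where
  "W_norm N1 \<sigma> x = (SUP f\<in>{f. norming N1 \<sigma> f}. pairing f x)"


section \<open>Completions of normed sequence spaces\<close>

text \<open>\<open>X\<close>, together with the embedding \<open>J\<close>, is a completion of \<^const>\<open>c00\<close> under
  the norm \<open>nrm\<close>.\<close>

definition is_c00_completion ::
    "(vec \<Rightarrow> real) \<Rightarrow> (vec \<Rightarrow> 'a::real_normed_vector) \<Rightarrow> 'a set \<Rightarrow> bool" where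
  "is_c00_completion nrm J X \<longleftrightarrow>
     subspace X \<and> complete X \<and>
     (\<forall>x\<in>c00. \<forall>y\<in>c00. \<forall>a b. J (\<lambda>i. a * x i + b * y i) = a *\<^sub>R J x + b *\<^sub>R J y) \<and>
     (\<forall>x\<in>c00. norm (J x) = nrm x) \<and>
     J ` c00 \<subseteq> X \<and> X \<subseteq> closure (J ` c00)"

end

theory Submission
  imports Defs
begin

text \<open>Since the norming set is closed under changes of sign, the norm of \<open>x\<close> is the supremum of
  \<open>f \<bar>x\<bar>\<close> over the nonnegative \<open>f\<close> in it. It therefore suffices to find, in any two block
  subspaces, normalized vectors \<open>y\<close> and \<open>z\<close> as far out as desired on whose moduli all nonnegative
  norming functionals almost agree: sequences of such pairs with summable errors are equivalent.

  Such \<open>y\<close> and \<open>z\<close> are the two halves of a sum of exact vectors \<open>x\<^sub>1 < x\<^sub>2 < \<dots>\<close> whose norming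
  functionals form a special sequence. Each \<open>x\<^sub>i\<close> is an average of rapidly increasing
  \<open>\<ell>\<^sub>1\<close>-averages taken alternately from the two subspaces. Functionals of other weights are small
  on the sum; a special functional of the same weight either has the coded weights of the chain, and
  then acts almost equally on both halves, or differs from it, and then it is small. The rule \<open>zeta\<close>
  does not spoil this: a switching set starting at \<open>k\<close> has at most \<open>k\<close> switching points, whereas
  the growth of the coding makes the number of pieces of each later \<open>x\<^sub>i\<close> much larger than \<open>k\<close>.\<close>

section \<open>Growth of the parameters\<close>

text \<open>Everything is measured at the weight \<open>m\<close> of the long special functional.
  That functional gives the half sum norm at least \<open>n / (2 * m)\<close>, while all of
  \<open>Wp\<close> give at most a constant times \<open>n / m ^ 2\<close> on the difference of the
  moduli. The quotient is of order \<open>1 / m\<close>, so a prescribed error is reached by raising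
  the weight. Losing one factor \<open>m\<close> would void this; the spare powers come from
  \<open>2 ^ sseq i = mseq (Suc i) ^ 3\<close> and from the base 5 in \<open>nseq\<close>.

  The obstacle is that rule \<open>zeta\<close> may be applied any number \<open>r\<close> of times,
  so the total number of switching points is not bounded. Two facts replace such a bound. Each
  application halves the functional and \<open>r \<le> 2 ^ r\<close>, so points of sets that start
  before a given exact vector are paid for by the halves. A set that starts inside the range of an
  exact vector may be too large to control, but it does so for one vector only: at most
  \<open>r\<close> vectors suffer, each with an error of order \<open>1 / 2 ^ r\<close>, and
  together they cost a constant.\<close>

lemma mseq_eq: "1 \<le> i \<Longrightarrow> mseq i = 2 ^ (5 ^ (i - 1))"
  using mseq_Suc[of "i - 1"] by simp

lemma mseq_ge_2: "1 \<le> i \<Longrightarrow> 2 \<le> mseq i"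
  using power_increasing[of 1 "5 ^ (i - 1)" "2::nat"] by (simp add: mseq_eq)

lemma mseq_step: "1 \<le> i \<Longrightarrow> mseq (Suc i) = mseq i ^ 5"
  by (cases i) auto

lemma mseq_mono: "1 \<le> i \<Longrightarrow> i \<le> j \<Longrightarrow> mseq i \<le> mseq j"
  by (simp add: mseq_eq power_increasing)

lemma mseq_power5_le: "1 \<le> i \<Longrightarrow> i < j \<Longrightarrow> mseq i ^ 5 \<le> mseq j"
  using mseq_mono[of "Suc i" j] by (simp add: mseq_step)

lemma mseq_strict_mono: "1 \<le> i \<Longrightarrow> i < j \<Longrightarrow> mseq i < mseq j"
  by (simp add: mseq_eq)

lemma mseq_less_iff: "1 \<le> i \<Longrightarrow> 1 \<le> j \<Longrightarrow> mseq i < mseq j \<longleftrightarrow> i < j"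
  using mseq_strict_mono[of i j] mseq_mono[of j i] by (metis not_le)

lemma two_power_sseq: "2 ^ sseq i = mseq (Suc i) ^ 3"
proof -
  have "real (2 ^ sseq i) = 2 powr real (sseq i)"
    by (simp add: powr_realpow)
  also have "\<dots> = real (mseq (Suc i) ^ 3)"
    using mseq_ge_2[of "Suc i"] by (subst real_sseq) (simp add: powr_log_cancel)
  finally show ?thesis
    using of_nat_eq_iff by blast
qed

lemma sseq_pos: "0 < sseq i"
proof (rule ccontr)
  assume "\<not> 0 < sseq i"
  then have "mseq (Suc i) ^ 3 = 1"
    using two_power_sseq[of i] by simp
  then show False
    using mseq_ge_2[of "Suc i"] by simp
qed

lemma nseq_step: "1 \<le> i \<Longrightarrow> nseq (Suc i) = (5 * nseq i) ^ sseq i"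
  by (cases i) auto

lemma nseq_ge_4: "1 \<le> i \<Longrightarrow> 4 \<le> nseq i"
proof (induction i rule: nat_induct_at_least)
  case base then show ?case by simp
next
  case (Suc i)
  have "5 * nseq i \<le> (5 * nseq i) ^ sseq i"
    using Suc sseq_pos[of i] by (intro self_le_power) auto
  then show ?case
    using Suc by (simp add: nseq_step)
qed

lemma nseq_mono: "1 \<le> i \<Longrightarrow> i \<le> j \<Longrightarrow> nseq i \<le> nseq j"
proof (induction j rule: nat_induct)
  case (Suc j)
  show ?case
  proof (cases "i = Suc j")
    case False
    then have "nseq i \<le> nseq j" "1 \<le> j"
      using Suc by auto
    moreover have "5 * nseq j \<le> (5 * nseq j) ^ sseq j"
      using nseq_ge_4[OF \<open>1 \<le> j\<close>] sseq_pos[of j] by (intro self_le_power) auto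
    ultimately show ?thesis
      by (simp add: nseq_step)
  qed simp
qed simp

text \<open>Lets the summands of an exact vector be paired off, one from each subspace.\<close>

lemma nseq_even: "1 \<le> i \<Longrightarrow> even (nseq i)"
proof (induction i rule: nat_induct_at_least)
  case (Suc i)
  then have "even (5 * nseq i)" by simp
  then show ?case
    using Suc(1) sseq_pos[of i] by (simp only: nseq_step even_power)
qed simp

text \<open>Since \<open>5 \<ge> 2 * 2\<close>, a factor
  \<open>2 ^ sseq i = mseq (Suc i) ^ 3\<close> is left over. The power on the left is what
  \<open>recursion\<close> produces when functionals of weight index at most \<open>i\<close> are
  unfolded \<open>sseq i\<close> times; the cube makes that contribution a negligible fraction of
  the number of summands.\<close>

lemma nseq_ratio:
  assumes "1 \<le> i"
  shows "(2 * nseq i) ^ sseq i * mseq (Suc i) ^ 3 \<le> nseq (Suc i)"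
proof -
  have "(2 * nseq i) ^ sseq i * 2 ^ sseq i = (4 * nseq i) ^ sseq i"
    unfolding power_mult_distrib[symmetric] by (simp only: mult.commute mult.left_commute) simp
  also have "\<dots> \<le> (5 * nseq i) ^ sseq i"
    by (intro power_mono) auto
  finally show ?thesis
    using assms by (simp add: two_power_sseq nseq_step)
qed

lemma mseq_cube_le_nseq:
  assumes "2 \<le> i"
  shows "mseq i ^ 3 \<le> nseq i"
proof -
  obtain k where k: "i = Suc k" "1 \<le> k"
    using assms by (cases i) auto
  have "mseq (Suc k) ^ 3 \<le> (2 * nseq k) ^ sseq k * mseq (Suc k) ^ 3"
    using nseq_ge_4[OF k(2)] by simp
  then show ?thesis
    using nseq_ratio[OF k(2)] unfolding k(1) by (rule order.trans)
qed


section \<open>Pairings and successive families\<close>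

lemma finite_supp: "x \<in> c00 \<Longrightarrow> finite (supp x)"
  by (simp add: c00_def)

lemma c00_subset: "x \<in> c00 \<Longrightarrow> supp y \<subseteq> supp x \<Longrightarrow> y \<in> c00"
  by (auto simp: c00_def supp_def intro: finite_subset)

lemma c00_lincomb: "x \<in> c00 \<Longrightarrow> y \<in> c00 \<Longrightarrow> (\<lambda>i. a * x i + b * y i) \<in> c00"
  by (auto simp: c00_def supp_def intro: finite_subset[of _ "{i. x i \<noteq> 0} \<union> {i. y i \<noteq> 0}"])

lemma c00_scale: "x \<in> c00 \<Longrightarrow> (\<lambda>i. a * x i) \<in> c00"
  by (erule c00_subset) (auto simp: supp_def)

lemma c00_abs [simp]: "abs_vec x \<in> c00 \<longleftrightarrow> x \<in> c00"
  by (simp add: c00_def supp_def abs_vec_def)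

lemma supp_abs [simp]: "supp (abs_vec x) = supp x"
  by (simp add: supp_def abs_vec_def)

lemma abs_abs [simp]: "abs_vec (abs_vec x) = abs_vec x"
  by (simp add: abs_vec_def)

lemma abs_vec_nonneg: "0 \<le> abs_vec x i"
  by (simp add: abs_vec_def)

lemma abs_vec_of_nonneg: "(\<And>i. 0 \<le> x i) \<Longrightarrow> abs_vec x = x"
  by (simp add: abs_vec_def)

lemma c00_zero: "(\<lambda>i. 0) \<in> c00"
  by (simp add: c00_def supp_def)

lemma c00_sum:
  "(\<And>k. k \<in> K \<Longrightarrow> d k \<in> c00) \<Longrightarrow> (\<lambda>i. \<Sum>k\<in>K. d k i) \<in> c00"
proof (induction K rule: infinite_finite_induct)
  case (insert k K)
  then show ?case
    using c00_lincomb[of "d k" "\<lambda>i. \<Sum>k\<in>K. d k i" 1 1] by simp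
qed (simp_all add: c00_zero)

lemma supp_sum: "supp (\<lambda>i. \<Sum>k\<in>K. d k i) \<subseteq> (\<Union>k\<in>K. supp (d k))"
  by (auto simp: supp_def dest: sum.not_neutral_contains_not_neutral)

lemma pairing_eq_sum:
  "finite A \<Longrightarrow> supp x \<subseteq> A \<Longrightarrow> pairing f x = (\<Sum>i\<in>A. f i * x i)"
  unfolding pairing_def by (rule sum.mono_neutral_left) (auto simp: supp_def)

lemma pairing_lincomb_right:
  assumes "x \<in> c00" "y \<in> c00"
  shows "pairing f (\<lambda>i. a * x i + b * y i) = a * pairing f x + b * pairing f y"
proof -
  let ?A = "supp x \<union> supp y"
  have "finite ?A" "supp (\<lambda>i. a * x i + b * y i) \<subseteq> ?A"
    using assms by (auto simp: c00_def supp_def)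
  then show ?thesis
    by (simp add: pairing_eq_sum[of ?A] sum_distrib_left algebra_simps flip: sum.distrib)
qed

lemma pairing_scale_right: "x \<in> c00 \<Longrightarrow> pairing f (\<lambda>i. a * x i) = a * pairing f x"
  using pairing_lincomb_right[of x x f a 0] by simp

lemma pairing_add_right:
  "x \<in> c00 \<Longrightarrow> y \<in> c00 \<Longrightarrow> pairing f (\<lambda>i. x i + y i) = pairing f x + pairing f y"
  using pairing_lincomb_right[of x y f 1 1] by simp

lemma pairing_diff_right:
  "x \<in> c00 \<Longrightarrow> y \<in> c00 \<Longrightarrow> pairing f (\<lambda>i. x i - y i) = pairing f x - pairing f y"
  using pairing_lincomb_right[of x y f 1 "-1"] by simp

lemma pairing_zero_right [simp]: "pairing f (\<lambda>i. 0) = 0"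
  by (simp add: pairing_def)

lemma pairing_sum_right:
  "(\<And>k. k \<in> K \<Longrightarrow> d k \<in> c00) \<Longrightarrow> pairing f (\<lambda>i. \<Sum>k\<in>K. d k i) = (\<Sum>k\<in>K. pairing f (d k))"
proof (induction K rule: infinite_finite_induct)
  case (insert k K)
  then show ?case
    using pairing_add_right[of "d k" "\<lambda>i. \<Sum>k\<in>K. d k i"] by (simp add: c00_sum)
qed simp_all

lemma pairing_sum_left: "pairing (\<lambda>i. \<Sum>l\<in>L. g l i) x = (\<Sum>l\<in>L. pairing (g l) x)"
  unfolding pairing_def by (simp add: sum_distrib_right) (rule sum.swap)

lemma pairing_scale_left: "pairing (\<lambda>i. c * f i) x = c * pairing f x"
  unfolding pairing_def by (simp add: sum_distrib_left mult.assoc)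

lemma pairing_divide_left: "pairing (\<lambda>i. f i / c) x = pairing f x / c"
  unfolding pairing_def by (simp add: sum_divide_distrib)

lemma pairing_mono_left:
  "(\<And>i. 0 \<le> x i) \<Longrightarrow> (\<And>i. f i \<le> g i) \<Longrightarrow> pairing f x \<le> pairing g x"
  unfolding pairing_def by (intro sum_mono mult_right_mono) auto

lemma pairing_mono_right:
  assumes "x \<in> c00" "y \<in> c00" "\<And>i. 0 \<le> f i" "\<And>i. x i \<le> y i"
  shows "pairing f x \<le> pairing f y"
proof -
  have "pairing f (\<lambda>i. y i - x i) \<ge> 0"
    unfolding pairing_def using assms by (intro sum_nonneg mult_nonneg_nonneg) auto
  then show ?thesis
    using assms by (simp add: pairing_diff_right)
qed

lemma pairing_nonneg:
  "(\<And>i. 0 \<le> f i) \<Longrightarrow> (\<And>i. 0 \<le> x i) \<Longrightarrow> 0 \<le> pairing f x"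
  unfolding pairing_def by (intro sum_nonneg mult_nonneg_nonneg) auto

lemma pairing_abs_le: "\<bar>pairing f x\<bar> \<le> pairing (abs_vec f) (abs_vec x)"
  unfolding pairing_def supp_abs
  by (rule order.trans[OF sum_abs]) (simp add: abs_vec_def abs_mult)

lemma pairing_disjoint: "supp f \<inter> supp x = {} \<Longrightarrow> pairing f x = 0"
  unfolding pairing_def by (intro sum.neutral) (auto simp: supp_def)

lemma pairing_unit:
  assumes "x \<in> c00"
  shows "pairing (\<lambda>i. c * unit_vec n i) x = c * x n"
proof -
  have "pairing (\<lambda>i. c * unit_vec n i) x = (\<Sum>i\<in>supp x. if i = n then c * x n else 0)"
    unfolding pairing_def by (intro sum.cong) (auto simp: unit_vec_def)
  also have "\<dots> = c * x n"
    using finite_supp[OF assms] by (simp add: supp_def)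
  finally show ?thesis .
qed

text \<open>Unlike \<open>block_less\<close>, this holds vacuously for zero vectors, because cutting
  and switching may annihilate members of a block sequence.\<close>

definition before :: "vec \<Rightarrow> vec \<Rightarrow> bool" where
  "before x y \<longleftrightarrow> (\<forall>s\<in>supp x. \<forall>t\<in>supp y. s < t)"

definition successive :: "nat set \<Rightarrow> (nat \<Rightarrow> vec) \<Rightarrow> bool" where
  "successive K d \<longleftrightarrow> (\<forall>k\<in>K. \<forall>k'\<in>K. k < k' \<longrightarrow> before (d k) (d k'))"

lemma before_subset: "before x y \<Longrightarrow> supp x' \<subseteq> supp x \<Longrightarrow> supp y' \<subseteq> supp y \<Longrightarrow> before x' y'"
  by (auto simp: before_def)

lemma successive_subset:
  "successive K d \<Longrightarrow> K' \<subseteq> K \<Longrightarrow> (\<And>k. k \<in> K' \<Longrightarrow> supp (d' k) \<subseteq> supp (d k)) \<Longrightarrow> successive K' d'"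
  unfolding successive_def by (meson before_subset subset_iff)

lemma successive_disjoint:
  "successive K d \<Longrightarrow> k \<in> K \<Longrightarrow> k' \<in> K \<Longrightarrow> k \<noteq> k' \<Longrightarrow> supp (d k) \<inter> supp (d k') = {}"
  unfolding successive_def before_def
  by (metis disjoint_iff less_irrefl linorder_neqE_nat)

lemma successive_abs_sum:
  assumes "successive K d" "finite K"
  shows "\<bar>\<Sum>k\<in>K. d k t\<bar> = (\<Sum>k\<in>K. \<bar>d k t\<bar>)"
proof (cases "\<exists>k\<in>K. d k t \<noteq> 0")
  case True
  then obtain k where k: "k \<in> K" "d k t \<noteq> 0" by blast
  have z: "d k' t = 0" if "k' \<in> K" "k' \<noteq> k" for k'
    using successive_disjoint[OF assms(1) that(1) k(1) that(2)] k(2) by (auto simp: supp_def)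
  have "(\<Sum>k\<in>K. d k t) = d k t" "(\<Sum>k\<in>K. \<bar>d k t\<bar>) = \<bar>d k t\<bar>"
    using z k(1) assms(2) by (subst sum.remove[of _ k]; simp)+
  then show ?thesis by simp
qed (simp add: sum.neutral)

lemma block_less_before: "x \<in> c00 \<Longrightarrow> y \<in> c00 \<Longrightarrow> block_less x y \<Longrightarrow> before x y"
  unfolding block_less_def before_def
  by (meson Max_ge Min_le finite_supp le_less_trans less_le_trans)

lemma before_block_less:
  "x \<in> c00 \<Longrightarrow> y \<in> c00 \<Longrightarrow> before x y \<Longrightarrow> supp x \<noteq> {} \<Longrightarrow> supp y \<noteq> {} \<Longrightarrow> block_less x y"
  unfolding block_less_def before_def by (simp add: finite_supp)

lemma sum_list_eval: "(\<Sum>f\<leftarrow>fs. f i) = (\<Sum>l<length fs. (fs ! l) i)"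
  for fs :: "vec list"
  by (simp add: sum_list_sum_nth atLeast0LessThan)

text \<open>Two successive families meet along a staircase, on which the sum of the two indices
  is injective.\<close>

lemma card_meeting_pairs:
  assumes K: "finite K" and d: "successive K d" and g: "successive {..<n} g"
  shows "(\<Sum>l<n. card {k\<in>K. supp (g l) \<inter> supp (d k) \<noteq> {}}) \<le> card K + n"
proof -
  define r where "r k = card {k'\<in>K. k' < k}" for k
  define P where "P = (SIGMA l:{..<n}. {k\<in>K. supp (g l) \<inter> supp (d k) \<noteq> {}})"
  have rless: "r k < r k'" if "k \<in> K" "k < k'" for k k'
    unfolding r_def using that K by (intro psubset_card_mono) auto
  have rbound: "r k < card K" if "k \<in> K" for k
    unfolding r_def using that K by (intro psubset_card_mono) auto
  have inj: "inj_on (\<lambda>(l, k). l + r k) P"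
  proof (rule inj_onI, clarify)
    fix l k l' k' assume A: "(l, k) \<in> P" "(l', k') \<in> P" and e: "l + r k = l' + r k'"
    \<comment> \<open>Equal index sums at different pairs force one index up and the other down,
      against the order of the two families.\<close>
    have key: False if m: "(l, k) \<in> P" "(l', k') \<in> P" "l < l'" "k' < k" for l k l' k'
    proof -
      obtain p where "p \<in> supp (g l)" "p \<in> supp (d k)"
        using m(1) unfolding P_def by blast
      moreover obtain p' where "p' \<in> supp (g l')" "p' \<in> supp (d k')"
        using m(2) unfolding P_def by blast
      moreover have "before (g l) (g l')" "before (d k') (d k)"
        using m d g by (auto simp: P_def successive_def)
      ultimately show False
        unfolding before_def by (meson less_asym)
    qed
    have kk: "k \<in> K" "k' \<in> K" using A by (auto simp: P_def)
    consider "k = k'" | "k < k'" | "k' < k" by linarith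
    then show "l = l' \<and> k = k'"
    proof cases
      case 2
      then have "l' < l" using rless[OF kk(1) 2] e by linarith
      then show ?thesis using key[OF A(2,1)] 2 by blast
    next
      case 3
      then have "l < l'" using rless[OF kk(2) 3] e by linarith
      then show ?thesis using key[OF A] 3 by blast
    qed (use e in simp)
  qed
  have "(\<lambda>(l, k). l + r k) ` P \<subseteq> {..<card K + n}"
  proof (rule image_subsetI)
    fix x assume "x \<in> P"
    then obtain l k where "x = (l, k)" "l < n" "k \<in> K"
      by (auto simp: P_def)
    then show "(case x of (l, k) \<Rightarrow> l + r k) \<in> {..<card K + n}"
      using rbound[of k] by simp
  qed
  then have "card P \<le> card K + n"
    using card_inj_on_le[OF inj] by (metis card_lessThan finite_lessThan)
  moreover have "card P = (\<Sum>l<n. card {k\<in>K. supp (g l) \<inter> supp (d k) \<noteq> {}})"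
    unfolding P_def using K by (intro card_SigmaI) auto
  ultimately show ?thesis by simp
qed

section \<open>The structure of norming functionals\<close>

definition valid_switch :: "nat set \<Rightarrow> bool" where
  "valid_switch F \<longleftrightarrow> finite F \<and> (\<exists>q\<ge>1. card F = 2 * q \<and> 2 * q \<le> Min F)"

definition switch_set :: "nat set \<Rightarrow> nat set" where
  "switch_set F =
     (\<Union>p<card F div 2. {sorted_list_of_set F ! (2 * p)..<sorted_list_of_set F ! (2 * p + 1)})"

text \<open>The operators generated by the rules \<open>gamma\<close> and \<open>zeta\<close>: one interval and any
  number of switching sets, each at the cost of a factor \<open>1/2\<close>.\<close>

definition trim :: "nat set \<Rightarrow> nat set list \<Rightarrow> vec \<Rightarrow> vec" where
  "trim E Fs v =
     (\<lambda>t. if t \<in> E \<and> (\<forall>F\<in>set Fs. t \<in> switch_set F) then v t / 2 ^ length Fs else 0)"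

lemma switch_eq: "switch F f = restr (switch_set F) f"
  by (simp add: switch_def switch_set_def)

lemma supp_trim: "supp (trim E Fs v) \<subseteq> supp v"
  by (auto simp: supp_def trim_def)

lemma trim_nonneg: "(\<And>t. 0 \<le> v t) \<Longrightarrow> 0 \<le> trim E Fs v t"
  by (simp add: trim_def)

lemma trim_le: "(\<And>t. 0 \<le> v t) \<Longrightarrow> trim E Fs v t \<le> v t / 2 ^ length Fs"
  by (simp add: trim_def)

lemma trim_le_self:
  assumes "\<And>t. 0 \<le> v t"
  shows "trim E Fs v t \<le> v t"
proof -
  have "v t / 2 ^ length Fs \<le> v t"
    using assms[of t] by (simp add: divide_le_eq mult_left_le mult_le_cancel_left1)
  then show ?thesis
    using assms[of t] by (simp add: trim_def)
qed

lemma restr_trim: "restr E' (trim E Fs v) = trim (E \<inter> E') Fs v"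
  by (auto simp: restr_def trim_def fun_eq_iff)

lemma switch_trim: "(\<lambda>i. switch F (trim E Fs v) i / 2) = trim E (F # Fs) v"
  by (auto simp: switch_eq restr_def trim_def fun_eq_iff)

lemma trim_UNIV_Nil: "trim UNIV [] v = v"
  by (simp add: trim_def)

lemma trim_Nil: "trim E [] v = restr E v"
  by (simp add: trim_def restr_def fun_eq_iff)

lemma trim_sum: "trim E Fs (\<lambda>i. (\<Sum>l\<in>L. v l i) / c) = (\<lambda>i. (\<Sum>l\<in>L. trim E Fs (v l) i) / c)"
proof (rule ext)
  fix i
  show "trim E Fs (\<lambda>i. (\<Sum>l\<in>L. v l i) / c) i = (\<Sum>l\<in>L. trim E Fs (v l) i) / c"
  proof (cases "i \<in> E \<and> (\<forall>F\<in>set Fs. i \<in> switch_set F)")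
    case True
    then have T: "trim E Fs v' i = v' i / 2 ^ length Fs" for v'
      by (simp add: trim_def)
    show ?thesis
      unfolding T sum_divide_distrib[symmetric] by (simp add: mult.commute)
  next
    case False
    then have "trim E Fs v' i = 0" for v'
      unfolding trim_def by (rule if_not_P)
    then show ?thesis by simp
  qed
qed

lemma nat_interval_Int: "nat_interval E \<Longrightarrow> nat_interval E' \<Longrightarrow> nat_interval (E \<inter> E')"
  by (auto simp: nat_interval_def)

lemma nat_interval_UNIV [simp]: "nat_interval UNIV"
  by (simp add: nat_interval_def)

lemma nat_interval_atLeastAtMost [simp]: "nat_interval {a..b}"
  by (auto simp: nat_interval_def)

lemma scaled_sum_eval: "scaled_sum k fs i = (\<Sum>l<length fs. (fs ! l) i) / mseq k"
  by (simp add: scaled_sum_def sum_list_eval)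

lemma successive_nth:
  assumes "\<forall>f\<in>set fs. f \<in> c00" "sorted_wrt block_less fs"
  shows "successive {..<length fs} (\<lambda>l. fs ! l)"
  unfolding successive_def
  using assms by (auto simp: sorted_wrt_iff_nth_less intro!: block_less_before)

lemma abs_scaled_sum:
  assumes "\<forall>f\<in>set fs. f \<in> c00" "sorted_wrt block_less fs"
  shows "abs_vec (scaled_sum k fs) = (\<lambda>i. (\<Sum>l<length fs. abs_vec (fs ! l) i) / mseq k)"
  using successive_abs_sum[OF successive_nth[OF assms]]
  by (simp add: abs_vec_def scaled_sum_eval fun_eq_iff)

lemma c00_scaled_sum: "\<forall>f\<in>set fs. f \<in> c00 \<Longrightarrow> scaled_sum k fs \<in> c00"
  using c00_scale[of "\<lambda>i. \<Sum>l<length fs. (fs ! l) i" "1 / mseq k"]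
    c00_sum[of "{..<length fs}" "\<lambda>l. fs ! l"]
  by (simp add: scaled_sum_eval[abs_def])

section \<open>Nonnegative norming functionals and their weights\<close>

locale norming_space =
  fixes N1 :: "nat set" and \<sigma> :: "vec list \<Rightarrow> nat"
begin

abbreviation "W \<equiv> norming N1 \<sigma>"
abbreviation "nrm \<equiv> W_norm N1 \<sigma>"

definition Wp :: "vec set" where
  "Wp = {f. W f \<and> (\<forall>i. 0 \<le> f i)}"

text \<open>Halved switching is built in, so that \<open>Wp_cases\<close> is exhaustive. The list is
  recorded before trimming: comparing a special functional with a chain needs the codes of its
  members, which trimming would destroy.\<close>

definition wt :: "nat \<Rightarrow> vec \<Rightarrow> bool" where
  "wt i f \<longleftrightarrow> 2 \<le> i \<and> (\<exists>fs E Fs. (\<forall>h\<in>set fs. W h) \<and> length fs = nseq i \<and>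
     sorted_wrt block_less fs \<and> (odd i \<longrightarrow> special N1 \<sigma> (i div 2) fs) \<and>
     nat_interval E \<and> (\<forall>F\<in>set Fs. valid_switch F) \<and> f = trim E Fs (abs_vec (scaled_sum i fs)))"

text \<open>Rationality is what admits \<open>abs_vec f\<close> as an entry of a coding word. The
  induction carries the claim for all members of a special list as well, since the rule
  \<open>epsilon\<close> mentions them only through \<open>special\<close>.\<close>

lemma W_regular: "W f \<Longrightarrow> f \<in> c00 \<and> (\<forall>i. \<bar>f i\<bar> \<le> 1 \<and> \<bar>f i\<bar> \<in> \<rat>)"
proof (induction rule: norming_weight_special.inducts(1)
    [of N1 \<sigma> f "\<lambda>f. f \<in> c00 \<and> (\<forall>i. \<bar>f i\<bar> \<le> 1 \<and> \<bar>f i\<bar> \<in> \<rat>)" "\<lambda>j fs. length fs = nseq (2 * j + 1) \<and> sorted_wrt block_less fs \<and>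
         (\<forall>f\<in>set fs. f \<in> c00 \<and> (\<forall>i. \<bar>f i\<bar> \<le> 1 \<and> \<bar>f i\<bar> \<in> \<rat>))"
      "\<lambda>_ _. True"])
  have sums: "scaled_sum k fs \<in> c00 \<and> (\<forall>i. \<bar>scaled_sum k fs i\<bar> \<le> 1 \<and> \<bar>scaled_sum k fs i\<bar> \<in> \<rat>)"
    if "1 \<le> k" "sorted_wrt block_less fs" "\<forall>f\<in>set fs. f \<in> c00 \<and> (\<forall>i. \<bar>f i\<bar> \<le> 1 \<and> \<bar>f i\<bar> \<in> \<rat>)"
    for k fs
  proof -
    have c: "\<forall>f\<in>set fs. f \<in> c00" using that by auto
    have e: "\<bar>scaled_sum k fs i\<bar> = (\<Sum>l<length fs. \<bar>(fs ! l) i\<bar>) / mseq k" for i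
      using abs_scaled_sum[OF c that(2), of k] by (simp add: abs_vec_def fun_eq_iff)
    \<comment> \<open>The summands are successive, so at most one of them is nonzero at
      \<open>i\<close>.\<close>
    have b: "(\<Sum>l<length fs. \<bar>(fs ! l) i\<bar>) \<le> 1" for i
    proof (cases "\<exists>l<length fs. (fs ! l) i \<noteq> 0")
      case True
      then obtain l where l: "l < length fs" "(fs ! l) i \<noteq> 0" by blast
      have "(fs ! l') i = 0" if "l' < length fs" "l' \<noteq> l" for l'
        using successive_disjoint[OF successive_nth[OF c \<open>sorted_wrt block_less fs\<close>], of l' l] that l
        by (auto simp: supp_def)
      then have "(\<Sum>l<length fs. \<bar>(fs ! l) i\<bar>) = \<bar>(fs ! l) i\<bar>"
        using l by (subst sum.remove[of _ l]) (auto intro!: sum.neutral)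
      then show ?thesis using that l by simp
    qed (simp add: sum.neutral)
    have "2 \<le> mseq k" using mseq_ge_2[OF that(1)] .
    then have "\<bar>scaled_sum k fs i\<bar> \<le> 1" for i
      using b[of i] by (simp add: e divide_le_eq)
    moreover have "\<bar>scaled_sum k fs i\<bar> \<in> \<rat>" for i
      unfolding e using that by (intro Rats_divide Rats_sum) auto
    ultimately show ?thesis using c00_scaled_sum[OF c] by blast
  qed
  { case (alpha f g) then show ?case by (auto simp: abs_vec_def fun_eq_iff) }
  { case (beta_pos n) then show ?case by (auto simp: c00_def supp_def unit_vec_def) }
  { case (beta_neg n) then show ?case by (auto simp: c00_def supp_def unit_vec_def) }
  { case (gamma f E) then show ?case
      by (auto simp: restr_def supp_def intro!: c00_subset[of f] split: if_splits) }
  { case (delta j fs) then show ?case by (intro sums) auto }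
  { case (epsilon j fs) then show ?case by (intro sums) auto }
  { case (zeta f F q)
    have "\<bar>switch F f i / 2\<bar> \<le> 1 \<and> \<bar>switch F f i / 2\<bar> \<in> \<rat>" for i
    proof (cases "i \<in> switch_set F")
      case True
      have "\<bar>f i\<bar> / 2 \<in> \<rat>" "\<bar>f i\<bar> \<le> 1" using zeta by auto
      then show ?thesis using True by (simp add: switch_eq restr_def)
    qed (simp add: switch_eq restr_def)
    moreover have "(\<lambda>i. switch F f i / 2) \<in> c00"
    proof (rule c00_subset)
      show "f \<in> c00" using zeta(2) by blast
      show "supp (\<lambda>i. switch F f i / 2) \<subseteq> supp f"
        using supp_trim[of UNIV "[F]" f] unfolding switch_trim[symmetric] trim_UNIV_Nil .
    qed
    ultimately show ?case by blast }
qed simp_all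

lemma W_c00: "W f \<Longrightarrow> f \<in> c00"
  using W_regular by blast

lemma W_abs: "W f \<Longrightarrow> abs_vec f \<in> Wp"
  unfolding Wp_def
  by (auto intro!: norming_weight_special.alpha[of N1 \<sigma> f "abs_vec f"] simp: W_c00 abs_vec_nonneg)

lemma Wp_W: "f \<in> Wp \<Longrightarrow> W f"
  by (simp add: Wp_def)

lemma Wp_c00: "f \<in> Wp \<Longrightarrow> f \<in> c00"
  using Wp_W W_c00 by blast

lemma Wp_nonneg: "f \<in> Wp \<Longrightarrow> 0 \<le> f i"
  by (simp add: Wp_def)

lemma Wp_le_1: "f \<in> Wp \<Longrightarrow> f i \<le> 1"
  using W_regular[OF Wp_W] by (metis abs_of_nonneg Wp_nonneg)

lemma Wp_Rats: "f \<in> Wp \<Longrightarrow> f i \<in> \<rat>"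
  using W_regular[OF Wp_W] by (metis abs_of_nonneg Wp_nonneg)

lemma Wp_abs: "f \<in> Wp \<Longrightarrow> abs_vec f = f"
  by (simp add: Wp_nonneg abs_vec_of_nonneg)

lemma W_trim:
  assumes "W f" "nat_interval E" "\<forall>F\<in>set Fs. valid_switch F"
  shows "W (trim E Fs f)"
  using assms(3)
proof (induction Fs)
  case Nil
  then show ?case using norming_weight_special.gamma[OF assms(1,2)] by (simp add: trim_Nil)
next
  case (Cons F Fs)
  then obtain q where "finite F" "card F = 2 * q" "1 \<le> q" "2 * q \<le> Min F"
    by (auto simp: valid_switch_def)
  then show ?case
    using norming_weight_special.zeta[of N1 \<sigma> "trim E Fs f" F q] Cons by (simp add: switch_trim)
qed

lemma Wp_trim:
  "f \<in> Wp \<Longrightarrow> nat_interval E \<Longrightarrow> \<forall>F\<in>set Fs. valid_switch F \<Longrightarrow> trim E Fs f \<in> Wp"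
  unfolding Wp_def by (simp add: W_trim trim_nonneg)

lemma Wp_restr: "f \<in> Wp \<Longrightarrow> nat_interval E \<Longrightarrow> restr E f \<in> Wp"
  using Wp_trim[of f E "[]"] by (simp add: trim_Nil)

lemma special_elim:
  assumes "special N1 \<sigma> j fs"
  shows "length fs = nseq (2 * j + 1)" "sorted_wrt block_less fs" "\<forall>f\<in>set fs. W f"
  using assms by (auto elim: special.cases)

lemma W_scaled_sum:
  assumes "2 \<le> i" "\<forall>h\<in>set fs. W h" "length fs = nseq i" "sorted_wrt block_less fs"
    "odd i \<longrightarrow> special N1 \<sigma> (i div 2) fs"
  shows "W (scaled_sum i fs)"
proof (cases "even i")
  case True
  then show ?thesis
    using norming_weight_special.delta[of "i div 2" fs N1 \<sigma>] assms by auto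
next
  case False
  moreover from this have "2 * (i div 2) + 1 = i" "1 \<le> i div 2"
    using assms(1) by auto
  ultimately show ?thesis
    using norming_weight_special.epsilon[of "i div 2" N1 \<sigma> fs] assms(5) by simp
qed

lemma wt_Wp: "wt i f \<Longrightarrow> f \<in> Wp"
  unfolding wt_def by (auto intro!: Wp_trim W_abs W_scaled_sum)

lemma wt_ge_2: "wt i f \<Longrightarrow> 2 \<le> i"
  by (simp add: wt_def)

lemma wt_scaled_sum:
  assumes "2 \<le> i" "\<forall>h\<in>set fs. W h" "length fs = nseq i" "sorted_wrt block_less fs"
    "odd i \<longrightarrow> special N1 \<sigma> (i div 2) fs"
  shows "wt i (abs_vec (scaled_sum i fs))"
  unfolding wt_def using assms
  by (intro conjI exI[of _ fs] exI[of _ UNIV] exI[of _ "[]"]) (auto simp: trim_UNIV_Nil)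

lemma wt_trim:
  assumes "wt i f" "nat_interval E"
  shows "wt i (restr E f)"
proof -
  obtain fs E' Fs where *: "\<forall>h\<in>set fs. W h" "length fs = nseq i"
     "sorted_wrt block_less fs" "odd i \<longrightarrow> special N1 \<sigma> (i div 2) fs"
     "nat_interval E'" "\<forall>F\<in>set Fs. valid_switch F" "f = trim E' Fs (abs_vec (scaled_sum i fs))"
    using assms(1) unfolding wt_def by blast
  show ?thesis
    unfolding wt_def using * assms wt_ge_2[OF assms(1)]
    by (intro conjI exI[of _ fs] exI[of _ "E' \<inter> E"] exI[of _ Fs])
      (auto simp: restr_trim nat_interval_Int)
qed

lemma wt_half_switch:
  assumes "wt i f" "valid_switch F"
  shows "wt i (\<lambda>t. switch F f t / 2)"
proof -
  obtain fs E' Fs where *: "\<forall>h\<in>set fs. W h" "length fs = nseq i"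
     "sorted_wrt block_less fs" "odd i \<longrightarrow> special N1 \<sigma> (i div 2) fs"
     "nat_interval E'" "\<forall>F\<in>set Fs. valid_switch F" "f = trim E' Fs (abs_vec (scaled_sum i fs))"
    using assms(1) unfolding wt_def by blast
  show ?thesis
    unfolding wt_def using * assms wt_ge_2[OF assms(1)]
    by (intro conjI exI[of _ fs] exI[of _ "E'"] exI[of _ "F # Fs"]) (auto simp: switch_trim)
qed

lemma wt_children:
  assumes "wt i f"
  obtains g where "\<And>l. l < nseq i \<Longrightarrow> g l \<in> Wp" "successive {..<nseq i} g"
    "f = (\<lambda>t. (\<Sum>l<nseq i. g l t) / mseq i)"
proof -
  obtain fs E Fs where *: "\<forall>h\<in>set fs. W h" "length fs = nseq i"
     "sorted_wrt block_less fs" "nat_interval E" "\<forall>F\<in>set Fs. valid_switch F"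
     "f = trim E Fs (abs_vec (scaled_sum i fs))"
    using assms(1) unfolding wt_def by blast
  have c: "\<forall>h\<in>set fs. h \<in> c00" using *(1) W_c00 by blast
  let ?g = "\<lambda>l. trim E Fs (abs_vec (fs ! l))"
  show ?thesis
  proof
    show "?g l \<in> Wp" if "l < nseq i" for l
      using * that by (intro Wp_trim W_abs) auto
    show "successive {..<nseq i} ?g"
      using *(2) supp_trim[of E Fs "abs_vec _"]
      by (intro successive_subset[OF successive_nth[OF c *(3)]]) auto
    show "f = (\<lambda>t. (\<Sum>l<nseq i. ?g l t) / mseq i)"
      unfolding *(6) abs_scaled_sum[OF c *(3)] *(2) trim_sum ..
  qed
qed

text \<open>Cutting and switching are absorbed by the outer \<open>trim\<close> of a weighted
  functional, and only rescale a coordinate functional. The factor \<open>c\<close> covers the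
  halves, and also 0 when the coordinate is cut away.\<close>

lemma W_structure:
  "W f \<Longrightarrow> (\<exists>n c. 0 \<le> c \<and> c \<le> 1 \<and> abs_vec f = (\<lambda>t. c * unit_vec n t)) \<or> (\<exists>i. wt i (abs_vec f))"
proof (induction rule: norming_weight_special.inducts(1)
    [of N1 \<sigma> f "\<lambda>f. (\<exists>n c. 0 \<le> c \<and> c \<le> 1 \<and> abs_vec f = (\<lambda>t. c * unit_vec n t)) \<or> (\<exists>i. wt i (abs_vec f))"
      "\<lambda>_ _. True" "\<lambda>_ _. True"])
  { case (alpha f g) then show ?case by simp }
  { case (beta_pos n)
    have "abs_vec (unit_vec n) = (\<lambda>t. 1 * unit_vec n t)"
      by (auto simp: abs_vec_def unit_vec_def fun_eq_iff)
    then show ?case using zero_le_one order_refl by blast }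
  { case (beta_neg n)
    have "abs_vec (\<lambda>i. - unit_vec n i) = (\<lambda>t. 1 * unit_vec n t)"
      by (auto simp: abs_vec_def unit_vec_def fun_eq_iff)
    then show ?case using zero_le_one order_refl by blast }
  { case (gamma f E)
    have e: "abs_vec (restr E f) = restr E (abs_vec f)"
      by (auto simp: abs_vec_def restr_def)
    from gamma(2) show ?case
    proof
      assume "\<exists>n c. 0 \<le> c \<and> c \<le> 1 \<and> abs_vec f = (\<lambda>t. c * unit_vec n t)"
      then obtain n c where c: "0 \<le> c" "c \<le> 1" "abs_vec f = (\<lambda>t. c * unit_vec n t)" by blast
      let ?c = "if n \<in> E then c else 0"
      have "0 \<le> ?c \<and> ?c \<le> 1 \<and> abs_vec (restr E f) = (\<lambda>t. ?c * unit_vec n t)"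
        unfolding e c(3) using c(1,2) by (auto simp: restr_def unit_vec_def)
      then show ?thesis by blast
    next
      assume "\<exists>i. wt i (abs_vec f)"
      then show ?thesis using wt_trim gamma(3) e by metis
    qed }
  { case (delta j fs)
    then have "wt (2 * j) (abs_vec (scaled_sum (2 * j) fs))"
      by (intro wt_scaled_sum) auto
    then show ?case by blast }
  { case (epsilon j fs)
    then have "wt (2 * j + 1) (abs_vec (scaled_sum (2 * j + 1) fs))"
      using special_elim[of j fs] by (intro wt_scaled_sum) auto
    then show ?case by blast }
  { case (zeta f F q)
    have e: "abs_vec (\<lambda>i. switch F f i / 2) = (\<lambda>t. switch F (abs_vec f) t / 2)"
      by (auto simp: abs_vec_def switch_eq restr_def)
    have v: "valid_switch F" using zeta by (auto simp: valid_switch_def)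
    from zeta(2) show ?case
    proof
      assume "\<exists>n c. 0 \<le> c \<and> c \<le> 1 \<and> abs_vec f = (\<lambda>t. c * unit_vec n t)"
      then obtain n c where c: "0 \<le> c" "c \<le> 1" "abs_vec f = (\<lambda>t. c * unit_vec n t)" by blast
      let ?c = "if n \<in> switch_set F then c / 2 else 0"
      have "0 \<le> ?c \<and> ?c \<le> 1 \<and> abs_vec (\<lambda>i. switch F f i / 2) = (\<lambda>t. ?c * unit_vec n t)"
        unfolding e c(3) using c(1,2) by (auto simp: switch_eq restr_def unit_vec_def)
      then show ?thesis by blast
    next
      assume "\<exists>i. wt i (abs_vec f)"
      then show ?thesis using wt_half_switch v e by metis
    qed }
qed simp_all

lemma Wp_cases:
  assumes "f \<in> Wp"
  obtains (unit) n c where "0 \<le> c" "c \<le> 1" "f = (\<lambda>t. c * unit_vec n t)"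
    | (weighted) i where "wt i f"
  using W_structure[OF Wp_W[OF assms]] Wp_abs[OF assms] by metis

end

section \<open>Block chains and rich families\<close>

lemma pairing_restr: "supp x \<subseteq> E \<Longrightarrow> pairing (restr E f) x = pairing f x"
  unfolding pairing_def restr_def by (intro sum.cong) auto

lemma supp_restr: "supp (restr E f) \<subseteq> supp f \<inter> E"
  by (auto simp: supp_def restr_def split: if_splits)

lemma successive_chain:
  assumes "\<And>n. v n \<in> c00" "\<And>n. supp (v n) \<noteq> {}" "\<And>n. supp (v (Suc n)) \<subseteq> {Max (supp (v n))<..}"
  shows "successive UNIV v"
proof -
  have step: "Max (supp (v n)) < Max (supp (v (Suc n)))" for n
    using assms(3)[of n] Max_in[OF finite_supp[OF assms(1)] assms(2), of "Suc n"] by auto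
  have "before (v k) (v k')" if less: "k < k'" for k k'
    unfolding before_def
  proof (intro ballI)
    fix s t assume st: "s \<in> supp (v k)" "t \<in> supp (v k')"
    obtain m where m: "k' = Suc m" "k \<le> m" using less by (cases k') auto
    have "s \<le> Max (supp (v k))" using st finite_supp[OF assms(1)] by simp
    also have "\<dots> \<le> Max (supp (v m))"
      by (rule lift_Suc_mono_le[of "\<lambda>n. Max (supp (v n))"]) (use step m in \<open>auto intro: less_imp_le\<close>)
    also have "\<dots> < t" using assms(3)[of m] st m by auto
    finally show "s < t" .
  qed
  then show ?thesis by (simp add: successive_def)
qed

text \<open>Stands in for the span of a block sequence. Linear combinations and nonzero vectors
  arbitrarily far out suffice for building averages, exact vectors and chains, so no basis is
  carried along.\<close>

definition rich :: "vec set \<Rightarrow> bool" where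
  "rich U \<longleftrightarrow> U \<subseteq> c00 \<and> (\<forall>x\<in>U. \<forall>y\<in>U. \<forall>a b. (\<lambda>i. a * x i + b * y i) \<in> U) \<and>
     (\<forall>N. \<exists>x\<in>U. supp x \<noteq> {} \<and> supp x \<subseteq> {N<..})"

lemma rich_c00: "rich U \<Longrightarrow> x \<in> U \<Longrightarrow> x \<in> c00"
  by (auto simp: rich_def)

lemma rich_lincomb: "rich U \<Longrightarrow> x \<in> U \<Longrightarrow> y \<in> U \<Longrightarrow> (\<lambda>i. a * x i + b * y i) \<in> U"
  by (simp add: rich_def)

lemma rich_scale: "rich U \<Longrightarrow> x \<in> U \<Longrightarrow> (\<lambda>i. a * x i) \<in> U"
  unfolding rich_def by (metis (no_types, lifting) add.right_neutral ext mult_zero_left)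

lemma rich_zero:
  assumes "rich U"
  shows "(\<lambda>i. 0) \<in> U"
proof -
  obtain x where "x \<in> U" using assms unfolding rich_def by blast
  from rich_scale[OF assms this, of 0] show ?thesis by simp
qed

lemma rich_sum:
  assumes "rich U" "\<And>k. k \<in> K \<Longrightarrow> x k \<in> U"
  shows "(\<lambda>i. \<Sum>k\<in>K. x k i) \<in> U"
  using assms(2)
proof (induction K rule: infinite_finite_induct)
  case (insert k K)
  then have "(\<lambda>i. 1 * x k i + 1 * (\<Sum>k\<in>K. x k i)) \<in> U"
    by (intro rich_lincomb[OF assms(1), of "x k"]) simp_all
  then show ?case using insert(1,2) by simp
qed (simp_all add: rich_zero[OF assms(1)])

context norming_space
begin

section \<open>The norm\<close>

lemma pairing_W_le: "W f \<Longrightarrow> pairing f x \<le> (\<Sum>i\<in>supp x. \<bar>x i\<bar>)"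
  unfolding pairing_def
proof (rule sum_mono)
  fix i assume "W f"
  then have "\<bar>f i\<bar> \<le> 1" using W_regular by blast
  then show "f i * x i \<le> \<bar>x i\<bar>"
    by (metis abs_ge_self abs_ge_zero abs_mult mult_left_le_one_le order.trans)
qed

lemma bdd_above_pairing: "bdd_above ((\<lambda>f. pairing f x) ` {f. W f})"
  by (rule bdd_aboveI2[of _ _ "\<Sum>i\<in>supp x. \<bar>x i\<bar>"]) (simp add: pairing_W_le)

lemma pairing_le_nrm: "W f \<Longrightarrow> pairing f x \<le> nrm x"
  unfolding W_norm_def by (rule cSUP_upper[OF _ bdd_above_pairing]) simp

lemma pairing_abs_le_nrm:
  assumes "f \<in> Wp"
  shows "pairing f (abs_vec x) \<le> nrm x"
proof -
  let ?g = "\<lambda>i. if 0 \<le> x i then f i else - f i"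
  have "abs_vec ?g = abs_vec f" by (auto simp: abs_vec_def)
  moreover have "supp ?g \<subseteq> supp f" by (auto simp: supp_def)
  then have "?g \<in> c00" using Wp_c00[OF assms] by (rule c00_subset[rotated])
  ultimately have "W ?g"
    using norming_weight_special.alpha[OF Wp_W[OF assms], of ?g] by simp
  moreover have "pairing ?g x = pairing f (abs_vec x)"
    unfolding pairing_def supp_abs by (intro sum.cong) (auto simp: abs_vec_def)
  ultimately show ?thesis using pairing_le_nrm by metis
qed

lemma W_nonempty: "{f. W f} \<noteq> {}"
  using norming_weight_special.beta_pos[of 1] by blast

lemma nrm_le:
  assumes "\<And>f. f \<in> Wp \<Longrightarrow> pairing f (abs_vec x) \<le> B"
  shows "nrm x \<le> B"
  unfolding W_norm_def
proof (rule cSUP_least[OF W_nonempty])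
  fix f assume "f \<in> {f. W f}"
  then have "pairing (abs_vec f) (abs_vec x) \<le> B" using assms W_abs by blast
  then show "pairing f x \<le> B" using pairing_abs_le[of f x] by linarith
qed

lemma nrm_approx: "c < nrm x \<Longrightarrow> \<exists>f\<in>Wp. c < pairing f (abs_vec x)"
  using nrm_le[of x c] by (meson not_le)

lemma unit_vec_Wp: "1 \<le> n \<Longrightarrow> unit_vec n \<in> Wp"
  using norming_weight_special.beta_pos[of n N1 \<sigma>] by (simp add: Wp_def unit_vec_def)

lemma coord_le_nrm:
  assumes "x \<in> c00"
  shows "\<bar>x i\<bar> \<le> nrm x"
proof -
  have "\<bar>x n\<bar> \<le> nrm x" if "1 \<le> n" for n
    using pairing_abs_le_nrm[OF unit_vec_Wp[OF that], of x] pairing_unit[of "abs_vec x" 1 n] assms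
    by (simp add: abs_vec_def[of x] c00_abs[unfolded abs_vec_def])
  moreover from this[of 1] have "0 \<le> nrm x" by linarith
  ultimately show ?thesis
    using assms by (cases "i = 0") (auto simp: c00_def)
qed

lemma nrm_nonneg: "x \<in> c00 \<Longrightarrow> 0 \<le> nrm x"
  using coord_le_nrm[of x 0] by linarith

lemma nrm_pos:
  assumes "x \<in> c00" "supp x \<noteq> {}"
  shows "0 < nrm x"
proof -
  obtain i where "x i \<noteq> 0" using assms by (auto simp: supp_def)
  then show ?thesis using coord_le_nrm[OF assms(1), of i] by linarith
qed

lemma nrm_mono:
  assumes "x \<in> c00" "y \<in> c00" "\<And>i. \<bar>x i\<bar> \<le> \<bar>y i\<bar>"
  shows "nrm x \<le> nrm y"
proof (rule nrm_le)
  fix f assume f: "f \<in> Wp"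
  have "pairing f (abs_vec x) \<le> pairing f (abs_vec y)"
    using assms f by (intro pairing_mono_right) (auto simp: Wp_nonneg abs_vec_def[of x] abs_vec_def[of y] c00_abs[unfolded abs_vec_def])
  then show "pairing f (abs_vec x) \<le> nrm y" using pairing_abs_le_nrm[OF f, of y] by linarith
qed

lemma nrm_scale_le:
  assumes "x \<in> c00"
  shows "nrm (\<lambda>i. a * x i) \<le> \<bar>a\<bar> * nrm x"
proof (rule nrm_le)
  fix f assume f: "f \<in> Wp"
  have "abs_vec (\<lambda>i. a * x i) = (\<lambda>i. \<bar>a\<bar> * abs_vec x i)" by (auto simp: abs_vec_def abs_mult)
  then have "pairing f (abs_vec (\<lambda>i. a * x i)) = \<bar>a\<bar> * pairing f (abs_vec x)"
    using assms by (simp add: pairing_scale_right)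
  then show "pairing f (abs_vec (\<lambda>i. a * x i)) \<le> \<bar>a\<bar> * nrm x"
    using pairing_abs_le_nrm[OF f, of x] by (simp add: mult_left_mono)
qed

lemma nrm_scale:
  assumes "x \<in> c00"
  shows "nrm (\<lambda>i. a * x i) = \<bar>a\<bar> * nrm x"
proof (cases "a = 0")
  case True
  then show ?thesis
    using nrm_scale_le[OF assms, of 0] nrm_nonneg[OF c00_zero] by simp
next
  case False
  have "nrm x \<le> \<bar>1 / a\<bar> * nrm (\<lambda>i. a * x i)"
    using nrm_scale_le[OF c00_scale[OF assms, of a], of "1 / a"] False by simp
  then have "\<bar>a\<bar> * nrm x \<le> nrm (\<lambda>i. a * x i)"
    using False by (simp add: field_simps)
  then show ?thesis using nrm_scale_le[OF assms, of a] by simp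
qed

text \<open>Cutting to the range of \<open>x\<close> by \<open>gamma\<close> costs nothing on
  \<open>x\<close>, and it makes functionals chosen for successive vectors successive
  (\<open>successive_hull\<close>), as the averaging rules require.\<close>

lemma norming_functional:
  assumes "x \<in> c00" "c < nrm x"
  shows "\<exists>f\<in>Wp. c < pairing f (abs_vec x) \<and> supp f \<subseteq> {Min (supp x)..Max (supp x)}"
proof -
  let ?E = "{Min (supp x)..Max (supp x)}"
  obtain f where f: "f \<in> Wp" "c < pairing f (abs_vec x)" using nrm_approx[OF assms(2)] by blast
  have "supp (abs_vec x) \<subseteq> ?E" using finite_supp[OF assms(1)] by auto
  then have "pairing (restr ?E f) (abs_vec x) = pairing f (abs_vec x)" by (rule pairing_restr)
  moreover have "restr ?E f \<in> Wp" using f by (intro Wp_restr) simp_all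
  moreover have "supp (restr ?E f) \<subseteq> ?E" using supp_restr by blast
  ultimately show ?thesis using f(2) by metis
qed

lemma successive_hull:
  assumes "successive K x" "\<And>k. k \<in> K \<Longrightarrow> x k \<in> c00" "\<And>k. k \<in> K \<Longrightarrow> supp (x k) \<noteq> {}"
    "\<And>k. k \<in> K \<Longrightarrow> supp (f k) \<subseteq> {Min (supp (x k))..Max (supp (x k))}"
  shows "successive K f"
  unfolding successive_def before_def
proof (intro ballI impI)
  fix k k' s t assume *: "k \<in> K" "k' \<in> K" "k < k'" "s \<in> supp (f k)" "t \<in> supp (f k')"
  have "s \<le> Max (supp (x k))" "Min (supp (x k')) \<le> t"
    using assms(4)[OF *(1)] assms(4)[OF *(2)] *(4,5) by auto
  moreover have "Max (supp (x k)) < Min (supp (x k'))"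
    using assms(1) * Max_in[OF finite_supp[OF assms(2)] assms(3), of k]
      Min_in[OF finite_supp[OF assms(2)] assms(3), of k']
    unfolding successive_def before_def by blast
  ultimately show "s < t" by linarith
qed

lemma scaled_sum_map: "scaled_sum k (map f [0..<n]) = (\<lambda>i. (\<Sum>l<n. f l i) / mseq k)"
  by (simp add: scaled_sum_eval fun_eq_iff)

lemma sorted_map_block_less:
  assumes "successive {..<n} f" "\<And>l. l < n \<Longrightarrow> f l \<in> c00" "\<And>l. l < n \<Longrightarrow> supp (f l) \<noteq> {}"
  shows "sorted_wrt block_less (map f [0..<n])"
  using assms by (auto simp: sorted_wrt_iff_nth_less successive_def intro!: before_block_less)

lemma even_average_wt:
  assumes "1 \<le> j" "successive {..<nseq (2 * j)} f"
    "\<And>l. l < nseq (2 * j) \<Longrightarrow> f l \<in> Wp" "\<And>l. l < nseq (2 * j) \<Longrightarrow> supp (f l) \<noteq> {}"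
  shows "wt (2 * j) (\<lambda>i. (\<Sum>l<nseq (2 * j). f l i) / mseq (2 * j))"
    and "weight N1 \<sigma> (\<lambda>i. (\<Sum>l<nseq (2 * j). f l i) / mseq (2 * j)) (2 * j)"
proof -
  let ?fs = "map f [0..<nseq (2 * j)]"
  let ?g = "\<lambda>i. (\<Sum>l<nseq (2 * j). f l i) / mseq (2 * j)"
  have s: "sorted_wrt block_less ?fs"
    using assms by (intro sorted_map_block_less) (auto intro: Wp_c00)
  have w: "\<forall>h\<in>set ?fs. W h" using assms(3) by (auto intro: Wp_W)
  have "abs_vec (scaled_sum (2 * j) ?fs) = ?g"
    unfolding scaled_sum_map
  proof (rule abs_vec_of_nonneg)
    show "0 \<le> ?g i" for i
      using Wp_nonneg[OF assms(3)] by (intro divide_nonneg_nonneg sum_nonneg) auto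
  qed
  then show wt: "wt (2 * j) ?g"
    using wt_scaled_sum[of "2 * j" ?fs] assms(1) s w by simp
  show "weight N1 \<sigma> ?g (2 * j)"
    using norming_weight_special.weight_even[of N1 \<sigma> ?g j ?fs UNIV]
      Wp_W[OF wt_Wp[OF wt]] assms(1) s w by (simp add: scaled_sum_map restr_def)
qed


section \<open>Averages of block sequences\<close>

text \<open>Each child of \<open>f\<close> sees only the vectors that it meets, so \<open>H\<close>
  is applied to those. By the staircase count the numbers met add up to at most
  \<open>card K + nseq i\<close> instead of \<open>nseq i * card K\<close>; this is why splitting a
  functional does not multiply the linear term.\<close>

lemma wt_step:
  fixes \<beta> \<gamma> :: real
  assumes f: "wt i f" and K: "finite K" "successive K d" "\<And>k. k \<in> K \<Longrightarrow> d k \<in> c00"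
    and "0 \<le> \<gamma>"
    and H: "\<And>g K'. g \<in> Wp \<Longrightarrow> K' \<subseteq> K \<Longrightarrow>
      \<bar>pairing g (\<lambda>t. \<Sum>k\<in>K'. d k t)\<bar> \<le> \<beta> + \<gamma> * card K'"
  shows "\<bar>pairing f (\<lambda>t. \<Sum>k\<in>K. d k t)\<bar> \<le>
      (real (nseq i) * \<beta> + \<gamma> * (real (card K) + real (nseq i))) / real (mseq i)"
proof -
  obtain g where g: "\<And>l. l < nseq i \<Longrightarrow> g l \<in> Wp" "successive {..<nseq i} g"
    "f = (\<lambda>t. (\<Sum>l<nseq i. g l t) / mseq i)"
    using wt_children[OF f] by blast
  define M where "M l = {k\<in>K. supp (g l) \<inter> supp (d k) \<noteq> {}}" for l
  let ?S = "\<lambda>K t. \<Sum>k\<in>K. d k t"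
  have "pairing (g l) (?S K) = pairing (g l) (?S (M l))" for l
  proof -
    have "pairing (g l) (?S K) = (\<Sum>k\<in>K. pairing (g l) (d k))"
      using K by (intro pairing_sum_right) auto
    also have "\<dots> = (\<Sum>k\<in>M l. pairing (g l) (d k))"
      using K(1) by (intro sum.mono_neutral_right) (auto simp: M_def pairing_disjoint)
    also have "\<dots> = pairing (g l) (?S (M l))"
      using K by (intro pairing_sum_right[symmetric]) (auto simp: M_def)
    finally show ?thesis .
  qed
  then have "\<bar>pairing (g l) (?S K)\<bar> \<le> \<beta> + \<gamma> * card (M l)" if "l < nseq i" for l
    using H[OF g(1)[OF that], of "M l"] by (auto simp: M_def)
  then have "\<bar>\<Sum>l<nseq i. pairing (g l) (?S K)\<bar> \<le> (\<Sum>l<nseq i. \<beta> + \<gamma> * card (M l))"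
    by (intro order.trans[OF sum_abs] sum_mono) auto
  also have "\<dots> = nseq i * \<beta> + \<gamma> * (\<Sum>l<nseq i. card (M l))"
    by (simp add: sum.distrib sum_distrib_left)
  also have "\<dots> \<le> nseq i * \<beta> + \<gamma> * (card K + nseq i)"
  proof -
    have "real (\<Sum>l<nseq i. card (M l)) \<le> real (card K + nseq i)"
      using card_meeting_pairs[OF K(1,2) g(2)] unfolding M_def of_nat_le_iff .
    then have "\<gamma> * real (\<Sum>l<nseq i. card (M l)) \<le> \<gamma> * real (card K + nseq i)"
      using \<open>0 \<le> \<gamma>\<close> by (rule mult_left_mono)
    then show ?thesis by simp
  qed
  finally have "\<bar>\<Sum>l<nseq i. pairing (g l) (?S K)\<bar> \<le> nseq i * \<beta> + \<gamma> * (card K + nseq i)" .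
  then show ?thesis
    unfolding g(3) by (simp add: pairing_divide_left pairing_sum_left divide_right_mono)
qed

text \<open>A functional is unfolded \<open>e\<close> times through weights of index below
  \<open>q\<close>: each level divides by at least 2 and has at most \<open>nseq (q - 1)\<close>
  children. Branches ending at a coordinate meet one vector and cost \<open>C\<close>, those ending
  at an index at least \<open>q\<close> are handled by \<open>leaf\<close>, and those surviving all
  levels have gained \<open>1 / 2 ^ e\<close>. It serves twice, for averages of rapidly increasing
  sequences and for the differences along a chain, where only \<open>leaf\<close> is
  specific.\<close>

lemma recursion:
  fixes C b \<tau> :: real
  assumes q: "2 \<le> q" and K: "finite K" "successive K d" "\<And>k. k \<in> K \<Longrightarrow> d k \<in> c00"
    and C: "0 \<le> C" "1 \<le> b" "0 \<le> \<tau>" "\<tau> \<le> 1"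
    and base: "\<And>g k. g \<in> Wp \<Longrightarrow> k \<in> K \<Longrightarrow> \<bar>pairing g (d k)\<bar> \<le> C"
    and leaf: "\<And>i g K'. wt i g \<Longrightarrow> q \<le> i \<Longrightarrow> K' \<subseteq> K \<Longrightarrow>
      \<bar>pairing g (\<lambda>t. \<Sum>k\<in>K'. d k t)\<bar> \<le> C * (b + \<tau> * card K')"
  shows "f \<in> Wp \<Longrightarrow> K' \<subseteq> K \<Longrightarrow> \<bar>pairing f (\<lambda>t. \<Sum>k\<in>K'. d k t)\<bar> \<le>
    C * (b * (2 * real (nseq (q - 1))) ^ e + (1 / 2 ^ e + \<tau>) * real (card K'))"
proof (induction e arbitrary: f K')
  case 0
  have "\<bar>pairing f (\<lambda>t. \<Sum>k\<in>K'. d k t)\<bar> = \<bar>\<Sum>k\<in>K'. pairing f (d k)\<bar>"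
    using K(3) 0 by (subst pairing_sum_right) auto
  also have "\<dots> \<le> (\<Sum>k\<in>K'. C)"
    using base 0 by (intro order.trans[OF sum_abs] sum_mono) auto
  also have "\<dots> \<le> C * (b + (1 + \<tau>) * card K')"
    using C by (simp add: algebra_simps)
  finally show ?case by simp
next
  case (Suc e)
  let ?n = "real (nseq (q - 1))" and ?k = "real (card K')"
  have finK: "finite K'" using Suc.prems K finite_subset by blast
  have n: "4 \<le> ?n" using nseq_ge_4[of "q - 1"] q by simp
  have P1: "1 \<le> (2 * ?n) ^ e" using n by (intro one_le_power) simp
  have big: "b \<le> b * (2 * ?n) ^ Suc e"
  proof -
    have "1 \<le> (2 * ?n) ^ Suc e" using n by (intro one_le_power) simp
    then show ?thesis using C mult_left_mono[of 1 "(2 * ?n) ^ Suc e" b] by simp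
  qed
  from Suc.prems(1) show ?case
  proof (cases rule: Wp_cases)
    case (unit n c)
    have "\<bar>\<Sum>k\<in>K'. pairing f (d k)\<bar> \<le> C"
    proof (cases "\<exists>k\<in>K'. d k n \<noteq> 0")
      case True
      then obtain k where k: "k \<in> K'" "d k n \<noteq> 0" by blast
      have "pairing f (d k') = 0" if "k' \<in> K'" "k' \<noteq> k" for k'
        using successive_disjoint[OF K(2), of k' k] that k Suc.prems(2) K(3) unit(3)
        by (auto simp: pairing_unit supp_def subset_iff)
      then have "(\<Sum>k\<in>K'. pairing f (d k)) = pairing f (d k)"
        using k finK by (subst sum.remove[of _ k]) auto
      then show ?thesis using base[of f k] k Suc.prems by auto
    next
      case False
      then have "pairing f (d k) = 0" if "k \<in> K'" for k
        using that K(3) Suc.prems(2) unit(3) by (auto simp: pairing_unit)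
      then show ?thesis using C by simp
    qed
    then have "\<bar>pairing f (\<lambda>t. \<Sum>k\<in>K'. d k t)\<bar> \<le> C"
      using K(3) Suc.prems by (subst pairing_sum_right) auto
    also have "\<dots> \<le> C * (b * (2 * ?n) ^ Suc e + (1 / 2 ^ Suc e + \<tau>) * ?k)"
    proof -
      have "1 \<le> b * (2 * ?n) ^ Suc e + (1 / 2 ^ Suc e + \<tau>) * ?k"
        using big C by (smt (verit) divide_nonneg_nonneg mult_nonneg_nonneg of_nat_0_le_iff zero_le_power)
      then show ?thesis using C mult_left_mono by fastforce
    qed
    finally show ?thesis by simp
  next
    case (weighted i)
    show ?thesis
    proof (cases "q \<le> i")
      case True
      have "\<bar>pairing f (\<lambda>t. \<Sum>k\<in>K'. d k t)\<bar> \<le> C * (b + \<tau> * ?k)"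
        using leaf[OF weighted True Suc.prems(2)] .
      also have "\<dots> \<le> C * (b * (2 * ?n) ^ Suc e + (1 / 2 ^ Suc e + \<tau>) * ?k)"
        using big C by (intro mult_left_mono add_mono mult_right_mono) auto
      finally show ?thesis by simp
    next
      case False
      let ?\<beta> = "C * (b * (2 * ?n) ^ e)" and ?\<gamma> = "C * (1 / 2 ^ e + \<tau>)"
      have i: "2 \<le> i" using wt_ge_2[OF weighted] .
      have "\<bar>pairing f (\<lambda>t. \<Sum>k\<in>K'. d k t)\<bar> \<le> (nseq i * ?\<beta> + ?\<gamma> * (?k + nseq i)) / mseq i"
      proof (rule wt_step[OF weighted finK])
        show "successive K' d" using K(2) Suc.prems(2) by (rule successive_subset) simp
        show "d k \<in> c00" if "k \<in> K'" for k using that K(3) Suc.prems by blast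
        show "0 \<le> ?\<gamma>" using C by simp
        show "\<bar>pairing g (\<lambda>t. \<Sum>k\<in>K''. d k t)\<bar> \<le> ?\<beta> + ?\<gamma> * card K''"
          if "g \<in> Wp" "K'' \<subseteq> K'" for g K''
          using Suc.IH[OF that(1), of K''] that(2) Suc.prems(2) by (simp add: algebra_simps)
      qed
      also have "\<dots> \<le> (?n * ?\<beta> + ?\<gamma> * (?k + ?n)) / 2"
      proof (rule frac_le)
        have "real (nseq i) \<le> ?n" using nseq_mono[of i "q - 1"] i False by simp
        moreover have "0 \<le> ?\<beta>" "0 \<le> ?\<gamma>" using C by simp_all
        ultimately show "nseq i * ?\<beta> + ?\<gamma> * (?k + nseq i) \<le> ?n * ?\<beta> + ?\<gamma> * (?k + ?n)"
          by (intro add_mono mult_right_mono mult_left_mono) auto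
        show "0 \<le> ?n * ?\<beta> + ?\<gamma> * (?k + ?n)"
          using \<open>0 \<le> ?\<beta>\<close> \<open>0 \<le> ?\<gamma>\<close> by simp
        show "2 \<le> real (mseq i)" using mseq_ge_2[of i] i by simp
      qed simp
      also have "\<dots> = C * (?n * (b * (2 * ?n) ^ e + (1 / 2 ^ e + \<tau>)) / 2 + (1 / 2 ^ e + \<tau>) / 2 * ?k)"
        by (simp add: field_simps)
      also have "\<dots> \<le> C * (b * (2 * ?n) ^ Suc e + (1 / 2 ^ Suc e + \<tau>) * ?k)"
      proof (intro mult_left_mono add_mono mult_right_mono)
        \<comment> \<open>The linear coefficient is at most 2, hence at most twice the constant
          term. Half of \<open>?n\<close> times three constant terms stays below
          \<open>2 * ?n\<close> times one; this is the origin of the base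
          \<open>2 * ?n\<close>.\<close>
        have "1 / 2 ^ e \<le> (1::real)" by simp
        then have "1 / 2 ^ e + \<tau> \<le> 2 * (b * (2 * ?n) ^ e)"
          using C mult_mono[OF C(2) P1] by linarith
        then have "?n * (b * (2 * ?n) ^ e + (1 / 2 ^ e + \<tau>)) \<le> ?n * (3 * (b * (2 * ?n) ^ e))"
          by (intro mult_left_mono) auto
        also have "\<dots> \<le> 2 * (b * (2 * ?n) ^ Suc e)"
          using C n by (simp add: algebra_simps)
        finally show "?n * (b * (2 * ?n) ^ e + (1 / 2 ^ e + \<tau>)) / 2 \<le> b * (2 * ?n) ^ Suc e" by simp
        show "(1 / 2 ^ e + \<tau>) / 2 \<le> 1 / 2 ^ Suc e + \<tau>" using C by simp
      qed (use C in auto)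
      finally show ?thesis by simp
    qed
  qed
qed

lemma block_sequence:
  assumes "rich U"
  shows "\<exists>v. (\<forall>t. v t \<in> U \<and> supp (v t) \<subseteq> {N<..} \<and> supp (v t) \<noteq> {} \<and> nrm (v t) = 1) \<and>
    successive UNIV v"
proof -
  have ex: "\<exists>v. v \<in> U \<and> supp v \<subseteq> {N<..} \<and> supp v \<noteq> {} \<and> nrm v = 1" for N
  proof -
    obtain x where x: "x \<in> U" "supp x \<noteq> {}" "supp x \<subseteq> {N<..}"
      using assms unfolding rich_def by blast
    have c: "x \<in> c00" using rich_c00[OF assms x(1)] .
    have p: "0 < nrm x" using nrm_pos[OF c x(2)] .
    have "supp (\<lambda>i. (1 / nrm x) * x i) = supp x" using p by (auto simp: supp_def)
    moreover have "nrm (\<lambda>i. (1 / nrm x) * x i) = 1" using p by (simp only: nrm_scale[OF c]) simp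
    ultimately show ?thesis using rich_scale[OF assms x(1)] x by metis
  qed
  have "\<exists>v. \<forall>n. (v n \<in> U \<and> supp (v n) \<subseteq> {N<..} \<and> supp (v n) \<noteq> {} \<and> nrm (v n) = 1) \<and>
      supp (v (Suc n)) \<subseteq> {Max (supp (v n))<..}"
  proof (rule dependent_nat_choice)
    show "\<exists>x. x \<in> U \<and> supp x \<subseteq> {N<..} \<and> supp x \<noteq> {} \<and> nrm x = 1" using ex .
    show "\<exists>y. (y \<in> U \<and> supp y \<subseteq> {N<..} \<and> supp y \<noteq> {} \<and> nrm y = 1) \<and> supp y \<subseteq> {Max (supp x)<..}"
      if "x \<in> U \<and> supp x \<subseteq> {N<..} \<and> supp x \<noteq> {} \<and> nrm x = 1" for x and n :: nat
    proof -
      obtain y where "y \<in> U" "supp y \<subseteq> {max N (Max (supp x))<..}" "supp y \<noteq> {}" "nrm y = 1"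
        using ex by blast
      moreover from this(2) have "supp y \<subseteq> {N<..}" "supp y \<subseteq> {Max (supp x)<..}" by auto
      ultimately show ?thesis by blast
    qed
  qed
  then obtain v where v: "\<And>n. v n \<in> U" "\<And>n. supp (v n) \<subseteq> {N<..}" "\<And>n. supp (v n) \<noteq> {}"
    "\<And>n. nrm (v n) = 1" "\<And>n. supp (v (Suc n)) \<subseteq> {Max (supp (v n))<..}" by blast
  moreover have "successive UNIV v"
    using v rich_c00[OF assms] by (intro successive_chain) auto
  ultimately show ?thesis by blast
qed

text \<open>If no average of \<open>k\<close> successive vectors of the unit ball had norm \<open>1/2\<close>, averages of
  \<open>k ^ d\<close> of them would have norm at most \<open>2 ^ -d\<close>, against the lower bound given by
  \<open>delta\<close>.\<close>

lemma l1_average: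
  assumes U: "rich U" and a: "1 \<le> a" and k: "k = 5 * nseq (2 * a - 1)"
  shows "\<exists>u. (\<forall>t<k. u t \<in> U \<and> supp (u t) \<subseteq> {N<..} \<and> nrm (u t) \<le> 1) \<and> successive {..<k} u \<and>
    real k / 2 \<le> nrm (\<lambda>i. \<Sum>t<k. u t i)"
proof (rule ccontr)
  assume contra: "\<not> ?thesis"
  define good where "good v \<longleftrightarrow> (\<forall>t. v t \<in> U \<and> supp (v t) \<subseteq> {N<..} \<and> nrm (v t) \<le> 1) \<and>
    successive UNIV v" for v :: "nat \<Rightarrow> vec"
  have kpos: "0 < k"
  proof -
    have "1 \<le> 2 * a - 1" using a by linarith
    then show ?thesis using nseq_ge_4[of "2 * a - 1"] k by linarith
  qed
  have small: "nrm (\<lambda>i. \<Sum>t<k. u t i) < real k / 2"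
    if "\<forall>t<k. u t \<in> U \<and> supp (u t) \<subseteq> {N<..} \<and> nrm (u t) \<le> 1" "successive {..<k} u" for u
    using contra that by (meson not_le)
  have iter: "nrm (\<lambda>i. \<Sum>t<k ^ d. v t i) \<le> (real k / 2) ^ d" if "good v" for d v
    using that
  proof (induction d arbitrary: v)
    case 0
    then show ?case by (simp add: good_def)
  next
    case (Suc d)
    \<comment> \<open>Sums of \<open>k\<close> consecutive vectors, scaled by \<open>2 / k\<close>:
      the contrary assumption returns them to the unit ball, so the grouping can be
      repeated.\<close>
    define S where "S t = (\<lambda>i. \<Sum>s<k. v (t * k + s) i)" for t
    define v' where "v' t = (\<lambda>i. (2 / real k) * S t i)" for t
    have v: "v t \<in> U" "supp (v t) \<subseteq> {N<..}" "nrm (v t) \<le> 1" for t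
      using Suc.prems by (auto simp: good_def)
    have sv: "successive UNIV v" using Suc.prems by (auto simp: good_def)
    have SU: "S t \<in> U" for t unfolding S_def by (intro rich_sum[OF U] v)
    have supS: "supp (S t) \<subseteq> (\<Union>s<k. supp (v (t * k + s)))" for t
      unfolding S_def by (rule supp_sum)
    have supv': "supp (v' t) \<subseteq> supp (S t)" for t by (auto simp: v'_def supp_def)
    have "good v'"
      unfolding good_def
    proof (intro conjI allI)
      fix t
      show "v' t \<in> U" unfolding v'_def by (rule rich_scale[OF U SU])
      show "supp (v' t) \<subseteq> {N<..}" using supv' supS v(2) by blast
      have "successive {..<k} (\<lambda>s. v (t * k + s))" using sv by (auto simp: successive_def)
      then have "nrm (S t) < real k / 2"
        unfolding S_def using v by (intro small) auto
      then have "(2 / real k) * nrm (S t) \<le> 1" using kpos by (simp add: field_simps)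
      then show "nrm (v' t) \<le> 1"
        unfolding v'_def using kpos by (simp only: nrm_scale[OF rich_c00[OF U SU]]) simp
    next
      show "successive UNIV v'"
        unfolding successive_def before_def
      proof (intro ballI impI)
        fix t t' s s' assume *: "(t::nat) < t'" "s \<in> supp (v' t)" "s' \<in> supp (v' t')"
        obtain r r' where r: "r < k" "r' < k" "s \<in> supp (v (t * k + r))" "s' \<in> supp (v (t' * k + r'))"
          using * supv' supS by blast
        have "t * k + r < Suc t * k" using r by simp
        also have "\<dots> \<le> t' * k" using * by (intro mult_le_mono1) simp
        finally have "t * k + r < t' * k + r'" by simp
        then show "s < s'" using sv r by (auto simp: successive_def before_def)
      qed
    qed
    then have IH: "nrm (\<lambda>i. \<Sum>t<k ^ d. v' t i) \<le> (real k / 2) ^ d" by (rule Suc.IH)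
    have c: "(\<lambda>i. \<Sum>t<k ^ d. v' t i) \<in> c00"
      using \<open>good v'\<close> by (intro c00_sum) (auto simp: good_def intro: rich_c00[OF U])
    have "(\<Sum>t<k ^ Suc d. v t i) = (real k / 2) * (\<Sum>t<k ^ d. v' t i)" for i
    proof -
      have "(\<Sum>t<k ^ Suc d. v t i) = (\<Sum>t<k ^ d. \<Sum>s=t * k..<t * k + k. v s i)"
        using sum.nat_group[of "\<lambda>t. v t i" k "k ^ d"] by (simp add: mult.commute)
      also have "\<dots> = (\<Sum>t<k ^ d. S t i)"
      proof (intro sum.cong refl)
        fix t
        show "(\<Sum>s=t * k..<t * k + k. v s i) = S t i"
          using sum.atLeastLessThan_shift_0[of "\<lambda>s. v s i" "t * k" "t * k + k"]
          by (simp add: S_def atLeast0LessThan add.commute)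
      qed
      also have "\<dots> = (real k / 2) * (\<Sum>t<k ^ d. v' t i)"
        using kpos by (simp add: v'_def sum_distrib_left)
      finally show ?thesis .
    qed
    then have "nrm (\<lambda>i. \<Sum>t<k ^ Suc d. v t i) = (real k / 2) * nrm (\<lambda>i. \<Sum>t<k ^ d. v' t i)"
      by (simp only: nrm_scale[OF c] abs_divide abs_of_nat abs_numeral)
    also have "\<dots> \<le> (real k / 2) * (real k / 2) ^ d" using IH by (intro mult_left_mono) auto
    finally show ?case by simp
  qed
  obtain v where v: "\<And>t. v t \<in> U" "\<And>t. supp (v t) \<subseteq> {N<..}" "\<And>t. supp (v t) \<noteq> {}"
    "\<And>t. nrm (v t) = 1" "successive UNIV v"
    using block_sequence[OF U] by blast
  have c: "v t \<in> c00" for t using rich_c00[OF U v(1)] .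
  have "\<exists>f. f \<in> Wp \<and> 1 / 2 < pairing f (abs_vec (v t)) \<and>
      supp f \<subseteq> {Min (supp (v t))..Max (supp (v t))}" for t
    using norming_functional[OF c, of "1 / 2" t] v(4) by auto
  then obtain f where f: "\<And>t. f t \<in> Wp" "\<And>t. 1 / 2 < pairing (f t) (abs_vec (v t))"
    "\<And>t. supp (f t) \<subseteq> {Min (supp (v t))..Max (supp (v t))}" by metis
  \<comment> \<open>As \<open>?n = k ^ sseq (2 * a - 1)\<close>, \<open>iter\<close> at that depth
    bounds the norm of a sum of \<open>?n\<close> vectors by \<open>?n / ?m ^ 3\<close>. The average
    \<open>F\<close> of their functionals gives at least \<open>?n / (2 * ?m)\<close>, which is
    impossible for \<open>?m \<ge> 2\<close>.\<close>
  let ?n = "nseq (2 * a)" and ?m = "real (mseq (2 * a))"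
  define F where "F = (\<lambda>i. (\<Sum>l<?n. f l i) / ?m)"
  have "successive {..<?n} f"
    by (rule successive_hull[OF successive_subset[OF v(5)]]) (rule subset_UNIV order_refl c v(3) f(3))+
  moreover have "supp (f l) \<noteq> {}" for l
    using f(2)[of l] pairing_disjoint[of "f l" "abs_vec (v l)"] by force
  ultimately have "F \<in> Wp"
    unfolding F_def using f(1) by (intro wt_Wp[OF even_average_wt(1)[OF a]]) simp_all
  define x where "x = (\<lambda>i. \<Sum>t<?n. v t i)"
  have absx: "abs_vec x = (\<lambda>i. \<Sum>t<?n. abs_vec (v t) i)"
    unfolding x_def abs_vec_def using v(5)
    by (auto simp: fun_eq_iff successive_def intro!: successive_abs_sum)
  have m: "2 \<le> ?m" using mseq_ge_2[of "2 * a"] a by simp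
  have "real ?n / 2 / ?m \<le> pairing F (abs_vec x)"
  proof -
    have "real ?n / 2 = (\<Sum>l<?n. 1 / 2)" by simp
    also have "\<dots> \<le> (\<Sum>l<?n. pairing (f l) (abs_vec (v l)))"
      using f(2) by (intro sum_mono less_imp_le) auto
    also have "\<dots> \<le> (\<Sum>l<?n. pairing (f l) (abs_vec x))"
    proof (intro sum_mono pairing_mono_right)
      fix l i assume l: "l \<in> {..<?n}"
      show "abs_vec (v l) i \<le> abs_vec x i"
        unfolding absx using l by (intro member_le_sum) (auto simp: abs_vec_nonneg)
      show "abs_vec x \<in> c00" unfolding x_def c00_abs by (intro c00_sum c)
    qed (use c f(1) Wp_nonneg in auto)
    finally show ?thesis
      unfolding F_def pairing_divide_left pairing_sum_left using m by (intro divide_right_mono) auto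
  qed
  also have "\<dots> \<le> nrm x" using pairing_abs_le_nrm[OF \<open>F \<in> Wp\<close>] .
  also have "\<dots> \<le> (real k / 2) ^ sseq (2 * a - 1)"
  proof -
    have "?n = k ^ sseq (2 * a - 1)"
      using nseq_step[of "2 * a - 1"] a k by simp
    then show ?thesis unfolding x_def using iter[of v "sseq (2 * a - 1)"] v
      by (simp add: good_def)
  qed
  also have "\<dots> = real ?n / ?m ^ 3"
  proof -
    have "real ?n = real k ^ sseq (2 * a - 1)"
      using nseq_step[of "2 * a - 1"] a k by simp
    moreover have "2 ^ sseq (2 * a - 1) = ?m ^ 3"
      using arg_cong[OF two_power_sseq[of "2 * a - 1"], of real] a by simp
    ultimately show ?thesis by (simp add: power_divide)
  qed
  finally have "real ?n / 2 / ?m \<le> real ?n / ?m ^ 3" .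
  moreover have "0 < real ?n" using nseq_ge_4[of "2 * a"] a by simp
  ultimately have "?m ^ 3 \<le> 2 * ?m" using m by (simp add: field_simps)
  then have "?m ^ 2 \<le> 2" using m by (simp add: power2_eq_square power3_eq_cube)
  moreover have "4 \<le> ?m ^ 2" using m power_mono[of 2 ?m 2] by simp
  ultimately show False by simp
qed

text \<open>Dividing by the value of a fixed functional, and not by the norm, makes the pairing
  exactly 1, so that pieces from the two subspaces can cancel exactly later on. That value exceeds
  \<open>k / 4\<close>; hence the trivial bound \<open>k\<close> on the sum becomes 4, rounded up to
  8, and the bound \<open>2 * k / mseq i\<close> after one splitting becomes
  \<open>8 / mseq i\<close>.\<close>

lemma piece:
  assumes U: "rich U"
  shows "\<exists>u f. u \<in> U \<and> supp u \<subseteq> {N<..} \<and> supp u \<noteq> {} \<and> f \<in> Wp \<and>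
    supp f \<subseteq> {Min (supp u)..Max (supp u)} \<and> pairing f (abs_vec u) = 1 \<and>
    (\<forall>g\<in>Wp. pairing g (abs_vec u) \<le> 8) \<and>
    (\<forall>i<j. \<forall>g. wt i g \<longrightarrow> pairing g (abs_vec u) \<le> 8 / mseq i)"
proof -
  \<comment> \<open>The index is \<open>2 * j + 1\<close>, so \<open>k\<close> exceeds
    \<open>nseq i\<close> for every \<open>i < j\<close>: in one splitting the children do not
    outnumber the summands.\<close>
  define k where "k = 5 * nseq (2 * Suc j - 1)"
  obtain w where w: "\<And>t. t < k \<Longrightarrow> w t \<in> U" "\<And>t. t < k \<Longrightarrow> supp (w t) \<subseteq> {N<..}"
    "\<And>t. t < k \<Longrightarrow> nrm (w t) \<le> 1" "successive {..<k} w" "real k / 2 \<le> nrm (\<lambda>i. \<Sum>t<k. w t i)"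
    using l1_average[OF U _ k_def, of N] by auto
  define x where "x = (\<lambda>i. \<Sum>t<k. w t i)"
  have k0: "0 < k" using nseq_ge_4[of "2 * Suc j - 1"] by (simp add: k_def)
  have wc: "w t \<in> c00" if "t < k" for t using rich_c00[OF U w(1)[OF that]] .
  have xU: "x \<in> U" unfolding x_def using w(1) by (intro rich_sum[OF U]) auto
  then have xc: "x \<in> c00" using rich_c00[OF U] by blast
  have absx: "abs_vec x = (\<lambda>i. \<Sum>t<k. abs_vec (w t) i)"
    unfolding x_def abs_vec_def using successive_abs_sum[OF w(4)] by (auto simp: fun_eq_iff)
  have sub: "\<bar>pairing g (\<lambda>i. \<Sum>t\<in>K'. abs_vec (w t) i)\<bar> \<le> 0 + 1 * real (card K')"
    if "g \<in> Wp" "K' \<subseteq> {..<k}" for g K'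
  proof -
    have "pairing g (\<lambda>i. \<Sum>t\<in>K'. abs_vec (w t) i) = (\<Sum>t\<in>K'. pairing g (abs_vec (w t)))"
      using that wc by (intro pairing_sum_right) auto
    also have "\<bar>\<dots>\<bar> \<le> (\<Sum>t\<in>K'. 1)"
    proof (intro order.trans[OF sum_abs] sum_mono)
      fix t assume "t \<in> K'"
      then have "t < k" using that by auto
      then have "pairing g (abs_vec (w t)) \<le> 1"
        using pairing_abs_le_nrm[OF that(1), of "w t"] w(3)[of t] by linarith
      then show "\<bar>pairing g (abs_vec (w t))\<bar> \<le> 1"
        using pairing_nonneg[of g "abs_vec (w t)"] that(1) by (simp add: Wp_nonneg abs_vec_nonneg)
    qed
    finally show ?thesis by simp
  qed
  have gx: "pairing g (abs_vec x) \<le> k" if "g \<in> Wp" for g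
    using sub[OF that, of "{..<k}"] by (simp add: absx)
  have gxw: "pairing g (abs_vec x) \<le> 2 * real k / mseq i" if "i < j" "wt i g" for i g
  proof -
    have "\<bar>pairing g (\<lambda>i. \<Sum>t<k. abs_vec (w t) i)\<bar> \<le>
        (real (nseq i) * 0 + 1 * (real (card {..<k}) + real (nseq i))) / real (mseq i)"
      using sub w(4) wc by (intro wt_step[OF that(2)]) (auto intro: successive_subset)
    moreover have "nseq i \<le> k"
      using nseq_mono[of i "2 * Suc j - 1"] that wt_ge_2[OF that(2)] by (simp add: k_def)
    ultimately have "pairing g (abs_vec x) \<le> (real k + real (nseq i)) / mseq i"
      by (simp add: absx)
    also have "\<dots> \<le> 2 * real k / mseq i"
      using \<open>nseq i \<le> k\<close> by (intro divide_right_mono) auto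
    finally show ?thesis .
  qed
  have "real k / 4 < nrm x" using w(5) k0 unfolding x_def by linarith
  then obtain f where f: "f \<in> Wp" "real k / 4 < pairing f (abs_vec x)"
      "supp f \<subseteq> {Min (supp x)..Max (supp x)}"
    using norming_functional[OF xc] by blast
  define c where "c = pairing f (abs_vec x)"
  define u where "u = (\<lambda>i. (1 / c) * x i)"
  have c0: "real k / 4 < c" "0 < c" using f(2) k0 unfolding c_def by linarith+
  have su: "supp u = supp x" using c0 by (auto simp: u_def supp_def)
  have absu: "abs_vec u = (\<lambda>i. (1 / c) * abs_vec x i)"
    using c0 by (auto simp: u_def abs_vec_def abs_mult)
  have pu: "pairing g (abs_vec u) = pairing g (abs_vec x) / c" for g
    unfolding absu using xc by (subst pairing_scale_right) auto
  have "supp x \<subseteq> {N<..}"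
    using supp_sum[of w "{..<k}"] w(2) unfolding x_def by blast
  moreover have "supp x \<noteq> {}"
  proof
    assume "supp x = {}"
    then have "c = 0" unfolding c_def by (intro pairing_disjoint) simp
    then show False using c0 by simp
  qed
  moreover have "pairing g (abs_vec u) \<le> 8" if "g \<in> Wp" for g
    using gx[OF that] c0 k0 by (simp add: pu divide_le_eq)
  moreover have "pairing g (abs_vec u) \<le> 8 / mseq i" if "i < j" "wt i g" for i g
  proof -
    have "pairing g (abs_vec x) / c \<le> (2 * real k / mseq i) / c"
      using gxw[OF that] c0 by (intro divide_right_mono) auto
    also have "\<dots> \<le> (8 * c / mseq i) / c"
      using c0 by (intro divide_right_mono) auto
    finally show ?thesis using c0 by (simp add: pu)
  qed
  moreover have "pairing f (abs_vec u) = 1" using c0 by (simp add: pu flip: c_def)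
  moreover have "u \<in> U" unfolding u_def by (rule rich_scale[OF U xU])
  ultimately show ?thesis using f su by metis
qed

end

section \<open>Exact vectors distributed over two subspaces\<close>

lemma sum_exceptions:
  fixes a :: "'i \<Rightarrow> real"
  assumes "finite K" "finite X" "real (card X) \<le> x" "0 \<le> B" "0 \<le> c"
    "\<And>k. k \<in> K \<Longrightarrow> k \<in> X \<Longrightarrow> a k \<le> B" "\<And>k. k \<in> K \<Longrightarrow> k \<notin> X \<Longrightarrow> a k \<le> c"
  shows "(\<Sum>k\<in>K. a k) \<le> x * B + c * card K"
proof -
  have "(\<Sum>k\<in>K. a k) = (\<Sum>k\<in>K \<inter> X. a k) + (\<Sum>k\<in>K - X. a k)"
    using sum.union_disjoint[of "K \<inter> X" "K - X" a] assms(1)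
    by (simp add: Int_Diff_Un Int_Diff_disjoint)
  also have "\<dots> \<le> (\<Sum>k\<in>K \<inter> X. B) + (\<Sum>k\<in>K - X. c)"
    using assms(6,7) by (intro add_mono sum_mono) auto
  also have "\<dots> = card (K \<inter> X) * B + c * card (K - X)" by simp
  also have "\<dots> \<le> x * B + c * card K"
  proof (intro add_mono mult_right_mono mult_left_mono)
    have "card (K \<inter> X) \<le> card X" using assms(2) by (intro card_mono) auto
    then show "real (card (K \<inter> X)) \<le> x" using assms(3) by linarith
    show "real (card (K - X)) \<le> real (card K)" using assms(1) by (simp add: card_mono)
  qed (use assms in auto)
  finally show ?thesis .
qed

lemma mseq_ge_self: "i \<le> mseq i"
proof (cases i)
  case (Suc j)
  have "j < 2 ^ j" by (rule less_exp)
  then have "Suc j \<le> 2 ^ j" by (rule Suc_leI)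
  also have "(2::nat) ^ j \<le> 2 ^ (5 ^ j)"
    using less_exp[of j] power_mono[of 2 5 j] by (intro power_increasing) simp_all
  finally show ?thesis using Suc by (simp only: mseq_Suc)
qed simp

section \<open>Points where intervals and switching sets change\<close>

lemma nat_interval_boundary:
  assumes "nat_interval E"
  obtains G where "finite G" "card G \<le> 2"
    "\<And>a b. {a..b} \<inter> G = {} \<Longrightarrow> {a..b} \<subseteq> E \<or> {a..b} \<inter> E = {}"
proof (cases "E = {}")
  case True
  then show ?thesis using that[of "{}"] by simp
next
  case False
  define p where "p = (LEAST s. s \<in> E)"
  \<comment> \<open>If \<open>E\<close> is unbounded there is no such \<open>t\<close> and
    \<open>r\<close> is arbitrary. This is harmless: a further point in the exceptional set only
    strengthens the disjointness assumption.\<close>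
  define r where "r = (LEAST t. t \<notin> E \<and> p < t)"
  have pE: "p \<in> E" and pmin: "s \<in> E \<Longrightarrow> p \<le> s" for s
    using False unfolding p_def by (auto intro: LeastI Least_le)
  show ?thesis
  proof (rule that)
    show "finite {p, r}" "card {p, r} \<le> 2" by (simp_all add: card_insert_if)
    fix a b assume d: "{a..b} \<inter> {p, r} = {}"
    show "{a..b} \<subseteq> E \<or> {a..b} \<inter> E = {}"
    proof (rule ccontr)
      assume "\<not> ?thesis"
      then obtain s t where st: "s \<in> {a..b}" "t \<in> {a..b}" "s \<in> E" "t \<notin> E" by blast
      have "p \<le> s" using pmin st by blast
      show False
      proof (cases "t < s")
        case True
        have "\<not> p \<le> t"
        proof
          assume "p \<le> t"
          then have "t \<in> {p..s}" using True by simp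
          then show False using assms pE st unfolding nat_interval_def by blast
        qed
        then show False using d st \<open>p \<le> s\<close> by auto
      next
        case False
        then have "p < t" using st \<open>p \<le> s\<close> by (metis le_neq_implies_less le_trans not_le)
        then have r: "r \<notin> E" "p < r" "r \<le> t"
          using LeastI[of "\<lambda>t. t \<notin> E \<and> p < t" t] Least_le[of "\<lambda>t. t \<notin> E \<and> p < t" t] st
          by (auto simp: r_def)
        have "\<not> r \<le> s"
        proof
          assume "r \<le> s"
          then have "r \<in> {p..s}" using r by simp
          then show False using assms pE st r unfolding nat_interval_def by blast
        qed
        then show False using d st r by auto
      qed
    qed
  qed
qed

lemma switch_set_boundary:
  assumes "finite F" "{a..b} \<inter> F = {}"
  shows "{a..b} \<subseteq> switch_set F \<or> {a..b} \<inter> switch_set F = {}"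
proof (rule ccontr)
  assume "\<not> ?thesis"
  then obtain s t where st: "s \<in> {a..b}" "t \<in> {a..b}" "s \<in> switch_set F" "t \<notin> switch_set F"
    by blast
  let ?L = "sorted_list_of_set F"
  obtain p where p: "p < card F div 2" "?L ! (2 * p) \<le> s" "s < ?L ! (2 * p + 1)"
    using st(3) by (auto simp: switch_set_def)
  have len: "length ?L = card F" by simp
  have "?L ! (2 * p) \<in> set ?L" "?L ! (2 * p + 1) \<in> set ?L"
    using p(1) len by (intro nth_mem, linarith)+
  then have F: "?L ! (2 * p) \<in> F" "?L ! (2 * p + 1) \<in> F" using assms(1) by simp_all
  have "t < ?L ! (2 * p) \<or> ?L ! (2 * p + 1) \<le> t"
    using st(4) p(1) unfolding switch_set_def by (meson UN_I atLeastLessThan_iff lessThan_iff not_le)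
  then have "?L ! (2 * p) \<in> {a..b} \<or> ?L ! (2 * p + 1) \<in> {a..b}"
    using st p by auto
  then show False using F assms(2) by blast
qed

text \<open>Membership in an interval or a switching set changes only at its end points, so on a
  stretch free of these the operator is a single scalar, the same for all vectors supported there.
  Neighbouring pieces inside one such stretch are therefore treated alike. The count is two for the
  interval and one for each element of each switching set.\<close>

lemma trim_boundary:
  assumes "nat_interval E" "\<forall>F\<in>set Fs. finite F"
  obtains G where "finite G" "card G \<le> 2 + (\<Sum>F\<leftarrow>Fs. card F)"
    "\<And>a b. {a..b} \<inter> G = {} \<Longrightarrow>
      (\<forall>v. supp v \<subseteq> {a..b} \<longrightarrow> trim E Fs v = (\<lambda>t. v t / 2 ^ length Fs)) \<or>
      (\<forall>v. supp v \<subseteq> {a..b} \<longrightarrow> trim E Fs v = (\<lambda>t. 0))"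
proof -
  obtain G where G: "finite G" "card G \<le> 2"
    "\<And>a b. {a..b} \<inter> G = {} \<Longrightarrow> {a..b} \<subseteq> E \<or> {a..b} \<inter> E = {}"
    using nat_interval_boundary[OF assms(1)] by blast
  have cF: "card (\<Union>(set Fs)) \<le> (\<Sum>F\<leftarrow>Fs. card F)"
  proof (induction Fs)
    case (Cons F Fs)
    have "card (\<Union>(set (F # Fs))) \<le> card F + card (\<Union>(set Fs))"
      using card_Un_le[of F "\<Union>(set Fs)"] by simp
    then show ?case using Cons by simp
  qed simp
  show ?thesis
  proof (rule that)
    show "finite (G \<union> \<Union>(set Fs))" using G assms by auto
    show "card (G \<union> \<Union>(set Fs)) \<le> 2 + (\<Sum>F\<leftarrow>Fs. card F)"
      using card_Un_le[of G "\<Union>(set Fs)"] G(2) cF by linarith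
    fix a b assume d: "{a..b} \<inter> (G \<union> \<Union>(set Fs)) = {}"
    have E: "{a..b} \<subseteq> E \<or> {a..b} \<inter> E = {}" using d G(3) by blast
    have F: "{a..b} \<subseteq> switch_set F \<or> {a..b} \<inter> switch_set F = {}" if "F \<in> set Fs" for F
      using switch_set_boundary[of F a b] assms(2) that d by blast
    show "(\<forall>v. supp v \<subseteq> {a..b} \<longrightarrow> trim E Fs v = (\<lambda>t. v t / 2 ^ length Fs)) \<or>
      (\<forall>v. supp v \<subseteq> {a..b} \<longrightarrow> trim E Fs v = (\<lambda>t. 0))"
    proof (cases "{a..b} \<subseteq> E \<and> (\<forall>F\<in>set Fs. {a..b} \<subseteq> switch_set F)")
      case True
      have "trim E Fs v t = v t / 2 ^ length Fs" if "supp v \<subseteq> {a..b}" for v t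
      proof (cases "t \<in> {a..b}")
        case False
        then have "v t = 0" using that by (auto simp: supp_def)
        then show ?thesis by (simp add: trim_def)
      next
        case t: True
        have "t \<in> E \<and> (\<forall>F\<in>set Fs. t \<in> switch_set F)" using True t by blast
        then show ?thesis unfolding trim_def by (rule if_P)
      qed
      then show ?thesis by blast
    next
      case False
      have "trim E Fs v t = 0" if "supp v \<subseteq> {a..b}" for v t
      proof (cases "t \<in> {a..b}")
        case t: True
        have "\<not> (t \<in> E \<and> (\<forall>F\<in>set Fs. t \<in> switch_set F))" using False E F t by blast
        then show ?thesis unfolding trim_def by (rule if_not_P)
      next
        case t: False
        then have "v t = 0" using that by (auto simp: supp_def)
        then show ?thesis by (simp add: trim_def)
      qed
      then show ?thesis by blast
    qed
  qed
qed

lemma card_hitting: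
  assumes "finite H" "finite G" "\<And>h. h \<in> H \<Longrightarrow> I h \<inter> G \<noteq> {}"
    "\<And>h h'. h \<in> H \<Longrightarrow> h' \<in> H \<Longrightarrow> h \<noteq> h' \<Longrightarrow> I h \<inter> I h' = {}"
  shows "card H \<le> card G"
proof -
  have "\<exists>f. \<forall>h\<in>H. f h \<in> I h \<inter> G" using assms(3) by (intro bchoice) blast
  then obtain f where f: "\<And>h. h \<in> H \<Longrightarrow> f h \<in> I h \<inter> G" by blast
  have "inj_on f H"
  proof (rule inj_onI, rule ccontr)
    fix h h' assume "h \<in> H" "h' \<in> H" "f h = f h'" "h \<noteq> h'"
    then show False using f[of h] f[of h'] assms(4)[of h h'] by auto
  qed
  then show ?thesis using f assms(2) by (intro card_inj_on_le[of f]) auto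
qed

section \<open>Rapidly increasing sequences and exact vectors\<close>

context norming_space
begin

lemma wt_coord_le:
  assumes "wt i f"
  shows "f t \<le> 1 / mseq i"
proof -
  obtain g where g: "\<And>l. l < nseq i \<Longrightarrow> g l \<in> Wp" "successive {..<nseq i} g"
    "f = (\<lambda>t. (\<Sum>l<nseq i. g l t) / mseq i)"
    using wt_children[OF assms] by blast
  have "(\<Sum>l<nseq i. g l t) \<le> 1"
  proof (cases "\<exists>l<nseq i. g l t \<noteq> 0")
    case True
    then obtain l where l: "l < nseq i" "g l t \<noteq> 0" by blast
    have "g l' t = 0" if "l' < nseq i" "l' \<noteq> l" for l'
      using successive_disjoint[OF g(2), of l' l] that l by (auto simp: supp_def)
    then have "(\<Sum>l<nseq i. g l t) = g l t"
      using l by (subst sum.remove[of _ l]) (auto intro!: sum.neutral)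
    then show ?thesis using Wp_le_1[OF g(1)[OF l(1)]] by simp
  qed (simp add: sum.neutral)
  then show ?thesis unfolding g(3) by (intro divide_right_mono) auto
qed

lemma wt_pairing_le_sum:
  assumes "wt i f"
  shows "pairing f (abs_vec x) \<le> (\<Sum>t\<in>supp x. \<bar>x t\<bar>) / mseq i"
proof -
  have "pairing f (abs_vec x) \<le> (\<Sum>t\<in>supp x. 1 / mseq i * \<bar>x t\<bar>)"
    unfolding pairing_def supp_abs
    unfolding abs_vec_def by (intro sum_mono mult_right_mono wt_coord_le[OF assms]) simp
  then show ?thesis by (simp add: sum_divide_distrib)
qed

text \<open>Rapidly increasing sequences. The exceptional \<open>k0\<close> is the stage at which the growth of the
  sequence overtakes the weight \<open>i\<close>.\<close>

definition ris :: "nat \<Rightarrow> (nat \<Rightarrow> vec) \<Rightarrow> bool" where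
  "ris q u \<longleftrightarrow> successive UNIV u \<and> (\<forall>k. u k \<in> c00) \<and>
     (\<forall>k. \<forall>g\<in>Wp. pairing g (abs_vec (u k)) \<le> 8) \<and>
     (\<forall>i g. wt i g \<longrightarrow> (\<exists>k0. \<forall>k. k \<noteq> k0 \<longrightarrow>
        pairing g (abs_vec (u k)) \<le> 8 * (1 / mseq i + 1 / real (mseq q) ^ 3)))"

text \<open>Each new vector is built for a threshold \<open>j\<close> so large that
  \<open>mseq j\<close> dominates the l1 norm of its predecessor. For weight index \<open>i\<close>,
  terms with \<open>i < j k\<close> are controlled by averaging. Terms with
  \<open>j (Suc k) \<le> i\<close> are controlled by their l1 norm, because the functional has
  coordinates at most \<open>1 / mseq i\<close>. The thresholds increase, so at most one
  \<open>k\<close> escapes both.\<close>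

lemma alternating_ris:
  assumes U: "rich U" and V: "rich V" and q: "1 \<le> q"
  shows "\<exists>u f. ris q u \<and> (\<forall>l. u l \<in> (if even l then U else V) \<and> supp (u l) \<subseteq> {N<..} \<and>
    supp (u l) \<noteq> {} \<and> f l \<in> Wp \<and> supp (f l) \<subseteq> {Min (supp (u l))..Max (supp (u l))} \<and>
    pairing (f l) (abs_vec (u l)) = 1)"
proof -
  define P where "P n x \<longleftrightarrow> (case x of (u, f, j) \<Rightarrow>
     u \<in> (if even n then U else V) \<and> supp u \<subseteq> {N<..} \<and>
    supp u \<noteq> {} \<and> f \<in> Wp \<and> supp f \<subseteq> {Min (supp u)..Max (supp u)} \<and>
    pairing f (abs_vec u) = 1 \<and> (\<forall>g\<in>Wp. pairing g (abs_vec u) \<le> 8) \<and>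
    (\<forall>i<j. \<forall>g. wt i g \<longrightarrow> pairing g (abs_vec u) \<le> 8 / mseq i))"
    for n :: nat and x :: "vec \<times> vec \<times> nat"
  define Q where "Q x y \<longleftrightarrow> (case x of (u, f, j) \<Rightarrow> case y of (u', f', j') \<Rightarrow>
      supp u' \<subseteq> {Max (supp u)<..} \<and> j < j' \<and>
      real (mseq q) ^ 3 * (\<Sum>t\<in>supp u. \<bar>u t\<bar>) \<le> real (mseq j'))"
    for x y :: "vec \<times> vec \<times> nat"
  have "\<exists>x. \<forall>n. P n (x n) \<and> Q (x n) (x (Suc n))"
  proof (rule dependent_nat_choice)
    obtain u f where "u \<in> U" "supp u \<subseteq> {N<..}" "supp u \<noteq> {}" "f \<in> Wp"
      "supp f \<subseteq> {Min (supp u)..Max (supp u)}" "pairing f (abs_vec u) = 1"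
      "\<forall>g\<in>Wp. pairing g (abs_vec u) \<le> 8"
      using piece[OF U, of N 0] by blast
    then have "P 0 (u, f, 0)" by (simp add: P_def)
    then show "\<exists>x. P 0 x" by blast
  next
    fix x and n :: nat assume "P n x"
    obtain u f j where x: "x = (u, f, j)" by (cases x)
    obtain j0 :: nat where j0: "real (mseq q) ^ 3 * (\<Sum>t\<in>supp u. \<bar>u t\<bar>) \<le> real j0"
      using real_arch_simple by blast
    let ?j = "max j0 (Suc j)"
    have R: "rich (if even (Suc n) then U else V)" using U V by simp
    obtain u' f' where u': "u' \<in> (if even (Suc n) then U else V)"
      "supp u' \<subseteq> {max N (Max (supp u))<..}" "supp u' \<noteq> {}" "f' \<in> Wp"
      "supp f' \<subseteq> {Min (supp u')..Max (supp u')}" "pairing f' (abs_vec u') = 1"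
      "\<forall>g\<in>Wp. pairing g (abs_vec u') \<le> 8"
      "\<forall>i<?j. \<forall>g. wt i g \<longrightarrow> pairing g (abs_vec u') \<le> 8 / mseq i"
      using piece[OF R, of "max N (Max (supp u))" ?j] by blast
    have s: "supp u' \<subseteq> {N<..}" "supp u' \<subseteq> {Max (supp u)<..}" using u'(2) by auto
    have "real j0 \<le> real (mseq ?j)"
      using mseq_ge_self[of ?j] by linarith
    then have "Q x (u', f', ?j)" unfolding Q_def x using s j0 by simp
    moreover have "P (Suc n) (u', f', ?j)" unfolding P_def using u' s by simp
    ultimately show "\<exists>y. P (Suc n) y \<and> Q x y" by blast
  qed
  then obtain x where x: "\<And>n. P n (x n)" "\<And>n. Q (x n) (x (Suc n))" by blast
  define u f j where "u n = fst (x n)" and "f n = fst (snd (x n))" and "j n = snd (snd (x n))" for n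
  have xe: "x n = (u n, f n, j n)" for n by (simp add: u_def f_def j_def)
  have p: "u n \<in> (if even n then U else V)" "supp (u n) \<subseteq> {N<..}" "supp (u n) \<noteq> {}" "f n \<in> Wp"
    "supp (f n) \<subseteq> {Min (supp (u n))..Max (supp (u n))}" "pairing (f n) (abs_vec (u n)) = 1"
    "\<forall>g\<in>Wp. pairing g (abs_vec (u n)) \<le> 8"
    "\<forall>i<j n. \<forall>g. wt i g \<longrightarrow> pairing g (abs_vec (u n)) \<le> 8 / mseq i" for n
    using x(1)[of n] unfolding P_def xe by simp_all
  have r: "supp (u (Suc n)) \<subseteq> {Max (supp (u n))<..}" "j n < j (Suc n)"
    "real (mseq q) ^ 3 * (\<Sum>t\<in>supp (u n). \<bar>u n t\<bar>) \<le> real (mseq (j (Suc n)))" for n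
    using x(2)[of n] unfolding Q_def xe by simp_all
  have c: "u n \<in> c00" for n
    using p(1)[of n] rich_c00[OF U] rich_c00[OF V] by (auto split: if_splits)
  have mono: "j k \<le> j k'" if "k \<le> k'" for k k'
    using lift_Suc_mono_le[of j, OF less_imp_le[OF r(2)] that] .
  have "ris q u"
    unfolding ris_def
  proof (intro conjI allI impI)
    show "successive UNIV u" using c p(3) r(1) by (rule successive_chain)
    show "u k \<in> c00" for k by (rule c)
    show "\<forall>g\<in>Wp. pairing g (abs_vec (u k)) \<le> 8" for k by (rule p(7))
    fix i g assume w: "wt i g"
    have mq: "0 < real (mseq q) ^ 3" using mseq_ge_2[OF q] by simp
    have mi: "0 < real (mseq i)" using mseq_ge_2[of i] wt_ge_2[OF w] by simp
    have good: "pairing g (abs_vec (u k)) \<le> 8 * (1 / mseq i + 1 / real (mseq q) ^ 3)"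
      if "i < j k \<or> j (Suc k) \<le> i" for k
    proof (cases "i < j k")
      case True
      then have "pairing g (abs_vec (u k)) \<le> 8 / mseq i" using p(8) w by blast
      moreover have "0 \<le> 8 * (1 / real (mseq q) ^ 3)" by simp
      ultimately show ?thesis unfolding distrib_left by linarith
    next
      case False
      then have k: "j (Suc k) \<le> i" using that by blast
      have "pairing g (abs_vec (u k)) \<le> (\<Sum>t\<in>supp (u k). \<bar>u k t\<bar>) / mseq i"
        by (rule wt_pairing_le_sum[OF w])
      also have "\<dots> \<le> 1 / real (mseq q) ^ 3"
      proof -
        have "1 \<le> j (Suc k)" using r(2)[of k] by simp
        then have "real (mseq (j (Suc k))) \<le> real (mseq i)" using mseq_mono k by simp
        then have "real (mseq q) ^ 3 * (\<Sum>t\<in>supp (u k). \<bar>u k t\<bar>) \<le> real (mseq i)"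
          using r(3)[of k] by linarith
        then show ?thesis using mi mq by (simp add: divide_simps mult.commute)
      qed
      also have "\<dots> \<le> 8 * (1 / mseq i + 1 / real (mseq q) ^ 3)"
      proof -
        have "0 \<le> 1 / real (mseq i)" "0 \<le> 1 / real (mseq q) ^ 3" by simp_all
        then show ?thesis unfolding distrib_left by linarith
      qed
      finally show ?thesis .
    qed
    show "\<exists>k0. \<forall>k. k \<noteq> k0 \<longrightarrow> pairing g (abs_vec (u k)) \<le> 8 * (1 / mseq i + 1 / real (mseq q) ^ 3)"
    proof (cases "\<exists>k0. j k0 \<le> i \<and> i < j (Suc k0)")
      case True
      then obtain k0 where k0: "j k0 \<le> i" "i < j (Suc k0)" by blast
      have "i < j k \<or> j (Suc k) \<le> i" if "k \<noteq> k0" for k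
      proof (cases "k < k0")
        case True
        then show ?thesis using mono[of "Suc k" k0] k0 by linarith
      next
        case False
        then show ?thesis using mono[of "Suc k0" k] k0 that by linarith
      qed
      then show ?thesis using good by blast
    next
      case False
      then show ?thesis using good by (meson not_le)
    qed
  qed
  then show ?thesis using p by blast
qed

lemma ris_leaf:
  assumes u: "ris q u" and q: "1 \<le> q" and w: "wt i g" and K: "finite K"
  shows "\<bar>pairing g (\<lambda>t. \<Sum>k\<in>K. abs_vec (u k) t)\<bar> \<le> 8 * (1 + (1 / mseq i + 1 / real (mseq q) ^ 3) * card K)"
proof -
  have c: "u k \<in> c00" for k using u by (simp add: ris_def)
  let ?c = "8 * (1 / real (mseq i) + 1 / real (mseq q) ^ 3)"
  obtain k0 where k0: "\<And>k. k \<noteq> k0 \<Longrightarrow> pairing g (abs_vec (u k)) \<le> ?c"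
    using u w unfolding ris_def by (metis of_nat_power)
  have g: "g \<in> Wp" using wt_Wp[OF w] .
  have e: "pairing g (\<lambda>t. \<Sum>k\<in>K. abs_vec (u k) t) = (\<Sum>k\<in>K. pairing g (abs_vec (u k)))"
    using c by (intro pairing_sum_right) auto
  have "(\<Sum>k\<in>K. pairing g (abs_vec (u k))) \<le> 1 * 8 + ?c * card K"
    using K u k0 g by (intro sum_exceptions[of _ "{k0}"]) (auto simp: ris_def)
  moreover have "0 \<le> (\<Sum>k\<in>K. pairing g (abs_vec (u k)))"
    using g by (intro sum_nonneg pairing_nonneg) (auto simp: Wp_nonneg abs_vec_nonneg)
  ultimately show ?thesis unfolding e by (simp add: algebra_simps)
qed

text \<open>The scaling \<open>mseq q / nseq q\<close> turns the rate \<open>2 / mseq q\<close> of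
  functionals of index at least \<open>q\<close> into a constant. Smaller weights gain their own
  reciprocal by one splitting; strictly larger ones have a rate of order
  \<open>1 / mseq q ^ 3\<close> and keep two of these powers. Only index \<open>q\<close> itself
  gets no gain.\<close>

lemma ris_average:
  assumes u: "ris q u" and q: "2 \<le> q"
  defines "A \<equiv> (\<lambda>t. real (mseq q) / real (nseq q) * (\<Sum>k<nseq q. abs_vec (u k) t))"
  shows "f \<in> Wp \<Longrightarrow> pairing f A \<le> 72"
    and "wt i f \<Longrightarrow> i < q \<Longrightarrow> pairing f A \<le> 72 / mseq i"
    and "wt i f \<Longrightarrow> q < i \<Longrightarrow> pairing f A \<le> 72 / real (mseq q) ^ 2"
proof -
  let ?m = "real (mseq q)" and ?n = "real (nseq q)" and ?n' = "real (nseq (q - 1))"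
  let ?S = "\<lambda>t. \<Sum>k<nseq q. abs_vec (u k) t"
  \<comment> \<open>One level less than \<open>sseq (q - 1)\<close>: the second estimate first
    splits \<open>f\<close> by its own weight, and its extra factor \<open>nseq (q - 1)\<close> uses
    up the reserved level. Hence \<open>1 / 2 ^ e = 2 / ?m ^ 3\<close>.\<close>
  define e where "e = sseq (q - 1) - 1"
  have m: "2 \<le> ?m" using mseq_ge_2[of q] q by simp
  have m3n: "?m ^ 3 \<le> ?n"
    using mseq_cube_le_nseq[OF q] by (metis of_nat_le_iff of_nat_power)
  have n: "0 < ?n" using nseq_ge_4[of q] q by simp
  have n': "4 \<le> ?n'" using nseq_ge_4[of "q - 1"] q by simp
  have se: "sseq (q - 1) = Suc e" using sseq_pos[of "q - 1"] by (simp add: e_def)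
  have sq: "Suc (q - 1) = q" using q by simp
  have p2: "1 / 2 ^ e = 2 / ?m ^ 3"
  proof -
    have "(2::nat) ^ Suc e = mseq q ^ 3"
      using two_power_sseq[of "q - 1"] unfolding se sq .
    then have "real (2 ^ Suc e) = real (mseq q ^ 3)" by (simp only:)
    then have "2 * 2 ^ e = ?m ^ 3" by simp
    then show ?thesis using m by (simp add: field_simps)
  qed
  have ratio: "2 * ?n' * (2 * ?n') ^ e * ?m ^ 3 \<le> ?n"
  proof -
    have "real ((2 * nseq (q - 1)) ^ sseq (q - 1) * mseq q ^ 3) \<le> real (nseq q)"
      using nseq_ratio[of "q - 1"] q sq by (simp only: of_nat_le_iff)
    then show ?thesis unfolding se by (simp add: mult.assoc)
  qed
  have c: "abs_vec (u k) \<in> c00" for k using u by (simp add: ris_def)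
  have sc: "?S \<in> c00" using c by (intro c00_sum)
  have pA: "pairing f A = ?m / ?n * pairing f ?S" for f
    unfolding A_def by (rule pairing_scale_right[OF sc])
  have suc: "successive K (\<lambda>k. abs_vec (u k))" for K
    using u by (auto simp: ris_def intro: successive_subset)
  have nn: "0 \<le> pairing g (abs_vec (u k))" if "g \<in> Wp" for g k
    using that by (intro pairing_nonneg) (auto simp: Wp_nonneg abs_vec_nonneg)
  have rec: "\<bar>pairing f (\<lambda>t. \<Sum>k\<in>K. abs_vec (u k) t)\<bar> \<le>
      8 * (1 * (2 * ?n') ^ e + (1 / 2 ^ e + 2 / ?m) * card K)"
    if "f \<in> Wp" "K \<subseteq> {..<nseq q}" for f K
  proof (rule recursion[OF q _ suc c _ _ _ _ _ _ that])
    show "\<bar>pairing g (abs_vec (u k))\<bar> \<le> 8" if "g \<in> Wp" for g k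
      using u that nn[OF that] unfolding ris_def by auto
    fix i g K' assume w: "wt i g" "q \<le> i" "K' \<subseteq> {..<nseq q}"
    have "1 / real (mseq i) + 1 / ?m ^ 3 \<le> 2 / ?m"
    proof -
      have "?m \<le> real (mseq i)" using mseq_mono[of q i] w q by simp
      then have "1 / real (mseq i) \<le> 1 / ?m" using m by (intro divide_left_mono) auto
      moreover have "?m ^ 1 \<le> ?m ^ 3" using m by (intro power_increasing) auto
      then have "1 / ?m ^ 3 \<le> 1 / ?m" using m by (intro divide_left_mono) auto
      ultimately show ?thesis by simp
    qed
    then have "8 * (1 + (1 / real (mseq i) + 1 / ?m ^ 3) * card K') \<le> 8 * (1 + 2 / ?m * card K')"
      by (intro mult_left_mono add_left_mono mult_right_mono) auto
    moreover have "finite K'" using w(3) finite_subset by blast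
    ultimately show "\<bar>pairing g (\<lambda>t. \<Sum>k\<in>K'. abs_vec (u k) t)\<bar> \<le> 8 * (1 + 2 / ?m * card K')"
      using ris_leaf[OF u _ w(1), of K'] q by (auto simp del: of_nat_power)
  qed (use m in auto)
  have pow: "(2 * ?n') ^ e * ?m ^ 3 \<le> ?n"
  proof -
    have "1 * ((2 * ?n') ^ e * ?m ^ 3) \<le> (2 * ?n') * ((2 * ?n') ^ e * ?m ^ 3)"
      using n' by (intro mult_right_mono) auto
    also have "\<dots> = 2 * ?n' * (2 * ?n') ^ e * ?m ^ 3" by (simp only: mult.assoc)
    finally show ?thesis using ratio by linarith
  qed
  have m2: "1 \<le> ?m ^ 2" using m by (intro one_le_power) simp
  then have m32: "1 / ?m ^ 2 \<le> 1" by (simp only: divide_le_eq_1_pos less_le_trans[OF zero_less_one])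
  show "pairing f A \<le> 72" if "f \<in> Wp"
  proof -
    have "pairing f ?S \<le> 8 * ((2 * ?n') ^ e + (2 / ?m ^ 3 + 2 / ?m) * ?n)"
      using rec[OF that, of "{..<nseq q}"] p2 by simp
    then have "?m / ?n * pairing f ?S \<le> ?m / ?n * (8 * ((2 * ?n') ^ e + (2 / ?m ^ 3 + 2 / ?m) * ?n))"
      using m n by (intro mult_left_mono) auto
    also have "\<dots> = 8 * ((2 * ?n') ^ e * ?m / ?n + 2 / ?m ^ 2 + 2)"
      using m n by (simp add: field_simps power2_eq_square power3_eq_cube)
    also have "\<dots> \<le> 8 * (1 / ?m ^ 2 + 2 / ?m ^ 2 + 2)"
    proof -
      have "(2 * ?n') ^ e * ?m / ?n \<le> 1 / ?m ^ 2"
        using pow m n by (simp add: field_simps power2_eq_square power3_eq_cube)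
      then show ?thesis by simp
    qed
    also have "\<dots> \<le> 72" using m32 by simp
    finally show ?thesis by (simp add: pA)
  qed
  show "pairing f A \<le> 72 / mseq i" if w: "wt i f" "i < q"
  proof -
    have i: "2 \<le> i" using wt_ge_2[OF w(1)] .
    let ?i = "real (mseq i)" and ?ni = "real (nseq i)"
    have mi: "2 \<le> ?i" using mseq_ge_2[of i] i by simp
    have nin': "?ni \<le> ?n'" using nseq_mono[of i "q - 1"] i w by simp
    have nin: "?ni \<le> ?n" using nseq_mono[of i q] i w by simp
    let ?\<gamma> = "8 * (2 / ?m ^ 3 + 2 / ?m)"
    have "\<bar>pairing f ?S\<bar> \<le> (?ni * (8 * (2 * ?n') ^ e) + ?\<gamma> * (real (card {..<nseq q}) + ?ni)) / ?i"
    proof (rule wt_step[OF w(1) _ suc c])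
      show "\<bar>pairing g (\<lambda>t. \<Sum>k\<in>K'. abs_vec (u k) t)\<bar> \<le> 8 * (2 * ?n') ^ e + ?\<gamma> * card K'"
        if "g \<in> Wp" "K' \<subseteq> {..<nseq q}" for g K'
        using rec[OF that] p2 by (simp add: algebra_simps)
    qed (use m in auto)
    then have "pairing f ?S \<le> (?ni * (8 * (2 * ?n') ^ e) + ?\<gamma> * (?n + ?ni)) / ?i" by simp
    also have "\<dots> \<le> (?n' * (8 * (2 * ?n') ^ e) + ?\<gamma> * (?n + ?n)) / ?i"
      using nin nin' m mi by (intro divide_right_mono add_mono mult_left_mono mult_right_mono) auto
    finally have "?m / ?n * pairing f ?S \<le>
        ?m / ?n * ((?n' * (8 * (2 * ?n') ^ e) + ?\<gamma> * (?n + ?n)) / ?i)"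
      using m n by (intro mult_left_mono) auto
    also have "\<dots> = (8 * (?n' * (2 * ?n') ^ e * ?m / ?n) + 32 / ?m ^ 2 + 32) / ?i"
      using m n mi by (simp add: field_simps power2_eq_square power3_eq_cube)
    also have "\<dots> \<le> (8 + 32 / ?m ^ 2 + 32) / ?i"
    proof -
      have "?n' * (2 * ?n') ^ e * ?m \<le> ?n' * (2 * ?n') ^ e * ?m * (2 * ?m ^ 2)"
        using m2 mult_left_mono[of 1 "2 * ?m ^ 2" "?n' * (2 * ?n') ^ e * ?m"] by simp
      also have "\<dots> \<le> ?n" using ratio by (simp add: algebra_simps power2_eq_square power3_eq_cube)
      finally have "?n' * (2 * ?n') ^ e * ?m / ?n \<le> 1" using n by simp
      then show ?thesis using mi by (intro divide_right_mono) auto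
    qed
    \<comment> \<open>Here 72 arises as \<open>8 + 32 + 32\<close>; the other two bounds are smaller
      and rounded up to it.\<close>
    also have "\<dots> \<le> 72 / ?i" using m32 mi by (intro divide_right_mono) auto
    finally show ?thesis by (simp add: pA)
  qed
  show "pairing f A \<le> 72 / real (mseq q) ^ 2" if w: "wt i f" "q < i"
  proof -
    let ?i = "real (mseq i)"
    have mi: "?m ^ 5 \<le> ?i"
      using mseq_power5_le[of q i] q w by (metis of_nat_le_iff of_nat_power less_imp_le one_le_numeral order.trans)
    have "pairing f ?S \<le> 8 * (1 + (1 / ?i + 1 / ?m ^ 3) * ?n)"
      using ris_leaf[OF u _ w(1), of "{..<nseq q}"] q by simp
    also have "\<dots> \<le> 8 * (1 + (1 / ?m ^ 3 + 1 / ?m ^ 3) * ?n)"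
    proof -
      have "?m ^ 3 \<le> ?m ^ 5" using m by (intro power_increasing) auto
      then have "?m ^ 3 \<le> ?i" using mi by linarith
      moreover have "0 < ?m ^ 3" using m by simp
      ultimately have "1 / ?i \<le> 1 / ?m ^ 3" by (intro divide_left_mono mult_pos_pos) linarith+
      then show ?thesis using n by (intro mult_left_mono add_left_mono mult_right_mono add_right_mono) auto
    qed
    finally have "?m / ?n * pairing f ?S \<le> ?m / ?n * (8 * (1 + (1 / ?m ^ 3 + 1 / ?m ^ 3) * ?n))"
      using m n by (intro mult_left_mono) auto
    also have "\<dots> = 8 * (?m / ?n + 2 / ?m ^ 2)"
      using m n by (simp add: field_simps power2_eq_square power3_eq_cube)
    also have "\<dots> \<le> 8 * (1 / ?m ^ 2 + 2 / ?m ^ 2)"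
      using m3n m n by (simp add: field_simps power2_eq_square power3_eq_cube)
    also have "\<dots> \<le> 72 / ?m ^ 2" using m by (simp add: divide_simps)
    finally show ?thesis by (simp add: pA)
  qed
qed

end

lemma sum_pairs: "(\<Sum>k<2 * h. a k) = (\<Sum>k<h. a (2 * k) + a (Suc (2 * k)))"
  for a :: "nat \<Rightarrow> 'b::comm_monoid_add"
  by (induction h) (simp_all add: add.assoc)

lemma Min_le_Max_supp: "x \<in> c00 \<Longrightarrow> supp x \<noteq> {} \<Longrightarrow> Min (supp x) \<le> Max (supp x)"
  by (simp add: finite_supp)

context norming_space
begin

text \<open>An exact pair of weight \<open>mseq q\<close> whose vector is split into two halves;
  \<open>g\<close> collects \<open>1 / 2\<close> from \<open>y\<close>, which has half of the
  pieces. Both \<open>wt\<close> and \<open>weight\<close> are recorded: estimates use the former,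
  special sequences demand the latter. The last clause concerns trims of \<open>g\<close> alone,
  because other functionals of the same weight are handled by the coding. Its numerator counts the
  points where the trim changes, each of which spoils at most one pair of pieces.\<close>

definition balanced :: "vec set \<Rightarrow> vec set \<Rightarrow> nat \<Rightarrow> nat \<Rightarrow> vec \<Rightarrow> vec \<Rightarrow> vec \<Rightarrow> bool" where
  "balanced U V q N y z g \<longleftrightarrow> y \<in> U \<and> z \<in> V \<and> wt q g \<and> weight N1 \<sigma> g q \<and>
     supp y \<union> supp z \<union> supp g \<subseteq> {N<..} \<and> supp g \<noteq> {} \<and> pairing g (abs_vec y) = 1 / 2 \<and>
     (\<forall>f\<in>Wp. pairing f (\<lambda>t. \<bar>y t\<bar> + \<bar>z t\<bar>) \<le> 72) \<and>
     (\<forall>i f. wt i f \<longrightarrow> i < q \<longrightarrow> pairing f (\<lambda>t. \<bar>y t\<bar> + \<bar>z t\<bar>) \<le> 72 / real (mseq i)) \<and>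
     (\<forall>i f. wt i f \<longrightarrow> q < i \<longrightarrow> pairing f (\<lambda>t. \<bar>y t\<bar> + \<bar>z t\<bar>) \<le> 72 / real (mseq q) ^ 2) \<and>
     (\<forall>E Fs. nat_interval E \<longrightarrow> (\<forall>F\<in>set Fs. finite F) \<longrightarrow>
        \<bar>pairing (trim E Fs g) (\<lambda>t. \<bar>y t\<bar> - \<bar>z t\<bar>)\<bar> \<le>
          (2 + real (\<Sum>F\<leftarrow>Fs. card F)) / (2 ^ length Fs * real (nseq q)))"

text \<open>The summands of the exact vector lie alternately in \<open>U\<close> and \<open>V\<close>, so an operator that
  changes between \<open>0\<close> and a constant only a few times treats the two halves almost alike.\<close>

lemma balanced_exists:
  assumes U: "rich U" and V: "rich V" and j: "1 \<le> j"
  shows "\<exists>y z g. balanced U V (2 * j) N y z g"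
proof -
  define q where "q = 2 * j"
  have q: "1 \<le> q" "2 \<le> q" using j by (simp_all add: q_def)
  obtain u f where ris: "ris q u" and uf: "\<And>l. u l \<in> (if even l then U else V)"
    "\<And>l. supp (u l) \<subseteq> {N<..}" "\<And>l. supp (u l) \<noteq> {}" "\<And>l. f l \<in> Wp"
    "\<And>l. supp (f l) \<subseteq> {Min (supp (u l))..Max (supp (u l))}"
    "\<And>l. pairing (f l) (abs_vec (u l)) = 1"
    using alternating_ris[OF U V q(1), of N] by blast
  have uc: "u l \<in> c00" for l using ris by (simp add: ris_def)
  have su: "successive UNIV u" using ris by (simp add: ris_def)
  obtain h where h: "nseq q = 2 * h" using nseq_even[OF q(1)] by blast
  have h0: "0 < h" using nseq_ge_4[OF q(1)] h by simp
  define m n c where "m = real (mseq q)" and "n = real (nseq q)" and "c = m / n"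
  have m: "2 \<le> m" using mseq_ge_2[OF q(1)] by (simp add: m_def)
  have n: "0 < n" "n = 2 * real h" using h h0 by (simp_all add: n_def)
  have c: "0 < c" using m n by (simp add: c_def)
  define y z g where "y = (\<lambda>t. c * (\<Sum>k<h. u (2 * k) t))" and "z = (\<lambda>t. c * (\<Sum>k<h. u (Suc (2 * k)) t))"
    and "g = (\<lambda>i. (\<Sum>l<nseq q. f l i) / m)"
  have fne: "supp (f l) \<noteq> {}" for l
    using uf(6)[of l] pairing_disjoint[of "f l" "abs_vec (u l)"] by force
  have bounds: "Max (supp (u k)) < Min (supp (u l))" if "k < l" for k l
    using su that Max_in[OF finite_supp[OF uc] uf(3), of k] Min_in[OF finite_supp[OF uc] uf(3), of l]
    by (auto simp: successive_def before_def)
  have hull: "supp (u k) \<subseteq> {Min (supp (u k))..Max (supp (u k))}" for k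
    using finite_supp[OF uc] by auto
  have dis: "supp (f l) \<inter> supp (u k) = {}" if "k \<noteq> l" for k l
  proof -
    have "{Min (supp (u l))..Max (supp (u l))} \<inter> {Min (supp (u k))..Max (supp (u k))} = {}"
      using that bounds[of k l] bounds[of l k] by (cases "k < l") auto
    then show ?thesis using hull[of k] uf(5)[of l] by blast
  qed
  have sf: "successive K f" for K
    by (rule successive_hull[OF successive_subset[OF su]]) (rule subset_UNIV order_refl uc uf(3,5))+
  have wtg: "wt q g" and weg: "weight N1 \<sigma> g q"
    using even_average_wt[OF j sf] uf(4) fne unfolding g_def m_def q_def by simp_all
  have yU: "y \<in> U"
    unfolding y_def using uf(1)[of "2 * _"] by (intro rich_scale[OF U] rich_sum[OF U]) simp
  have zV: "z \<in> V"
    unfolding z_def using uf(1)[of "Suc (2 * _)"] by (intro rich_scale[OF V] rich_sum[OF V]) simp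
  have absy: "\<bar>y t\<bar> = c * (\<Sum>k<h. \<bar>u (2 * k) t\<bar>)" for t
  proof -
    have "successive {..<h} (\<lambda>k. u (2 * k))" using su by (auto simp: successive_def)
    then show ?thesis using c successive_abs_sum[of "{..<h}" "\<lambda>k. u (2 * k)" t]
      by (simp add: y_def abs_mult)
  qed
  have absz: "\<bar>z t\<bar> = c * (\<Sum>k<h. \<bar>u (Suc (2 * k)) t\<bar>)" for t
  proof -
    have "successive {..<h} (\<lambda>k. u (Suc (2 * k)))" using su by (auto simp: successive_def)
    then show ?thesis using c successive_abs_sum[of "{..<h}" "\<lambda>k. u (Suc (2 * k))" t]
      by (simp add: z_def abs_mult)
  qed
  have A: "(\<lambda>t. \<bar>y t\<bar> + \<bar>z t\<bar>) =
      (\<lambda>t. real (mseq q) / real (nseq q) * (\<Sum>k<nseq q. abs_vec (u k) t))"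
    unfolding absy absz h sum_pairs
    by (simp add: c_def m_def n_def h abs_vec_def sum.distrib distrib_left fun_eq_iff)
  have pg: "pairing (trim E Fs g) (abs_vec (u k)) = pairing (trim E Fs (f k)) (abs_vec (u k)) / m"
    if "k < nseq q" for E Fs k
  proof -
    have "pairing (trim E Fs g) (abs_vec (u k)) = (\<Sum>l<nseq q. pairing (trim E Fs (f l)) (abs_vec (u k))) / m"
      unfolding g_def trim_sum by (simp add: pairing_divide_left pairing_sum_left)
    also have "(\<Sum>l<nseq q. pairing (trim E Fs (f l)) (abs_vec (u k))) =
        pairing (trim E Fs (f k)) (abs_vec (u k))"
    proof (subst sum.remove[of _ k])
      have "pairing (trim E Fs (f l)) (abs_vec (u k)) = 0" if "l \<noteq> k" for l
        using dis[of k l] that supp_trim[of E Fs "f l"] by (intro pairing_disjoint) auto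
      then show "pairing (trim E Fs (f k)) (abs_vec (u k)) +
          (\<Sum>l\<in>{..<nseq q} - {k}. pairing (trim E Fs (f l)) (abs_vec (u k))) =
          pairing (trim E Fs (f k)) (abs_vec (u k))" by simp
    qed (use that in auto)
    finally show ?thesis .
  qed
  have half: "pairing g (abs_vec y) = 1 / 2"
  proof -
    have "abs_vec y = (\<lambda>t. c * (\<Sum>k<h. abs_vec (u (2 * k)) t))"
      by (simp add: abs_vec_def absy)
    then have "pairing g (abs_vec y) = c * (\<Sum>k<h. pairing g (abs_vec (u (2 * k))))"
      using uc by (simp add: pairing_scale_right c00_sum pairing_sum_right)
    also have "\<dots> = c * (\<Sum>k<h. 1 / m)"
    proof -
      have "pairing g (abs_vec (u (2 * k))) = 1 / m" if "k < h" for k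
        using pg[of "2 * k" UNIV "[]"] that h by (simp add: trim_UNIV_Nil uf(6))
      then show ?thesis by simp
    qed
    also have "\<dots> = 1 / 2" using m n h0 by (simp add: c_def)
    finally show ?thesis .
  qed
  have alt: "\<bar>pairing (trim E Fs g) (\<lambda>t. \<bar>y t\<bar> - \<bar>z t\<bar>)\<bar> \<le>
      (2 + real (\<Sum>F\<leftarrow>Fs. card F)) / (2 ^ length Fs * real (nseq q))"
    if E: "nat_interval E" "\<forall>F\<in>set Fs. finite F" for E Fs
  proof -
    define a where "a k = pairing (trim E Fs (f k)) (abs_vec (u k))" for k
    \<comment> \<open>The hull of a piece from \<open>U\<close> and the next piece from
      \<open>V\<close>. These hulls are disjoint, so a point of \<open>G\<close> lies in at most
      one.\<close>
    define I where "I k = {Min (supp (u (2 * k)))..Max (supp (u (Suc (2 * k))))}" for k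
    obtain G where G: "finite G" "card G \<le> 2 + (\<Sum>F\<leftarrow>Fs. card F)"
      "\<And>a b. {a..b} \<inter> G = {} \<Longrightarrow>
        (\<forall>v. supp v \<subseteq> {a..b} \<longrightarrow> trim E Fs v = (\<lambda>t. v t / 2 ^ length Fs)) \<or>
        (\<forall>v. supp v \<subseteq> {a..b} \<longrightarrow> trim E Fs v = (\<lambda>t. 0))"
      using trim_boundary[OF E] by blast
    let ?r = "1 / 2 ^ length Fs :: real"
    have d: "(\<lambda>t. \<bar>y t\<bar> - \<bar>z t\<bar>) =
        (\<lambda>t. c * (\<Sum>k<h. abs_vec (u (2 * k)) t - abs_vec (u (Suc (2 * k))) t))"
      by (simp add: absy absz abs_vec_def sum_subtractf right_diff_distrib)
    have dc: "(\<lambda>t. abs_vec (u (2 * k)) t - abs_vec (u (Suc (2 * k))) t) \<in> c00" for k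
      using c00_lincomb[of "abs_vec (u (2 * k))" "abs_vec (u (Suc (2 * k)))" 1 "-1"] uc by simp
    have "pairing (trim E Fs g) (\<lambda>t. \<bar>y t\<bar> - \<bar>z t\<bar>) =
        c * (\<Sum>k<h. pairing (trim E Fs g) (\<lambda>t. abs_vec (u (2 * k)) t - abs_vec (u (Suc (2 * k))) t))"
      unfolding d by (subst pairing_scale_right[OF c00_sum[OF dc]], subst pairing_sum_right[OF dc]) simp
    also have "\<dots> = c * (\<Sum>k<h. (a (2 * k) - a (Suc (2 * k))) / m)"
    proof -
      have "pairing (trim E Fs g) (\<lambda>t. abs_vec (u (2 * k)) t - abs_vec (u (Suc (2 * k))) t) =
          (a (2 * k) - a (Suc (2 * k))) / m" if "k < h" for k
        using that h uc by (simp add: pairing_diff_right pg a_def diff_divide_distrib)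
      then show ?thesis by simp
    qed
    also have "\<dots> = (\<Sum>k<h. a (2 * k) - a (Suc (2 * k))) / n"
      using m by (simp add: c_def flip: sum_divide_distrib)
    finally have e: "\<bar>pairing (trim E Fs g) (\<lambda>t. \<bar>y t\<bar> - \<bar>z t\<bar>)\<bar> = \<bar>\<Sum>k<h. a (2 * k) - a (Suc (2 * k))\<bar> / n"
      using n by simp
    define bad where "bad = {k\<in>{..<h}. I k \<inter> G \<noteq> {}}"
    \<comment> \<open>Both values of a pair lie in \<open>[0, ?r]\<close>, since \<open>f k\<close>
      is 1 on its piece: a spoilt pair costs at most \<open>?r\<close>, and the others cancel
      exactly.\<close>
    have a01: "0 \<le> a k" "a k \<le> ?r" for k
    proof -
      show "0 \<le> a k" unfolding a_def
        using uf(4) by (intro pairing_nonneg trim_nonneg) (auto simp: Wp_nonneg abs_vec_nonneg)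
      have "a k \<le> pairing (\<lambda>t. ?r * f k t) (abs_vec (u k))"
        unfolding a_def using trim_le[of "f k" E Fs] Wp_nonneg[OF uf(4)]
        by (intro pairing_mono_left) (auto simp: abs_vec_nonneg)
      then show "a k \<le> ?r" unfolding pairing_scale_left uf(6) by simp
    qed
    have "\<bar>\<Sum>k<h. a (2 * k) - a (Suc (2 * k))\<bar> \<le> (\<Sum>k<h. \<bar>a (2 * k) - a (Suc (2 * k))\<bar>)"
      by (rule sum_abs)
    also have "\<dots> \<le> real (card bad) * ?r + 0 * real (card {..<h})"
    proof (rule sum_exceptions)
      show "\<bar>a (2 * k) - a (Suc (2 * k))\<bar> \<le> ?r" for k
        using a01[of "2 * k"] a01[of "Suc (2 * k)"] by linarith
      fix k assume "k \<in> {..<h}" "k \<notin> bad"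
      then have "I k \<inter> G = {}" by (simp add: bad_def)
      moreover have "supp (f (2 * k)) \<subseteq> I k" "supp (f (Suc (2 * k))) \<subseteq> I k"
        using uf(5)[of "2 * k"] uf(5)[of "Suc (2 * k)"] bounds[of "2 * k" "Suc (2 * k)"]
          Min_le_Max_supp[of "u (2 * k)"] Min_le_Max_supp[of "u (Suc (2 * k))"] uc uf(3)
        unfolding I_def by fastforce+
      ultimately have "(trim E Fs (f (2 * k)) = (\<lambda>t. ?r * f (2 * k) t) \<and>
            trim E Fs (f (Suc (2 * k))) = (\<lambda>t. ?r * f (Suc (2 * k)) t)) \<or>
          (trim E Fs (f (2 * k)) = (\<lambda>t. 0 * f (2 * k) t) \<and>
            trim E Fs (f (Suc (2 * k))) = (\<lambda>t. 0 * f (Suc (2 * k)) t))"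
        using G(3)[of "Min (supp (u (2 * k)))" "Max (supp (u (Suc (2 * k))))"]
        unfolding I_def by auto
      then have "a (2 * k) = a (Suc (2 * k))"
        unfolding a_def by (elim disjE conjE) (simp_all only: pairing_scale_left uf(6))
      then show "\<bar>a (2 * k) - a (Suc (2 * k))\<bar> \<le> 0" by simp
    qed (auto simp: bad_def)
    also have "\<dots> \<le> (2 + real (\<Sum>F\<leftarrow>Fs. card F)) * ?r"
    proof -
      have "card bad \<le> card G"
      proof (rule card_hitting[of _ _ I])
        fix k k' assume "k \<in> bad" "k' \<in> bad" "k \<noteq> k'"
        then show "I k \<inter> I k' = {}"
          using bounds[of "Suc (2 * k)" "2 * k'"] bounds[of "Suc (2 * k')" "2 * k"]
          unfolding I_def by (cases "k < k'") auto
      qed (use G in \<open>auto simp: bad_def\<close>)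
      then have "real (card bad) \<le> 2 + real (\<Sum>F\<leftarrow>Fs. card F)" using G(2) by linarith
      then have "real (card bad) * ?r \<le> (2 + real (\<Sum>F\<leftarrow>Fs. card F)) * ?r"
        by (intro mult_right_mono) auto
      then show ?thesis by simp
    qed
    finally show ?thesis
      unfolding e using n(1) by (simp add: n_def divide_right_mono flip: divide_divide_eq_left)
  qed
  have "supp y \<subseteq> {N<..}" "supp z \<subseteq> {N<..}" "supp g \<subseteq> {N<..}"
  proof -
    have uN: "u l t = 0" if "t \<le> N" for l t using uf(2)[of l] that by (auto simp: supp_def)
    have fN: "f l t = 0" if "t \<le> N" for l t
    proof (rule ccontr)
      assume "f l t \<noteq> 0"
      then have "Min (supp (u l)) \<le> t" using uf(5)[of l] by (auto simp: supp_def)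
      moreover have "N < Min (supp (u l))"
        using uf(2)[of l] Min_in[OF finite_supp[OF uc] uf(3), of l] by auto
      ultimately show False using that by simp
    qed
    show "supp y \<subseteq> {N<..}" "supp z \<subseteq> {N<..}" "supp g \<subseteq> {N<..}"
      unfolding supp_def y_def z_def g_def using uN fN by (auto simp: not_le[symmetric])
  qed
  moreover have "supp g \<noteq> {}"
    using half pairing_disjoint[of g "abs_vec y"] by force
  moreover have "\<forall>f\<in>Wp. pairing f (\<lambda>t. \<bar>y t\<bar> + \<bar>z t\<bar>) \<le> 72"
    "\<forall>i f. wt i f \<longrightarrow> i < q \<longrightarrow> pairing f (\<lambda>t. \<bar>y t\<bar> + \<bar>z t\<bar>) \<le> 72 / real (mseq i)"
    "\<forall>i f. wt i f \<longrightarrow> q < i \<longrightarrow> pairing f (\<lambda>t. \<bar>y t\<bar> + \<bar>z t\<bar>) \<le> 72 / real (mseq q) ^ 2"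
    unfolding A using ris_average[OF ris q(2)] by blast+
  ultimately have "balanced U V q N y z g"
    unfolding balanced_def using yU zV wtg weg half alt by simp
  then show ?thesis unfolding q_def by blast
qed

end

section \<open>Chains coded by special sequences\<close>

lemma switch_set_ge:
  assumes "finite F" "t \<in> switch_set F"
  shows "Min F \<le> t"
proof -
  let ?L = "sorted_list_of_set F"
  obtain p where p: "p < card F div 2" "?L ! (2 * p) \<le> t"
    using assms(2) by (auto simp: switch_set_def)
  have "?L ! (2 * p) \<in> set ?L" using p(1) by (intro nth_mem) simp
  then have "Min F \<le> ?L ! (2 * p)" using assms(1) by simp
  then show ?thesis using p(2) by linarith
qed

lemma sum_indicator_le:
  fixes B :: real
  assumes "finite K" "finite X" "0 \<le> B"
  shows "(\<Sum>k\<in>K. if k \<in> X then B else 0) \<le> card X * B"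
proof -
  have "(\<Sum>k\<in>K. if k \<in> X then B else 0) = (\<Sum>k\<in>K \<inter> X. B)"
    using assms(1) by (rule sum.inter_restrict[symmetric])
  also have "\<dots> = card (K \<inter> X) * B" by simp
  also have "\<dots> \<le> card X * B"
    using assms by (intro mult_right_mono) (auto intro: card_mono)
  finally show ?thesis .
qed

context norming_space
begin

lemma coding_domain_map:
  assumes "0 < k" "successive {..<k} g" "\<And>i. i < k \<Longrightarrow> g i \<in> c00"
    "\<And>i. i < k \<Longrightarrow> supp (g i) \<noteq> {}" "\<And>i t. i < k \<Longrightarrow> g i t \<in> \<rat> \<and> 0 \<le> g i t"
  shows "map g [0..<k] \<in> coding_domain"
  unfolding coding_domain_def using assms sorted_map_block_less[of k g] by auto

lemma weight_wt:
  assumes "weight N1 \<sigma> f (2 * j)"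
  shows "wt (2 * j) (abs_vec f)"
  using assms
proof cases
  case (weight_even j' fs E)
  then have j: "j' = j" by simp
  let ?S = "scaled_sum (2 * j) fs"
  have "wt (2 * j) (abs_vec ?S)"
    using weight_even unfolding j by (intro wt_scaled_sum) auto
  then have "wt (2 * j) (restr E (abs_vec ?S))" using weight_even wt_trim by blast
  moreover have "restr E (abs_vec ?S) = abs_vec (restr E ?S)"
    by (auto simp: restr_def abs_vec_def fun_eq_iff)
  moreover have "abs_vec f = abs_vec (restr E ?S)" using weight_even unfolding j by blast
  ultimately show ?thesis by simp
next
  case (weight_odd j' fs E)
  then show ?thesis by presburger
qed

end

locale coded_space = norming_space N1 \<sigma> for N1 :: "nat set" and \<sigma> +
  fixes N2 :: "nat set"
  assumes N12: "N1 \<union> N2 = {1..}" "N1 \<inter> N2 = {}" and infinite_N1: "infinite N1"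
    and coding: "coding_function N2 \<sigma>"
begin

lemma coding_inj: "xs \<in> coding_domain \<Longrightarrow> ys \<in> coding_domain \<Longrightarrow> \<sigma> xs = \<sigma> ys \<Longrightarrow> xs = ys"
  using coding unfolding coding_function_def by (meson inj_onD)

lemma coding_N2: "xs \<in> coding_domain \<Longrightarrow> \<sigma> xs \<in> N2"
  using coding unfolding coding_function_def by blast

text \<open>A functional of weight \<open>mseq (2 * j)\<close> has coordinates at most
  \<open>1 / mseq (2 * j)\<close>, so the reciprocal factor in the coding condition is at least
  \<open>mseq (2 * j)\<close>; the other factor is at least 1, as supports avoid 0. The first
  conclusion limits the size of switching sets that start early, the second makes the weights of a
  chain increase.\<close>

lemma coding_growth:
  assumes "xs \<in> coding_domain" "last xs = g" "wt (2 * j) g" "1 \<le> j"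
  shows "Max (supp g) < mseq (2 * \<sigma> xs)" "mseq (2 * j) < mseq (2 * \<sigma> xs)"
proof -
  have "last xs \<in> set xs" using assms(1) by (auto simp: coding_domain_def)
  then have g: "g \<in> c00" "supp g \<noteq> {}" "\<And>i. 0 \<le> g i"
    using assms(1,2) by (auto simp: coding_domain_def)
  let ?M = "Max ((\<lambda>l. 1 / g l) ` supp g)"
  have lt: "real (Max (supp g)) * ?M < real (mseq (2 * \<sigma> xs))"
    using coding assms(1,2) unfolding coding_function_def by blast
  obtain l where l: "l \<in> supp g" using g(2) by blast
  have gl: "0 < g l" using g(3)[of l] l by (simp add: supp_def less_le)
  have m: "2 \<le> real (mseq (2 * j))" using mseq_ge_2[of "2 * j"] assms(4) by simp
  have "real (mseq (2 * j)) \<le> 1 / g l"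
    using wt_coord_le[OF assms(3), of l] gl m by (simp add: field_simps)
  also have "\<dots> \<le> ?M" using l finite_supp[OF g(1)] by (intro Max_ge) auto
  finally have M: "real (mseq (2 * j)) \<le> ?M" .
  have "g 0 = 0" using g(1) by (simp add: c00_def)
  then have "1 \<le> l" using l by (cases l) (auto simp: supp_def)
  also have "l \<le> Max (supp g)" using l finite_supp[OF g(1)] by simp
  finally have S: "1 \<le> real (Max (supp g))" by simp
  have "real (Max (supp g)) * 1 \<le> real (Max (supp g)) * ?M"
    using M m S by (intro mult_left_mono) auto
  then show "Max (supp g) < mseq (2 * \<sigma> xs)" using lt by simp
  have "1 * real (mseq (2 * j)) \<le> real (Max (supp g)) * ?M"
    using M m S by (intro mult_mono) auto
  then show "mseq (2 * j) < mseq (2 * \<sigma> xs)" using lt by simp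
qed

text \<open>\<open>L\<close> is the threshold for the first weight. It is later set equal to the
  length \<open>n\<close>, but stays separate so that induction on \<open>n\<close> leaves it fixed.
  \<open>M i\<close> records the point beyond which stage \<open>i\<close> lives, so an extension
  only has to exceed finitely many supports.\<close>

definition is_chain :: "vec set \<Rightarrow> vec set \<Rightarrow> nat \<Rightarrow> nat \<Rightarrow> nat \<Rightarrow> (nat \<Rightarrow> vec) \<Rightarrow> (nat \<Rightarrow> vec) \<Rightarrow>
    (nat \<Rightarrow> vec) \<Rightarrow> (nat \<Rightarrow> nat) \<Rightarrow> (nat \<Rightarrow> nat) \<Rightarrow> bool" where
  "is_chain U V N L n y z g j M \<longleftrightarrow>
    (\<forall>i<n. 1 \<le> j i \<and> N \<le> M i \<and> balanced U V (2 * j i) (M i) (y i) (z i) (g i)) \<and>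
    (\<forall>k<n. \<forall>i<k. supp (y i) \<union> supp (z i) \<union> supp (g i) \<subseteq> {..M k}) \<and>
    (0 < n \<longrightarrow> j 0 \<in> N1 \<and> L < mseq (2 * j 0)) \<and>
    (\<forall>i<n. 0 < i \<longrightarrow> map g [0..<i] \<in> coding_domain \<and> j i = \<sigma> (map g [0..<i]))"

lemma chain_exists:
  assumes U: "rich U" and V: "rich V"
  shows "\<exists>y z g j M. is_chain U V N L n y z g j M"
proof (induction n)
  case 0
  then show ?case by (simp add: is_chain_def)
next
  case (Suc n)
  then obtain y z g j M where IH: "is_chain U V N L n y z g j M" by blast
  have b: "1 \<le> j i \<and> N \<le> M i \<and> balanced U V (2 * j i) (M i) (y i) (z i) (g i)" if "i < n" for i
    using IH that by (simp add: is_chain_def)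
  have s: "supp (y i) \<union> supp (z i) \<union> supp (g i) \<subseteq> {..M k}" if "k < n" "i < k" for i k
    using IH that by (simp add: is_chain_def)
  have j0: "j 0 \<in> N1 \<and> L < mseq (2 * j 0)" if "0 < n"
    using IH that by (simp add: is_chain_def)
  have js: "map g [0..<i] \<in> coding_domain \<and> j i = \<sigma> (map g [0..<i])" if "i < n" "0 < i" for i
    using IH that by (simp add: is_chain_def)
  have yz: "y i \<in> c00" "z i \<in> c00" "g i \<in> c00" "g i \<in> Wp" "supp (g i) \<noteq> {}" if "i < n" for i
  proof -
    have B: "y i \<in> U" "z i \<in> V" "wt (2 * j i) (g i)" "supp (g i) \<noteq> {}"
      using b[OF that] unfolding balanced_def by simp_all
    show "y i \<in> c00" "z i \<in> c00" "g i \<in> c00" "g i \<in> Wp" "supp (g i) \<noteq> {}"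
      using rich_c00[OF U B(1)] rich_c00[OF V B(2)] wt_Wp[OF B(3)] Wp_c00[OF wt_Wp[OF B(3)]] B(4)
      by blast+
  qed
  have dom: "map g [0..<n] \<in> coding_domain" if "0 < n"
  proof (rule coding_domain_map[OF that])
    show "successive {..<n} g"
      unfolding successive_def before_def
    proof (intro ballI impI)
      fix i k t t' assume *: "i \<in> {..<n}" "k \<in> {..<n}" "i < k" "t \<in> supp (g i)" "t' \<in> supp (g k)"
      have "supp (g k) \<subseteq> {M k<..}" using b[of k] * unfolding balanced_def by blast
      moreover have "supp (g i) \<subseteq> {..M k}" using s[of k i] * by blast
      ultimately show "t < t'" using * by fastforce
    qed
    show "g i \<in> c00" "supp (g i) \<noteq> {}" if "i < n" for i using yz that by blast+
    show "g i t \<in> \<rat> \<and> 0 \<le> g i t" if "i < n" for i t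
      using Wp_Rats[OF yz(4)[OF that]] Wp_nonneg[OF yz(4)[OF that]] by blast
  qed
  \<comment> \<open>The first index may be chosen freely and large in \<open>N1\<close>; every later
    one is forced by the coding.\<close>
  obtain j1 where j1: "1 \<le> j1" "n = 0 \<Longrightarrow> j1 \<in> N1 \<and> L < mseq (2 * j1)"
    "0 < n \<Longrightarrow> j1 = \<sigma> (map g [0..<n])"
  proof (cases "n = 0")
    case True
    obtain x where x: "x \<in> N1" "L < x"
      using infinite_N1 by (meson infinite_nat_iff_unbounded)
    have "1 \<le> x" using x(1) N12(1) by auto
    moreover have "L < mseq (2 * x)" using x(2) mseq_ge_self[of "2 * x"] by linarith
    ultimately show ?thesis using that x(1) True by blast
  next
    case False
    then have "\<sigma> (map g [0..<n]) \<in> N2" using dom coding_N2 by blast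
    then have "1 \<le> \<sigma> (map g [0..<n])" using N12(1) by auto
    then show ?thesis using that False by blast
  qed
  \<comment> \<open>Inserting \<open>N\<close> keeps the set nonempty at the first stage and yields
    \<open>N \<le> M1\<close>.\<close>
  define S where "S = insert N (\<Union>i<n. supp (y i) \<union> supp (z i) \<union> supp (g i))"
  define M1 where "M1 = Max S"
  have "finite S" unfolding S_def using yz finite_supp by blast
  then have S: "N \<le> M1" "\<And>i. i < n \<Longrightarrow> supp (y i) \<union> supp (z i) \<union> supp (g i) \<subseteq> {..M1}"
    unfolding M1_def by (auto simp: S_def intro!: Max_ge)
  obtain y1 z1 g1 where b1: "balanced U V (2 * j1) M1 y1 z1 g1"
    using balanced_exists[OF U V j1(1)] by blast
  have mapeq: "map (g(n := g1)) [0..<i] = map g [0..<i]" if "i \<le> n" for i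
    using that by (intro map_cong) auto
  have "is_chain U V N L (Suc n) (y(n := y1)) (z(n := z1)) (g(n := g1)) (j(n := j1)) (M(n := M1))"
    unfolding is_chain_def
  proof (intro conjI allI impI)
    fix i assume "i < Suc n"
    then show "1 \<le> (j(n := j1)) i" "N \<le> (M(n := M1)) i"
      "balanced U V (2 * (j(n := j1)) i) ((M(n := M1)) i) ((y(n := y1)) i) ((z(n := z1)) i) ((g(n := g1)) i)"
      using b[of i] b1 j1(1) S(1) by (cases "i = n"; simp)+
  next
    fix k i assume "k < Suc n" "i < k"
    then show "supp ((y(n := y1)) i) \<union> supp ((z(n := z1)) i) \<union> supp ((g(n := g1)) i) \<subseteq> {..(M(n := M1)) k}"
      using s[of k i] S(2)[of i] by (cases "k = n") auto
  next
    show "(j(n := j1)) 0 \<in> N1" "L < mseq (2 * (j(n := j1)) 0)"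
      using j0 j1(2) by (cases "n = 0"; simp)+
  next
    fix i assume i: "i < Suc n" "0 < i"
    then show "map (g(n := g1)) [0..<i] \<in> coding_domain"
      using js[of i] dom mapeq[of i] by (cases "i = n") auto
    show "(j(n := j1)) i = \<sigma> (map (g(n := g1)) [0..<i])"
      using i js[of i] j1(3) mapeq[of i] by (cases "i = n") auto
  qed
  then show ?case by blast
qed

end

section \<open>The sum of a chain and the difference of its halves\<close>

locale chain = coded_space N1 \<sigma> N2 for N1 :: "nat set" and \<sigma> N2 +
  fixes U V :: "vec set" and p N n m :: nat
    and y z g :: "nat \<Rightarrow> vec" and j M :: "nat \<Rightarrow> nat"
  assumes U: "rich U" and V: "rich V" and p: "1 \<le> p"
    and n_def: "n = nseq (2 * p + 1)" and m_def: "m = mseq (2 * p + 1)"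
    and is_chain: "is_chain U V N n n y z g j M"
begin

definition a :: "nat \<Rightarrow> vec" where "a i = (\<lambda>t. \<bar>y i t\<bar> + \<bar>z i t\<bar>)"
definition d :: "nat \<Rightarrow> vec" where "d i = (\<lambda>t. \<bar>y i t\<bar> - \<bar>z i t\<bar>)"

lemma bal: "i < n \<Longrightarrow> 1 \<le> j i \<and> N \<le> M i \<and> balanced U V (2 * j i) (M i) (y i) (z i) (g i)"
  using is_chain by (simp add: is_chain_def)

lemma sup: "k < n \<Longrightarrow> i < k \<Longrightarrow> supp (y i) \<union> supp (z i) \<union> supp (g i) \<subseteq> {..M k}"
  using is_chain by (simp add: is_chain_def)

lemma jcode: "i < n \<Longrightarrow> 0 < i \<Longrightarrow> map g [0..<i] \<in> coding_domain \<and> j i = \<sigma> (map g [0..<i])"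
  using is_chain by (simp add: is_chain_def)

lemma n4: "4 \<le> n" using nseq_ge_4[of "2 * p + 1"] by (simp add: n_def)
lemma j0: "j 0 \<in> N1" "n < mseq (2 * j 0)"
  using is_chain n4 by (simp_all add: is_chain_def)

lemma m2: "2 \<le> m" using mseq_ge_2[of "2 * p + 1"] by (simp add: m_def)

lemma m3n: "m ^ 3 \<le> n"
  using mseq_cube_le_nseq[of "2 * p + 1"] p by (simp add: m_def n_def)

lemma props:
  assumes "i < n"
  shows "1 \<le> j i" "y i \<in> U" "z i \<in> V" "wt (2 * j i) (g i)" "weight N1 \<sigma> (g i) (2 * j i)"
    "supp (y i) \<subseteq> {M i<..}" "supp (z i) \<subseteq> {M i<..}" "supp (g i) \<subseteq> {M i<..}" "supp (g i) \<noteq> {}"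
    "pairing (g i) (abs_vec (y i)) = 1 / 2"
    "\<And>f. f \<in> Wp \<Longrightarrow> pairing f (a i) \<le> 72"
    "\<And>b f. wt b f \<Longrightarrow> b < 2 * j i \<Longrightarrow> pairing f (a i) \<le> 72 / real (mseq b)"
    "\<And>b f. wt b f \<Longrightarrow> 2 * j i < b \<Longrightarrow> pairing f (a i) \<le> 72 / real (mseq (2 * j i)) ^ 2"
    "\<And>E Fs. nat_interval E \<Longrightarrow> \<forall>F\<in>set Fs. finite F \<Longrightarrow> \<bar>pairing (trim E Fs (g i)) (d i)\<bar> \<le>
      (2 + real (\<Sum>F\<leftarrow>Fs. card F)) / (2 ^ length Fs * real (nseq (2 * j i)))"
  using bal[OF assms] unfolding balanced_def a_def d_def by simp_all

lemma yc: "i < n \<Longrightarrow> y i \<in> c00" and zc: "i < n \<Longrightarrow> z i \<in> c00"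
  using props(2,3) rich_c00[OF U] rich_c00[OF V] by blast+

lemma gp: "i < n \<Longrightarrow> g i \<in> Wp"
  using props(4) wt_Wp by blast

lemma ac: "i < n \<Longrightarrow> a i \<in> c00" and dc: "i < n \<Longrightarrow> d i \<in> c00"
  using c00_lincomb[of "abs_vec (y i)" "abs_vec (z i)" 1 1]
    c00_lincomb[of "abs_vec (y i)" "abs_vec (z i)" 1 "-1"] yc[of i] zc[of i]
  by (simp_all add: a_def d_def abs_vec_def c00_abs[unfolded abs_vec_def])

lemma successiveI:
  assumes "\<And>i. i < n \<Longrightarrow> supp (x i) \<subseteq> supp (y i) \<union> supp (z i) \<union> supp (g i)"
  shows "successive {..<n} x"
  unfolding successive_def before_def
proof (intro ballI impI)
  fix i k t t' assume *: "i \<in> {..<n}" "k \<in> {..<n}" "i < k" "t \<in> supp (x i)" "t' \<in> supp (x k)"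
  have "t \<le> M k" using assms[of i] sup[of k i] * by auto
  moreover have "M k < t'" using assms[of k] props(6-8)[of k] * by auto
  ultimately show "t < t'" by simp
qed

lemma supp_d: "supp (d i) \<subseteq> supp (y i) \<union> supp (z i)"
  by (auto simp: d_def supp_def)

lemma suc_g: "successive {..<n} g" and suc_d: "successive {..<n} d" and suc_y: "successive {..<n} y"
  using supp_d by (auto intro!: successiveI)

lemma growth:
  assumes "Suc i < n"
  shows "Max (supp (g i)) < mseq (2 * j (Suc i))" "mseq (2 * j i) < mseq (2 * j (Suc i))"
proof -
  have c: "map g [0..<Suc i] \<in> coding_domain" "j (Suc i) = \<sigma> (map g [0..<Suc i])"
    using jcode[OF assms] by auto
  have l: "last (map g [0..<Suc i]) = g i" by simp
  show "Max (supp (g i)) < mseq (2 * j (Suc i))" "mseq (2 * j i) < mseq (2 * j (Suc i))"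
    using coding_growth[OF c(1) l, of "j i"] props(1,4)[of i] assms unfolding c(2) by simp_all
qed

lemma j_mono: "i < k \<Longrightarrow> k < n \<Longrightarrow> mseq (2 * j i) < mseq (2 * j k)"
proof (induction k)
  case (Suc k)
  then show ?case using growth(2)[of k] by (cases "i = k") (auto intro: less_trans)
qed simp

lemma j_inj: "i < n \<Longrightarrow> k < n \<Longrightarrow> j i = j k \<Longrightarrow> i = k"
  using j_mono[of i k] j_mono[of k i] by (metis less_irrefl linorder_neqE_nat)

lemma n_less_mj: "i < n \<Longrightarrow> n < mseq (2 * j i)"
  using j0(2) j_mono[of 0 i] by (cases "i = 0") (auto intro: less_trans)

lemma special_g: "special N1 \<sigma> p (map g [0..<n])"
proof (rule norming_weight_special.special[where js = j])
  show "sorted_wrt block_less (map g [0..<n])"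
    using suc_g gp props(9) by (intro sorted_map_block_less) (auto intro: Wp_c00)
  show "\<forall>f\<in>set (map g [0..<n]). W f" using gp by (auto intro: Wp_W)
  show "\<forall>i<length (map g [0..<n]). weight N1 \<sigma> (map g [0..<n] ! i) (2 * j i)"
    using props(5) by simp
  show "\<forall>i. i + 1 < length (map g [0..<n]) \<longrightarrow> mseq (2 * j i) < mseq (2 * j (i + 1))"
    using growth(2) by simp
  show "\<forall>i. 0 < i \<and> i < length (map g [0..<n]) \<longrightarrow> j i = \<sigma> (map abs_vec (take i (map g [0..<n])))"
  proof (intro allI impI)
    fix i assume i: "0 < i \<and> i < length (map g [0..<n])"
    then have "map abs_vec (take i (map g [0..<n])) = map g [0..<i]"
      using gp by (auto simp: take_map Wp_abs intro!: map_cong)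
    then show "j i = \<sigma> (map abs_vec (take i (map g [0..<n])))" using jcode[of i] i by simp
  qed
qed (use j0 n_def in auto)

text \<open>The \<open>g i\<close> form a special sequence by construction, so
  \<open>epsilon\<close> makes their average a norming functional, and it collects
  \<open>1 / 2\<close> from each \<open>y i\<close>.\<close>

lemma lower_bound:
  defines "Y \<equiv> (\<lambda>t. \<Sum>i<n. y i t)"
  shows "real n / (2 * real m) \<le> nrm Y"
proof -
  define F where "F = (\<lambda>t. (\<Sum>i<n. g i t) / real m)"
  have "F = abs_vec (scaled_sum (2 * p + 1) (map g [0..<n]))"
    unfolding scaled_sum_map F_def m_def
    by (rule abs_vec_of_nonneg[symmetric])
      (intro divide_nonneg_nonneg sum_nonneg, auto intro: Wp_nonneg gp)
  moreover have "W (scaled_sum (2 * p + 1) (map g [0..<n]))"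
    using norming_weight_special.epsilon[OF p special_g] .
  ultimately have F: "F \<in> Wp" using W_abs by simp
  have absY: "abs_vec Y t = (\<Sum>i<n. abs_vec (y i) t)" for t
    unfolding Y_def abs_vec_def using successive_abs_sum[OF suc_y] by simp
  have Yc: "Y \<in> c00" unfolding Y_def using yc by (intro c00_sum) auto
  have "real n / (2 * real m) = (\<Sum>i<n. 1 / 2) / real m" by simp
  also have "\<dots> \<le> (\<Sum>i<n. pairing (g i) (abs_vec Y)) / real m"
  proof (intro divide_right_mono sum_mono)
    fix i assume i: "i \<in> {..<n}"
    have "pairing (g i) (abs_vec (y i)) \<le> pairing (g i) (abs_vec Y)"
    proof (rule pairing_mono_right)
      show "abs_vec (y i) t \<le> abs_vec Y t" for t
        unfolding absY using i by (intro member_le_sum) (auto simp: abs_vec_nonneg)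
    qed (use i yc Yc Wp_nonneg[OF gp] in auto)
    then show "1 / 2 \<le> pairing (g i) (abs_vec Y)" using props(10)[of i] i by simp
  qed simp
  also have "\<dots> = pairing F (abs_vec Y)"
    unfolding F_def by (simp add: pairing_divide_left pairing_sum_left)
  also have "\<dots> \<le> nrm Y" using pairing_abs_le_nrm[OF F] .
  finally show ?thesis .
qed

lemma pairing_d_le_a:
  assumes "i < n" "\<And>t. 0 \<le> f t"
  shows "\<bar>pairing f (d i)\<bar> \<le> pairing f (a i)"
proof -
  have "pairing f (d i) \<le> pairing f (a i)"
    using assms dc ac by (intro pairing_mono_right) (auto simp: d_def a_def)
  moreover have "pairing f (\<lambda>t. - 1 * d i t) \<le> pairing f (a i)"
    using assms c00_scale[OF dc[of i], of "-1"] ac by (intro pairing_mono_right) (auto simp: d_def a_def)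
  then have "- 1 * pairing f (d i) \<le> pairing f (a i)"
    unfolding pairing_scale_right[OF dc[OF assms(1)]] .
  ultimately show ?thesis by linarith
qed

text \<open>Joins the two sides of the chain weight in one bound: smaller weights contribute their
  own reciprocal, larger ones the squared reciprocal of the weight of the exact vector.\<close>

lemma pairing_a_small:
  assumes "i < n" "wt b f" "b \<noteq> 2 * j i"
  shows "pairing f (a i) \<le> 72 * (1 / real (mseq b) + 1 / real (mseq (2 * j i)) ^ 2)"
proof -
  have "0 \<le> 1 / real (mseq b)" "0 \<le> 1 / real (mseq (2 * j i)) ^ 2" by simp_all
  moreover have "pairing f (a i) \<le> 72 * (1 / real (mseq b)) \<or>
      pairing f (a i) \<le> 72 * (1 / real (mseq (2 * j i)) ^ 2)"
    using props(12,13)[OF assms(1,2)] assms(3) by (cases "b < 2 * j i") auto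
  ultimately show ?thesis unfolding distrib_left by linarith
qed

lemma pairing_sum_d_le:
  assumes "K \<subseteq> {..<n}" "f \<in> Wp"
  shows "\<bar>pairing f (\<lambda>t. \<Sum>k\<in>K. d k t)\<bar> \<le> (\<Sum>k\<in>K. \<bar>pairing f (d k)\<bar>)"
  using assms dc by (subst pairing_sum_right) (auto intro: sum_abs)

lemma inverse_mj_le: "i < n \<Longrightarrow> 1 / real (mseq (2 * j i)) ^ 2 \<le> 1 / real n ^ 2"
  using n_less_mj[of i] n4 by (intro divide_left_mono power_mono mult_pos_pos) auto

text \<open>The weights of the chain are distinct, so \<open>b\<close> matches at most one of them,
  where the trivial bound 72 is used. Elsewhere both reciprocals are at most
  \<open>1 / m ^ 2\<close>, because \<open>mseq b \<ge> m ^ 5\<close> and the chain weights exceed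
  \<open>n \<ge> m\<close>. The constant 6 is dictated by \<open>leaf_critical\<close>, with which
  this is joined into a single leaf estimate.\<close>

lemma leaf_large:
  assumes w: "wt b f" and b: "2 * p + 1 < b" and K: "K \<subseteq> {..<n}"
  shows "\<bar>pairing f (\<lambda>t. \<Sum>k\<in>K. d k t)\<bar> \<le> 72 * (6 + 2 / real m ^ 2 * real (card K))"
proof -
  have f: "f \<in> Wp" using wt_Wp[OF w] .
  have fK: "finite K" using K finite_subset by blast
  let ?X = "{k\<in>{..<n}. 2 * j k = b}"
  have X: "card ?X \<le> 1"
    using card_le_Suc0_iff_eq[of ?X] j_inj by auto
  have m: "2 \<le> real m" using m2 by simp
  have mn: "real m \<le> real n"
    using m3n self_le_power[of m 3] m2 by (simp add: order.trans)
  have mb: "1 / real (mseq b) \<le> 1 / real m ^ 2"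
  proof -
    have "m ^ 2 \<le> m ^ 5" using m2 by (intro power_increasing) auto
    also have "m ^ 5 \<le> mseq b" using mseq_power5_le[OF _ b] by (simp add: m_def)
    finally have "real m ^ 2 \<le> real (mseq b)" by (metis of_nat_le_iff of_nat_power)
    moreover have "0 < real m ^ 2" using m by simp
    ultimately show ?thesis by (intro divide_left_mono mult_pos_pos) linarith+
  qed
  have small: "\<bar>pairing f (d k)\<bar> \<le> 72 * (2 / real m ^ 2)" if "k < n" "2 * j k \<noteq> b" for k
  proof -
    have "\<bar>pairing f (d k)\<bar> \<le> 72 * (1 / real (mseq b) + 1 / real (mseq (2 * j k)) ^ 2)"
      using pairing_d_le_a[OF that(1), of f] pairing_a_small[OF that(1) w] that(2) Wp_nonneg[OF f]
      by fastforce
    moreover have "1 / real n ^ 2 \<le> 1 / real m ^ 2"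
      using m mn by (intro divide_left_mono power_mono mult_pos_pos) auto
    ultimately have "\<bar>pairing f (d k)\<bar> \<le> 72 * (1 / real m ^ 2 + 1 / real m ^ 2)"
      using mb inverse_mj_le[OF that(1)] unfolding distrib_left by linarith
    then show ?thesis by simp
  qed
  have "(\<Sum>k\<in>K. \<bar>pairing f (d k)\<bar>) \<le> 1 * 72 + 72 * (2 / real m ^ 2) * card K"
  proof (rule sum_exceptions[OF fK, of ?X])
    show "\<bar>pairing f (d k)\<bar> \<le> 72" if "k \<in> K" for k
      using pairing_d_le_a[of k f] props(11)[of k f] that K f Wp_nonneg[OF f] by fastforce
    show "\<bar>pairing f (d k)\<bar> \<le> 72 * (2 / real m ^ 2)" if "k \<in> K" "k \<notin> ?X" for k
      using small[of k] that K by auto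
  qed (use X in auto)
  then show ?thesis using pairing_sum_d_le[OF K f] by (simp add: algebra_simps)
qed

end

section \<open>Functionals of the critical weight and the upper bound\<close>

context chain
begin

text \<open>The half-open ranges from \<open>low i\<close> to the end of \<open>g i\<close> are
  disjoint, so a switching set starts inside at most one of them. The value 0 at the first index is
  consistent with this, as switching sets start at 2 or later.\<close>

definition low :: "nat \<Rightarrow> nat" where
  "low i = (case i of 0 \<Rightarrow> 0 | Suc k \<Rightarrow> Max (supp (g k)))"

lemma low_less_mj: "i < n \<Longrightarrow> low i < mseq (2 * j i)"
  using growth(1) n_less_mj by (cases i) (auto simp: low_def intro: le_less_trans)

lemma low_mono:
  assumes "i < k" "k < n"
  shows "Max (supp (g i)) \<le> low k"
proof -
  obtain k' where k': "k = Suc k'" "i \<le> k'" using assms(1) by (cases k) auto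
  show ?thesis
  proof (cases "i = k'")
    case False
    then have "i < k'" using k' by simp
    moreover have "i < n" "k' < n" using assms k' by auto
    moreover have "Max (supp (g k')) \<in> supp (g k')" "Max (supp (g i)) \<in> supp (g i)"
      using Max_in[OF finite_supp[OF Wp_c00[OF gp]] props(9)] \<open>i < n\<close> \<open>k' < n\<close> by blast+
    ultimately have "Max (supp (g i)) < Max (supp (g k'))"
      using suc_g unfolding successive_def before_def by blast
    then show ?thesis using k' by (simp add: low_def)
  qed (simp add: k' low_def)
qed

text \<open>If no switching set starts inside the range of \<open>g i\<close>, each of them either kills \<open>g i\<close> or has
  at most \<open>low i\<close> points, which is small compared with the number of pieces of \<open>g i\<close>.\<close>

lemma pairing_trim_g:
  assumes i: "i < n" and E: "nat_interval E" and Fs: "\<forall>F\<in>set Fs. valid_switch F"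
    and far: "\<And>F. F \<in> set Fs \<Longrightarrow> Min F \<le> low i \<or> Max (supp (g i)) < Min F"
  shows "\<bar>pairing (trim E Fs (g i)) (d i)\<bar> \<le> 2 / real n"
proof (cases "\<exists>F\<in>set Fs. Max (supp (g i)) < Min F")
  case True
  then obtain F where F: "F \<in> set Fs" "Max (supp (g i)) < Min F" by blast
  have "trim E Fs (g i) t = 0" for t
  proof (cases "t \<in> supp (g i)")
    case True
    then have "t < Min F" using F(2) finite_supp[OF Wp_c00[OF gp[OF i]]]
      by (meson Max_ge le_less_trans)
    moreover have "finite F" using Fs F(1) by (simp add: valid_switch_def)
    ultimately have "t \<notin> switch_set F" using switch_set_ge[of F t] by linarith
    then have "\<not> (t \<in> E \<and> (\<forall>F\<in>set Fs. t \<in> switch_set F))" using F(1) by blast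
    then show ?thesis unfolding trim_def by (rule if_not_P)
  qed (auto simp: trim_def supp_def)
  then have "supp (trim E Fs (g i)) = {}" by (simp add: supp_def)
  then show ?thesis by (simp add: pairing_disjoint)
next
  case False
  let ?m = "real (mseq (2 * j i))" and ?n = "real (nseq (2 * j i))" and ?r = "real (length Fs)"
  have j1: "1 \<le> j i" using props(1)[OF i] .
  have m: "2 \<le> ?m" using mseq_ge_2[of "2 * j i"] j1 by simp
  have fin: "\<forall>F\<in>set Fs. finite F" using Fs by (simp add: valid_switch_def)
  have "card F \<le> low i" if "F \<in> set Fs" for F
  proof -
    have "card F \<le> Min F" using Fs that by (auto simp: valid_switch_def)
    also have "\<dots> \<le> low i" using far[OF that] False that by auto
    finally show ?thesis .
  qed
  then have "(\<Sum>F\<leftarrow>Fs. card F) \<le> length Fs * low i"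
    using sum_list_mono[of Fs card "\<lambda>_. low i"] by (simp add: sum_list_triv)
  then have "real (\<Sum>F\<leftarrow>Fs. card F) \<le> real (length Fs * low i)" by (simp only: of_nat_le_iff)
  also have "\<dots> = ?r * real (low i)" by simp
  also have "\<dots> \<le> ?r * ?m" using low_less_mj[OF i] by (intro mult_left_mono) auto
  finally have c: "2 + real (\<Sum>F\<leftarrow>Fs. card F) \<le> 2 + ?r * ?m" by simp
  \<comment> \<open>The number of switching sets is absorbed by the halves that they bring.\<close>
  have r: "?r \<le> 2 ^ length Fs" "(1::real) \<le> 2 ^ length Fs"
    using less_exp[of "length Fs"] by (metis of_nat_le_iff of_nat_numeral of_nat_power less_imp_le) simp
  have "2 + ?r * ?m \<le> 2 ^ length Fs * (2 * ?m)"
  proof -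
    have "?r * ?m \<le> 2 ^ length Fs * ?m" using r m by (intro mult_right_mono) auto
    moreover have "1 * 2 \<le> 2 ^ length Fs * ?m" using r m by (intro mult_mono) auto
    ultimately show ?thesis by simp
  qed
  then have "(2 + real (\<Sum>F\<leftarrow>Fs. card F)) / (2 ^ length Fs * ?n) \<le> (2 ^ length Fs * (2 * ?m)) / (2 ^ length Fs * ?n)"
    using c by (intro divide_right_mono) auto
  also have "\<dots> = 2 * ?m / ?n" by simp
  also have "\<dots> \<le> 2 / real n"
  proof -
    \<comment> \<open>The number of pieces is at least the cube of the weight: one factor pays for
      the switching points, another for \<open>n\<close>.\<close>
    have "?m * real n \<le> ?m * ?m" using n_less_mj[OF i] m by (intro mult_left_mono) auto
    also have "?m * ?m \<le> ?m ^ 3"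
      using power_increasing[of 2 3 ?m] m by (simp add: power2_eq_square)
    also have "\<dots> \<le> ?n" using mseq_cube_le_nseq[of "2 * j i"] j1
      by (metis of_nat_le_iff of_nat_power mult_le_mono2 mult_1_right)
    finally have "?m * real n \<le> ?n" .
    moreover have "0 < ?n" using nseq_ge_4[of "2 * j i"] j1 by simp
    ultimately show ?thesis using n4 by (simp add: field_simps)
  qed
  finally show ?thesis using props(14)[OF i E fin] by linarith
qed

text \<open>Functionals of the critical weight share an initial segment of the chain with \<open>g\<close>; beyond it
  all their weights differ from those of the chain, by injectivity of the coding.\<close>

lemma leaf_critical:
  assumes w: "wt (2 * p + 1) f" and K: "K \<subseteq> {..<n}"
  shows "\<bar>pairing f (\<lambda>t. \<Sum>k\<in>K. d k t)\<bar> \<le> 72 * (6 + 2 / real m ^ 2 * real (card K))"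
proof -
  have f: "f \<in> Wp" using wt_Wp[OF w] .
  have fK: "finite K" using K finite_subset by blast
  have "(2 * p + 1) div 2 = p" by simp
  then obtain hs E Fs where hs: "\<forall>h\<in>set hs. W h" "length hs = n" "sorted_wrt block_less hs"
    "special N1 \<sigma> p hs" and E: "nat_interval E" and Fs: "\<forall>F\<in>set Fs. valid_switch F"
    and fe: "f = trim E Fs (abs_vec (scaled_sum (2 * p + 1) hs))"
    using w unfolding wt_def n_def by auto
  obtain js where js: "\<forall>i<length hs. weight N1 \<sigma> (hs ! i) (2 * js i)" "n < mseq (2 * js 0)"
    "\<forall>i. i + 1 < length hs \<longrightarrow> mseq (2 * js i) < mseq (2 * js (i + 1))" "js 0 \<in> N1"
    "\<forall>i. 0 < i \<and> i < length hs \<longrightarrow> js i = \<sigma> (map abs_vec (take i hs))"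
    using hs(4) by (cases rule: special.cases) (auto simp: n_def)
  define H where "H l = abs_vec (hs ! l)" for l
  have Hwt: "wt (2 * js l) (H l)" if "l < n" for l
    using weight_wt js(1) hs(2) that by (simp add: H_def)
  have HW: "H l \<in> Wp" if "l < n" for l using wt_Wp[OF Hwt[OF that]] .
  have js1: "1 \<le> js l" if "l < n" for l using wt_ge_2[OF Hwt[OF that]] by simp
  have hc: "\<forall>h\<in>set hs. h \<in> c00" using hs(1) W_c00 by blast
  have take_H: "map abs_vec (take l hs) = map H [0..<l]" if "l < n" for l
    using that hs(2) by (intro nth_equalityI) (auto simp: H_def)
  \<comment> \<open>Nonzero supports are read off \<open>block_less\<close> by comparison with
    another member, so the list must have at least two.\<close>
  have H_ne: "supp (H l) \<noteq> {}" if "l < n" for l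
  proof -
    have "1 < n" using n4 by simp
    show ?thesis
    proof (cases "l = 0")
      case True
      then have "block_less (hs ! 0) (hs ! 1)"
        using hs(2,3) \<open>1 < n\<close> by (simp add: sorted_wrt_iff_nth_less)
      then show ?thesis using True by (simp add: H_def block_less_def)
    next
      case False
      then have "block_less (hs ! 0) (hs ! l)"
        using hs(2,3) that by (simp add: sorted_wrt_iff_nth_less)
      then show ?thesis by (simp add: H_def block_less_def)
    qed
  qed
  have Hdom: "map H [0..<l] \<in> coding_domain" if "0 < l" "l < n" for l
  proof (rule coding_domain_map[OF that(1)])
    show "successive {..<l} H"
      using that hs(2) by (intro successive_subset[OF successive_nth[OF hc hs(3)]]) (auto simp: H_def)
    show "H i \<in> c00" "supp (H i) \<noteq> {}" if "i < l" for i
      using that \<open>l < n\<close> Wp_c00[OF HW] H_ne by auto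
    show "H i t \<in> \<rat> \<and> 0 \<le> H i t" if "i < l" for i t
      using that \<open>l < n\<close> Wp_Rats[OF HW] Wp_nonneg[OF HW] by auto
  qed
  \<comment> \<open>Position 0 carries an index from \<open>N1\<close> and every later position a
    code in \<open>N2\<close>, so a match is either at both starts or between two codes. In the
    latter case injectivity returns the words, hence the position and all earlier entries.\<close>
  have key: "l = i \<and> (\<forall>k<i. H k = g k)" if "l < n" "i < n" "js l = j i" for l i
  proof -
    have N2: "js l \<in> N2" if "0 < l" "l < n" for l
      using js(5) hs(2) that take_H coding_N2[OF Hdom] by simp
    have N2': "j i \<in> N2" if "0 < i" "i < n" for i
      using jcode[OF that(2,1)] coding_N2 by simp
    show ?thesis
    proof (cases "i = 0 \<or> l = 0")
      case True
      then have "i = 0 \<and> l = 0"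
        using N2[of l] N2'[of i] that j0(1) js(4) N12(2) by (cases "i = 0"; cases "l = 0"; auto)
      then show ?thesis by simp
    next
      case False
      have "\<sigma> (map H [0..<l]) = \<sigma> (map g [0..<i])"
        using js(5) hs(2) that take_H jcode[of i] False by simp
      then have e: "map H [0..<l] = map g [0..<i]"
        using coding_inj[OF Hdom[of l]] jcode[of i] that False by blast
      then have "length (map H [0..<l]) = length (map g [0..<i])" by (simp only:)
      then have "l = i" by simp
      then show ?thesis using e by simp
    qed
  qed
  have jsmono: "mseq (2 * js 0) < mseq (2 * js l)" if "0 < l" "l < n" for l
    using that
  proof (induction l)
    case (Suc l)
    then have "mseq (2 * js l) < mseq (2 * js (Suc l))" using js(3) hs(2) by simp
    then show ?case using Suc by (cases "l = 0") auto
  qed simp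
  have nn: "4 \<le> real n" using n4 by simp
  \<comment> \<open>The weights grow at least by fifth powers, so all but the first exceed
    \<open>n ^ 2\<close>, and together these add no more than the bound \<open>1 / n\<close> for the
    first.\<close>
  have invjs: "(\<Sum>l<n. 1 / real (mseq (2 * js l))) \<le> 2 / real n"
  proof -
    have "(\<Sum>l<n. 1 / real (mseq (2 * js l))) \<le> 1 * (1 / real n) + 1 / real n ^ 2 * card {..<n}"
    proof (rule sum_exceptions[of _ "{0}"])
      show "1 / real (mseq (2 * js l)) \<le> 1 / real n" if "l \<in> {0}" for l
        using that js(2) nn by (intro divide_left_mono) auto
      show "1 / real (mseq (2 * js l)) \<le> 1 / real n ^ 2" if "l \<in> {..<n}" "l \<notin> {0}" for l
      proof -
        have l: "0 < l" "l < n" using that by auto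
        have "js 0 < js l"
          using jsmono[OF l] mseq_less_iff[of "2 * js 0" "2 * js l"] js1[of 0] js1[of l] l by simp
        then have "mseq (2 * js 0) ^ 5 \<le> mseq (2 * js l)"
          using js1[of 0] l by (intro mseq_power5_le) auto
        moreover have "n ^ 2 \<le> n ^ 5" using n4 by (intro power_increasing) auto
        moreover have "n ^ 5 \<le> mseq (2 * js 0) ^ 5" using js(2) by (intro power_mono) auto
        ultimately have "n ^ 2 \<le> mseq (2 * js l)" by linarith
        then have "real n ^ 2 \<le> real (mseq (2 * js l))" by (metis of_nat_le_iff of_nat_power)
        moreover have "0 < real n ^ 2" using nn by simp
        ultimately show ?thesis by (intro divide_left_mono mult_pos_pos) linarith+
      qed
    qed auto
    then show ?thesis using nn by (simp add: power2_eq_square)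
  qed
  have m: "2 \<le> real m" using m2 by simp
  let ?T = "\<lambda>l. trim E Fs (H l)"
  have fT: "pairing f x = (\<Sum>l<n. pairing (?T l) x) / real m" for x
    unfolding fe abs_scaled_sum[OF hc hs(3)] trim_sum hs(2) H_def[symmetric]
    by (simp add: pairing_divide_left pairing_sum_left m_def)
  have T0: "0 \<le> ?T l t" for l t by (rule trim_nonneg) (simp add: H_def abs_vec_nonneg)
  have Tle: "\<bar>pairing (?T l) (d i)\<bar> \<le> pairing (H l) (a i)" if "i < n" for l i
  proof -
    have "pairing (?T l) (a i) \<le> pairing (H l) (a i)"
      by (intro pairing_mono_left trim_le_self) (auto simp: a_def H_def abs_vec_nonneg)
    then show ?thesis using pairing_d_le_a[OF that, of "?T l"] T0 by force
  qed
  have small: "\<bar>pairing (?T l) (d i)\<bar> \<le> 72 * (1 / real (mseq (2 * js l)) + 1 / real n ^ 2)"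
    if "l < n" "i < n" "js l \<noteq> j i" for l i
    using Tle[OF that(2), of l] pairing_a_small[OF that(2) Hwt[OF that(1)]] inverse_mj_le[OF that(2)] that(3)
    by (smt (verit) mult_left_cancel zero_neq_numeral)
  have small_sum: "(\<Sum>l<n. 72 * (1 / real (mseq (2 * js l)) + 1 / real n ^ 2)) \<le> 216 / real n"
  proof -
    have "(\<Sum>l<n. 72 * (1 / real (mseq (2 * js l)) + 1 / real n ^ 2)) =
        72 * ((\<Sum>l<n. 1 / real (mseq (2 * js l))) + real n * (1 / real n ^ 2))"
      unfolding sum_distrib_left[symmetric] sum.distrib by simp
    also have "real n * (1 / real n ^ 2) = 1 / real n" using nn by (simp add: power2_eq_square)
    finally show ?thesis using invjs by simp
  qed
  have mdiv: "x / real m \<le> x" if "0 \<le> x" for x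
    using that m by (simp add: divide_le_eq mult_le_cancel_left1)
  define agree where "agree i \<longleftrightarrow> (\<forall>k<i. H k = g k)" for i
  \<comment> \<open>The first place where the two sequences part, if there is one. The weight there
    may still be that of the chain, so nothing better than 72 is available.\<close>
  define X where "X = {i\<in>{..<n}. agree i \<and> H i \<noteq> g i}"
  \<comment> \<open>Indices at which some switching set starts inside the range. There are at most
    \<open>length Fs\<close>, and at each of them all the halves of \<open>f\<close> are still
    available.\<close>
  define C where "C = {i\<in>{..<n}. {low i<..Max (supp (g i))} \<inter> Min ` set Fs \<noteq> {}}"
  have cX: "card X \<le> 1"
  proof -
    have "i = k" if "i \<in> X" "k \<in> X" for i k
    proof (rule ccontr)
      assume "i \<noteq> k"
      then show False using that unfolding X_def agree_def
        by (cases "i < k") (auto simp: not_less le_less)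
    qed
    then show ?thesis using card_le_Suc0_iff_eq[of X] by (auto simp: X_def)
  qed
  have cC: "card C \<le> length Fs"
  proof -
    have "card C \<le> card (Min ` set Fs)"
    proof (rule card_hitting[of _ _ "\<lambda>i. {low i<..Max (supp (g i))}"])
      fix i k assume "i \<in> C" "k \<in> C" "i \<noteq> k"
      then show "{low i<..Max (supp (g i))} \<inter> {low k<..Max (supp (g k))} = {}"
        using low_mono[of i k] low_mono[of k i] by (cases "i < k") (auto simp: C_def)
    qed (auto simp: C_def)
    also have "\<dots> \<le> card (set Fs)" by (rule card_image_le) simp
    also have "\<dots> \<le> length Fs" by (rule card_length)
    finally show ?thesis .
  qed
  have bX: "\<bar>pairing f (d i)\<bar> \<le> 72" if "i < n" for i
    using pairing_d_le_a[OF that, of f] props(11)[OF that f] Wp_nonneg[OF f] by fastforce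
  have bC: "\<bar>pairing f (d i)\<bar> \<le> 72 / 2 ^ length Fs" if "i < n" for i
  proof -
    let ?f = "abs_vec (scaled_sum (2 * p + 1) hs)"
    have f1: "?f \<in> Wp" using norming_weight_special.epsilon[OF p hs(4)] by (rule W_abs)
    have "pairing f (a i) \<le> pairing (\<lambda>t. ?f t / 2 ^ length Fs) (a i)"
      unfolding fe by (intro pairing_mono_left trim_le) (auto simp: a_def abs_vec_nonneg)
    also have "\<dots> = pairing ?f (a i) / 2 ^ length Fs" by (rule pairing_divide_left)
    also have "\<dots> \<le> 72 / 2 ^ length Fs" using props(11)[OF that f1] by (intro divide_right_mono) auto
    finally show ?thesis using pairing_d_le_a[OF that, of f] Wp_nonneg[OF f] by fastforce
  qed
  have bR: "\<bar>pairing f (d i)\<bar> \<le> 288 / real n" if i: "i < n" "i \<notin> X" "i \<notin> C" for i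
  proof -
    \<comment> \<open>If an earlier entry differs, no member of the special sequence has the weight
      of \<open>g i\<close>. Otherwise member \<open>i\<close> is \<open>g i\<close> itself, and it
      is the only one with that weight.\<close>
    have "(\<Sum>l<n. \<bar>pairing (?T l) (d i)\<bar>) \<le> 288 / real n"
    proof (cases "agree i")
      case False
      then have "js l \<noteq> j i" if "l < n" for l using key[OF that i(1)] unfolding agree_def by blast
      then have "(\<Sum>l<n. \<bar>pairing (?T l) (d i)\<bar>) \<le>
          (\<Sum>l<n. 72 * (1 / real (mseq (2 * js l)) + 1 / real n ^ 2))"
        using small i(1) by (intro sum_mono) auto
      also have "\<dots> \<le> 216 / real n" by (rule small_sum)
      also have "\<dots> \<le> 288 / real n" by (intro divide_right_mono) auto
      finally show ?thesis .
    next
      case True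
      then have Hi: "H i = g i" using i by (simp add: X_def)
      have "(\<Sum>l<n. \<bar>pairing (?T l) (d i)\<bar>) =
          \<bar>pairing (?T i) (d i)\<bar> + (\<Sum>l\<in>{..<n} - {i}. \<bar>pairing (?T l) (d i)\<bar>)"
        using i(1) by (intro sum.remove) auto
      also have "\<dots> \<le> 2 / real n + 216 / real n"
      proof (rule add_mono)
        show "\<bar>pairing (?T i) (d i)\<bar> \<le> 2 / real n"
          unfolding Hi
        proof (rule pairing_trim_g[OF i(1) E Fs])
          show "Min F \<le> low i \<or> Max (supp (g i)) < Min F" if "F \<in> set Fs" for F
          proof (rule ccontr)
            assume "\<not> ?thesis"
            then have "Min F \<in> {low i<..Max (supp (g i))} \<inter> Min ` set Fs" using that by auto
            then show False using i(1,3) unfolding C_def by blast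
          qed
        qed
        have "(\<Sum>l\<in>{..<n} - {i}. \<bar>pairing (?T l) (d i)\<bar>) \<le>
            (\<Sum>l\<in>{..<n} - {i}. 72 * (1 / real (mseq (2 * js l)) + 1 / real n ^ 2))"
          using small i(1) key by (intro sum_mono) blast
        also have "\<dots> \<le> (\<Sum>l<n. 72 * (1 / real (mseq (2 * js l)) + 1 / real n ^ 2))"
          by (intro sum_mono2) auto
        also have "\<dots> \<le> 216 / real n" by (rule small_sum)
        finally show "(\<Sum>l\<in>{..<n} - {i}. \<bar>pairing (?T l) (d i)\<bar>) \<le> 216 / real n" .
      qed
      also have "\<dots> \<le> 288 / real n" using nn by (simp add: divide_simps)
      finally show ?thesis .
    qed
    then have "\<bar>\<Sum>l<n. pairing (?T l) (d i)\<bar> \<le> 288 / real n"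
      by (rule order.trans[OF sum_abs])
    then have "\<bar>pairing f (d i)\<bar> \<le> (288 / real n) / real m"
      unfolding fT abs_divide abs_of_nat by (rule divide_right_mono) simp
    also have "\<dots> \<le> 288 / real n" by (rule mdiv) simp
    finally show ?thesis .
  qed
  have "\<bar>pairing f (d i)\<bar> \<le> (if i \<in> X then 72 else 0) + (if i \<in> C then 72 / 2 ^ length Fs else 0) + 288 / real n"
    if "i \<in> K" for i
  proof -
    have i: "i < n" using that K by auto
    obtain A B where AB: "A = 288 / real n" "B = (72::real) / 2 ^ length Fs" by blast
    have "0 \<le> A" "0 \<le> B" by (simp_all add: AB)
    then show ?thesis
      using bX[OF i] bC[OF i] bR[OF i] unfolding AB[symmetric]
      by (cases "i \<in> X"; cases "i \<in> C") simp_all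
  qed
  then have "(\<Sum>k\<in>K. \<bar>pairing f (d k)\<bar>) \<le> (\<Sum>i\<in>K. (if i \<in> X then 72 else 0) +
      (if i \<in> C then 72 / 2 ^ length Fs else 0) + 288 / real n)"
    by (rule sum_mono)
  also have "\<dots> = (\<Sum>i\<in>K. if i \<in> X then 72 else 0) + (\<Sum>i\<in>K. if i \<in> C then 72 / 2 ^ length Fs else 0) +
      real (card K) * (288 / real n)"
    by (simp add: sum.distrib)
  \<comment> \<open>The parting index, the starts of switching sets, and all remaining indices. The
    total 432 is the \<open>72 * 6\<close> of the leaf estimate.\<close>
  also have "\<dots> \<le> 72 + 72 + 288"
  proof (intro add_mono)
    have "(\<Sum>i\<in>K. if i \<in> X then 72 else 0) \<le> real (card X) * 72"
      using fK by (intro sum_indicator_le) (auto simp: X_def)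
    also have "\<dots> \<le> 72" using cX by simp
    finally show "(\<Sum>i\<in>K. if i \<in> X then 72 else 0) \<le> (72::real)" .
    have "(\<Sum>i\<in>K. if i \<in> C then 72 / 2 ^ length Fs else 0) \<le> real (card C) * (72 / 2 ^ length Fs)"
      using fK by (intro sum_indicator_le) (auto simp: C_def)
    also have "\<dots> \<le> 2 ^ length Fs * (72 / 2 ^ length Fs)"
    proof (rule mult_right_mono)
      have "card C \<le> 2 ^ length Fs" using cC less_exp[of "length Fs"] by linarith
      then show "real (card C) \<le> 2 ^ length Fs" by (metis of_nat_le_iff of_nat_numeral of_nat_power)
    qed simp
    also have "\<dots> = 72" by simp
    finally show "(\<Sum>i\<in>K. if i \<in> C then 72 / 2 ^ length Fs else 0) \<le> (72::real)" .
    have "card K \<le> n" using K card_mono[of "{..<n}" K] by simp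
    then show "real (card K) * (288 / real n) \<le> 288" using nn by (simp add: divide_le_eq)
  qed
  finally have "(\<Sum>k\<in>K. \<bar>pairing f (d k)\<bar>) \<le> 432" by simp
  moreover have "0 \<le> 2 / real m ^ 2 * real (card K)" by simp
  ultimately show ?thesis using pairing_sum_d_le[OF K f] unfolding distrib_left by linarith
qed

text \<open>With \<open>e = sseq (2 * p)\<close> one has \<open>2 ^ e = m ^ 3\<close>, so unfolding
  the weights below the critical one costs only order \<open>n / m ^ 3\<close>, and the leaf rate
  \<open>2 / m ^ 2\<close> decides. This is one factor \<open>m\<close> better than what a single
  half attains in \<open>lower_bound\<close>.\<close>

lemma upper_bound:
  assumes f: "f \<in> Wp"
  shows "\<bar>pairing f (\<lambda>t. \<Sum>i<n. d i t)\<bar> \<le> 720 * real n / real m ^ 2"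
proof -
  define e where "e = sseq (2 * p)"
  let ?n' = "real (nseq (2 * p))"
  have m: "2 \<le> real m" using m2 by simp
  have m3: "0 < real m ^ 3" using m by simp
  have E: "2 ^ e = real m ^ 3"
  proof -
    have "(2::nat) ^ e = m ^ 3" using two_power_sseq[of "2 * p"] by (simp add: e_def m_def)
    then have "real (2 ^ e) = real (m ^ 3)" by (simp only:)
    then show ?thesis by simp
  qed
  have R: "(2 * ?n') ^ e \<le> real n / real m ^ 3"
  proof -
    have "(2 * nseq (2 * p)) ^ e * m ^ 3 \<le> n"
      using nseq_ratio[of "2 * p"] p by (simp add: e_def m_def n_def)
    then have "real ((2 * nseq (2 * p)) ^ e * m ^ 3) \<le> real n" by (simp only: of_nat_le_iff)
    then show ?thesis using m3 by (simp add: pos_le_divide_eq)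
  qed
  have "\<bar>pairing f (\<lambda>t. \<Sum>i\<in>{..<n}. d i t)\<bar> \<le>
      72 * (6 * (2 * real (nseq (2 * p + 1 - 1))) ^ e + (1 / 2 ^ e + 2 / real m ^ 2) * real (card {..<n}))"
  proof (rule recursion[OF _ _ suc_d _ _ _ _ _ _ _ f])
    show "2 / real m ^ 2 \<le> 1"
    proof -
      have "2 * 2 \<le> real m * real m" using m by (intro mult_mono) auto
      then show ?thesis using m by (simp add: divide_le_eq power2_eq_square)
    qed
    show "\<bar>pairing h (d k)\<bar> \<le> 72" if "h \<in> Wp" "k \<in> {..<n}" for h k
      using pairing_d_le_a[of k h] props(11)[of k h] that Wp_nonneg[of h] by fastforce
    show "\<bar>pairing h (\<lambda>t. \<Sum>k\<in>K. d k t)\<bar> \<le> 72 * (6 + 2 / real m ^ 2 * real (card K))"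
      if "wt i h" "2 * p + 1 \<le> i" "K \<subseteq> {..<n}" for i h K
      using leaf_critical[of h K] leaf_large[of i h K] that by (cases "i = 2 * p + 1") auto
  qed (use p dc in auto)
  then have "\<bar>pairing f (\<lambda>t. \<Sum>i<n. d i t)\<bar> \<le>
      72 * (6 * (2 * ?n') ^ e + (1 / real m ^ 3 + 2 / real m ^ 2) * real n)"
    by (simp add: E)
  also have "\<dots> \<le> 72 * (6 * (real n / real m ^ 3) + (1 / real m ^ 3 + 2 / real m ^ 2) * real n)"
    using R by (intro mult_left_mono add_right_mono) auto
  also have "\<dots> = 72 * real n * (7 * (1 / real m ^ 3) + 2 * (1 / real m ^ 2))"
    by (simp add: field_simps)
  also have "\<dots> \<le> 72 * real n * (7 * (1 / (2 * real m ^ 2)) + 2 * (1 / real m ^ 2))"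
  proof (intro mult_left_mono add_right_mono divide_left_mono)
    show "2 * real m ^ 2 \<le> real m ^ 3" using m by (simp add: power2_eq_square power3_eq_cube)
  qed (use m in auto)
  also have "\<dots> \<le> 720 * real n / real m ^ 2" using m by (simp add: divide_simps)
  finally show ?thesis .
qed

end

section \<open>Nearly equal vectors in two rich families\<close>

context coded_space
begin

lemma close_pair:
  assumes U: "rich U" and V: "rich V" and "0 < \<epsilon>"
  shows "\<exists>v\<in>U. \<exists>w\<in>V. nrm v = 1 \<and> supp v \<union> supp w \<subseteq> {N<..} \<and>
    (\<forall>f\<in>Wp. \<bar>pairing f (abs_vec v) - pairing f (abs_vec w)\<bar> \<le> \<epsilon>)"
proof -
  \<comment> \<open>1440 is twice 720: dividing \<open>upper_bound\<close> by
    \<open>lower_bound\<close> leaves \<open>1440 / m\<close>.\<close>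
  obtain p0 :: nat where p0: "1440 / \<epsilon> < real p0" using reals_Archimedean2 by blast
  define p where "p = Suc p0"
  define n m where "n = nseq (2 * p + 1)" and "m = mseq (2 * p + 1)"
  obtain y z g j M where ch: "is_chain U V N n n y z g j M"
    using chain_exists[OF U V] by blast
  interpret chain N1 \<sigma> N2 U V p N n m y z g j M
    by unfold_locales (use U V ch in \<open>auto simp: p_def n_def m_def\<close>)
  define Y Z where "Y = (\<lambda>t. \<Sum>i<n. y i t)" and "Z = (\<lambda>t. \<Sum>i<n. z i t)"
  define c where "c = 1 / nrm Y"
  have low: "real n / (2 * real m) \<le> nrm Y" using lower_bound unfolding Y_def .
  have pos: "0 < real n / (2 * real m)" using n4 m2 by simp
  have c: "0 < c" using low pos by (simp add: c_def)
  have YU: "Y \<in> U" unfolding Y_def using props(2) by (intro rich_sum[OF U]) auto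
  have ZV: "Z \<in> V" unfolding Z_def using props(3) by (intro rich_sum[OF V]) auto
  have Yc: "Y \<in> c00" and Zc: "Z \<in> c00" using rich_c00[OF U YU] rich_c00[OF V ZV] .
  have sz: "successive {..<n} z" by (rule successiveI) blast
  have D: "(\<lambda>t. abs_vec Y t - abs_vec Z t) = (\<lambda>t. \<Sum>i<n. d i t)"
    unfolding abs_vec_def Y_def Z_def d_def
    using successive_abs_sum[OF suc_y] successive_abs_sum[OF sz] by (simp add: sum_subtractf)
  have "\<bar>pairing f (abs_vec (\<lambda>t. c * Y t)) - pairing f (abs_vec (\<lambda>t. c * Z t))\<bar> \<le> \<epsilon>"
    if f: "f \<in> Wp" for f
  proof -
    have e: "abs_vec (\<lambda>t. c * x t) = (\<lambda>t. c * abs_vec x t)" for x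
      using c by (simp add: abs_vec_def abs_mult)
    have "pairing f (abs_vec (\<lambda>t. c * Y t)) - pairing f (abs_vec (\<lambda>t. c * Z t)) =
        c * pairing f (\<lambda>t. \<Sum>i<n. d i t)"
      unfolding e D[symmetric] using Yc Zc
      by (simp add: pairing_scale_right pairing_diff_right right_diff_distrib)
    then have "\<bar>pairing f (abs_vec (\<lambda>t. c * Y t)) - pairing f (abs_vec (\<lambda>t. c * Z t))\<bar> =
        c * \<bar>pairing f (\<lambda>t. \<Sum>i<n. d i t)\<bar>" using c by (simp add: abs_mult)
    also have "\<dots> \<le> c * (720 * real n / real m ^ 2)"
      using upper_bound[OF f] c by (intro mult_left_mono) auto
    also have "\<dots> \<le> (2 * real m / real n) * (720 * real n / real m ^ 2)"
    proof (rule mult_right_mono)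
      show "c \<le> 2 * real m / real n"
        using le_imp_inverse_le[OF low pos] by (simp add: c_def inverse_eq_divide)
    qed simp
    also have "\<dots> = 1440 / real m" using n4 m2 by (simp add: power2_eq_square)
    also have "\<dots> \<le> \<epsilon>"
    proof -
      have "p0 \<le> mseq (2 * p + 1)" using mseq_ge_self[of "2 * p + 1"] by (simp add: p_def)
      then have "1440 / \<epsilon> \<le> real m" using p0 by (simp add: m_def)
      then show ?thesis using \<open>0 < \<epsilon>\<close> m2 by (simp add: field_simps)
    qed
    finally show ?thesis .
  qed
  moreover have "nrm (\<lambda>t. c * Y t) = 1"
    using low pos by (simp only: nrm_scale[OF Yc]) (simp add: c_def)
  moreover have "supp (\<lambda>t. c * Y t) \<union> supp (\<lambda>t. c * Z t) \<subseteq> {N<..}"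
  proof -
    have "supp (y i) \<union> supp (z i) \<subseteq> {N<..}" if "i < n" for i
      using props(6,7)[OF that] bal[OF that] by auto
    then have "supp Y \<union> supp Z \<subseteq> {N<..}"
      using supp_sum[of y "{..<n}"] supp_sum[of z "{..<n}"] unfolding Y_def Z_def by blast
    then show ?thesis by (auto simp: supp_def)
  qed
  moreover have "(\<lambda>t. c * Y t) \<in> U" "(\<lambda>t. c * Z t) \<in> V"
    using rich_scale[OF U YU] rich_scale[OF V ZV] by blast+
  ultimately show ?thesis by blast
qed

end

section \<open>Subspaces of the completion\<close>

lemma subspace_closure:
  fixes S :: "'b::real_normed_vector set"
  assumes "subspace S"
  shows "subspace (closure S)"
  unfolding subspace_def
proof (intro conjI ballI allI)
  show "0 \<in> closure S" using assms closure_subset subspace_0 by blast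
  fix x assume x: "x \<in> closure S"
  then obtain f where f: "\<And>n. f n \<in> S" "f \<longlonglongrightarrow> x" by (auto simp: closure_sequential)
  show "c *\<^sub>R x \<in> closure S" for c
    unfolding closure_sequential using f assms
    by (intro exI[of _ "\<lambda>n. c *\<^sub>R f n"]) (auto intro!: tendsto_intros subspace_scale)
  fix y assume "y \<in> closure S"
  then obtain h where h: "\<And>n. h n \<in> S" "h \<longlonglongrightarrow> y" by (auto simp: closure_sequential)
  show "x + y \<in> closure S"
    unfolding closure_sequential using f h assms
    by (intro exI[of _ "\<lambda>n. f n + h n"]) (auto intro!: tendsto_intros subspace_add)
qed

text \<open>The inequality turns convergence of the first coordinates into the Cauchy property of
  the second ones, and completeness of \<open>X\<close> supplies the limit.\<close>

lemma closure_graph_total: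
  fixes G :: "('b::real_normed_vector \<times> 'b) set"
  assumes G: "subspace G" and "0 < c" "\<And>x. x \<in> G \<Longrightarrow> c * norm (snd x) \<le> norm (fst x)"
    and X: "complete X" "snd ` G \<subseteq> X" and y: "y \<in> closure (fst ` G)"
  shows "\<exists>z. (y, z) \<in> closure G"
proof -
  obtain f where f: "\<And>n. f n \<in> fst ` G" "f \<longlonglongrightarrow> y" using y by (auto simp: closure_sequential)
  have "\<exists>h. h \<in> G \<and> fst h = f n" for n using f(1)[of n] by auto
  then obtain h where h: "\<And>n. h n \<in> G" "\<And>n. fst (h n) = f n" by metis
  have d: "c * norm (snd (h k) - snd (h l)) \<le> norm (f k - f l)" for k l
    using assms(3)[OF subspace_diff[OF G h(1)[of k] h(1)[of l]]] by (simp add: h(2))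
  have "Cauchy (\<lambda>n. snd (h n))"
  proof (rule CauchyI)
    fix e :: real assume "0 < e"
    have "Cauchy f" using f(2) by (rule LIMSEQ_imp_Cauchy)
    then obtain N where N: "\<And>k l. N \<le> k \<Longrightarrow> N \<le> l \<Longrightarrow> norm (f k - f l) < c * e"
      using CauchyD[of f "c * e"] \<open>0 < e\<close> \<open>0 < c\<close> by (metis mult_pos_pos)
    have "norm (snd (h k) - snd (h l)) < e" if "N \<le> k" "N \<le> l" for k l
    proof -
      have "c * norm (snd (h k) - snd (h l)) < c * e" using N[OF that] d[of k l] by linarith
      then show ?thesis using \<open>0 < c\<close> by simp
    qed
    then show "\<exists>M. \<forall>m\<ge>M. \<forall>n\<ge>M. norm (snd (h m) - snd (h n)) < e" by blast
  qed
  moreover have "snd (h n) \<in> X" for n using h(1) X(2) by blast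
  ultimately obtain z where z: "(\<lambda>n. snd (h n)) \<longlonglongrightarrow> z"
    using X(1)[unfolded complete_def, rule_format, of "\<lambda>n. snd (h n)"] by auto
  have "h = (\<lambda>n. (f n, snd (h n)))" using h(2) by (metis prod.collapse)
  then have "h \<longlonglongrightarrow> (y, z)" using tendsto_Pair[OF f(2) z] by simp
  then show ?thesis using h(1) by (auto simp: closure_sequential)
qed

text \<open>A relation replaces a map, so that well-definedness and extension by continuity need no
  separate treatment: both inequalities pass to the closure of \<open>G\<close>, where they give
  uniqueness in each coordinate. The situation is symmetric, and \<open>prod.swap\<close> yields the
  inverse.\<close>

lemma graph_isomorphism:
  fixes G :: "('b::real_normed_vector \<times> 'b) set"
  assumes G: "subspace G" and c: "0 < c" "\<And>x. x \<in> G \<Longrightarrow> c * norm (snd x) \<le> norm (fst x)"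
    and b: "0 < b" "\<And>x. x \<in> G \<Longrightarrow> b * norm (fst x) \<le> norm (snd x)"
    and X: "complete X" "fst ` G \<subseteq> X" "snd ` G \<subseteq> X"
  shows "isomorphic_subspaces (closure (fst ` G)) (closure (snd ` G))"
proof -
  let ?H = "closure G"
  have H: "subspace ?H" using subspace_closure[OF G] .
  have Hc: "c * norm (snd x) \<le> norm (fst x)" if "x \<in> ?H" for x
  proof -
    have "closed {x. c * norm (snd x) \<le> norm (fst (x :: 'b \<times> 'b))}"
      by (intro closed_Collect_le continuous_intros)
    then have "?H \<subseteq> {x. c * norm (snd x) \<le> norm (fst x)}"
      using c(2) by (intro closure_minimal) auto
    then show ?thesis using that by blast
  qed
  have Hb: "b * norm (fst x) \<le> norm (snd x)" if "x \<in> ?H" for x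
  proof -
    have "closed {x. b * norm (fst x) \<le> norm (snd (x :: 'b \<times> 'b))}"
      by (intro closed_Collect_le continuous_intros)
    then have "?H \<subseteq> {x. b * norm (fst x) \<le> norm (snd x)}"
      using b(2) by (intro closure_minimal) auto
    then show ?thesis using that by blast
  qed
  let ?Y = "closure (fst ` G)" and ?Z = "closure (snd ` G)"
  have tot1: "\<exists>z. (y, z) \<in> ?H" if "y \<in> ?Y" for y
    using closure_graph_total[OF G c X(1,3) that] .
  let ?G' = "prod.swap ` G"
  have G': "subspace ?G'"
  proof -
    have "linear (prod.swap :: 'b \<times> 'b \<Rightarrow> 'b \<times> 'b)" by (intro linearI) auto
    then show ?thesis using G by (rule linear_subspace_image)
  qed
  have swapH: "(z, y) \<in> closure ?G' \<Longrightarrow> (y, z) \<in> ?H" for y z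
  proof -
    assume "(z, y) \<in> closure ?G'"
    then obtain f where f: "\<And>n. f n \<in> ?G'" "f \<longlonglongrightarrow> (z, y)" by (auto simp: closure_sequential)
    have "(\<lambda>n. prod.swap (f n)) \<longlonglongrightarrow> (y, z)"
      using tendsto_Pair[OF tendsto_snd[OF f(2)] tendsto_fst[OF f(2)]] by (simp add: prod.swap_def)
    moreover have "prod.swap (f n) \<in> G" for n using f(1)[of n] by auto
    ultimately show ?thesis
      unfolding closure_sequential by (intro exI[of _ "\<lambda>n. prod.swap (f n)"]) simp
  qed
  have tot2: "\<exists>y. (y, z) \<in> ?H" if "z \<in> ?Z" for z
  proof -
    have im: "fst ` ?G' = snd ` G" "snd ` ?G' = fst ` G" by (auto simp: image_image)
    have "\<exists>y. (z, y) \<in> closure ?G'"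
      by (rule closure_graph_total[OF G' b(1) _ X(1)]) (use b(2) X that im in auto)
    then show ?thesis using swapH by blast
  qed
  have mem: "y \<in> ?Y \<and> z \<in> ?Z" if yz: "(y, z) \<in> ?H" for y z
  proof -
    obtain f where f: "\<And>n. f n \<in> G" "f \<longlonglongrightarrow> (y, z)" using yz by (auto simp: closure_sequential)
    have "(\<lambda>n. fst (f n)) \<longlonglongrightarrow> y" "(\<lambda>n. snd (f n)) \<longlonglongrightarrow> z"
      using tendsto_fst[OF f(2)] tendsto_snd[OF f(2)] by simp_all
    then show ?thesis
      unfolding closure_sequential using f(1)
      by (intro conjI exI[of _ "\<lambda>n. fst (f n)"] exI[of _ "\<lambda>n. snd (f n)"]) auto
  qed
  have uniq1: "z = z'" if "(y, z) \<in> ?H" "(y, z') \<in> ?H" for y z z'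
    using Hc[OF subspace_diff[OF H that]] c(1) by (simp add: mult_le_0_iff)
  have uniq2: "y = y'" if "(y, z) \<in> ?H" "(y', z) \<in> ?H" for y y' z
    using Hb[OF subspace_diff[OF H that]] b(1) by (simp add: mult_le_0_iff)
  obtain T where T: "\<And>y. y \<in> ?Y \<Longrightarrow> (y, T y) \<in> ?H" using tot1 by metis
  obtain S where S: "\<And>z. z \<in> ?Z \<Longrightarrow> (S z, z) \<in> ?H" using tot2 by metis
  have Yl: "subspace ?Y" using linear_subspace_image[OF linear_fst G] by (rule subspace_closure)
  have "linear_map_on ?Y T"
    unfolding linear_map_on_def
  proof (intro ballI allI)
    fix x y r s assume xy: "x \<in> ?Y" "y \<in> ?Y"
    have "r *\<^sub>R (x, T x) + s *\<^sub>R (y, T y) \<in> ?H"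
      using T xy H by (intro subspace_add subspace_scale) auto
    then have "(r *\<^sub>R x + s *\<^sub>R y, r *\<^sub>R T x + s *\<^sub>R T y) \<in> ?H" by simp
    moreover have "r *\<^sub>R x + s *\<^sub>R y \<in> ?Y" using xy Yl by (intro subspace_add subspace_scale)
    ultimately show "T (r *\<^sub>R x + s *\<^sub>R y) = r *\<^sub>R T x + s *\<^sub>R T y" using uniq1 T by blast
  qed
  moreover have "homeomorphism ?Y ?Z T S"
    unfolding homeomorphism_def
  proof (intro conjI ballI)
    have "(1 / c)-lipschitz_on ?Y T"
    proof (rule lipschitz_onI)
      fix x y assume "x \<in> ?Y" "y \<in> ?Y"
      then show "dist (T x) (T y) \<le> 1 / c * dist x y"
        using Hc[OF subspace_diff[OF H T T]] c(1) by (simp add: dist_norm field_simps)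
    qed (use c in simp)
    then show "continuous_on ?Y T" by (rule lipschitz_on_continuous_on)
    have "(1 / b)-lipschitz_on ?Z S"
    proof (rule lipschitz_onI)
      fix x y assume "x \<in> ?Z" "y \<in> ?Z"
      then show "dist (S x) (S y) \<le> 1 / b * dist x y"
        using Hb[OF subspace_diff[OF H S S]] b(1) by (simp add: dist_norm field_simps)
    qed (use b in simp)
    then show "continuous_on ?Z S" by (rule lipschitz_on_continuous_on)
    have TZ: "T x \<in> ?Z" if "x \<in> ?Y" for x using mem[OF T[OF that]] by blast
    have SY: "S x \<in> ?Y" if "x \<in> ?Z" for x using mem[OF S[OF that]] by blast
    show ST: "S (T x) = x" if "x \<in> ?Y" for x using uniq2[OF S[OF TZ[OF that]] T[OF that]] .
    show TS: "T (S x) = x" if "x \<in> ?Z" for x using uniq1[OF T[OF SY[OF that]] S[OF that]] .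
    show "T ` ?Y = ?Z" using TZ TS SY by force
    show "S ` ?Z = ?Y" using SY ST TZ by force
  qed
  ultimately show ?thesis unfolding isomorphic_subspaces_def by blast
qed

text \<open>The coefficient bound gives independence. Distinctness of the vectors comes first, since
  a set of vectors cannot record repetitions.\<close>

lemma infinite_dimensional_sequence:
  fixes y :: "nat \<Rightarrow> 'b::real_normed_vector"
  assumes "0 < \<kappa>" "\<And>K r k. finite K \<Longrightarrow> k \<in> K \<Longrightarrow> \<kappa> * \<bar>r k\<bar> \<le> norm (\<Sum>k\<in>K. r k *\<^sub>R y k)"
    "range y \<subseteq> S"
  shows "infinite_dimensional S"
  unfolding infinite_dimensional_def
proof
  assume "\<exists>B. finite B \<and> S \<subseteq> span B"
  then obtain B where B: "finite B" "S \<subseteq> span B" by blast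
  have inj: "inj y"
  proof (rule injI, rule ccontr)
    fix k l assume "y k = y l" "k \<noteq> l"
    then have "(\<Sum>i\<in>{k, l}. (if i = k then 1 else -1) *\<^sub>R y i) = 0" by simp
    then show False
      using assms(1) assms(2)[of "{k, l}" k "\<lambda>i. if i = k then 1 else -1"] by simp
  qed
  have "independent (range y)"
    unfolding dependent_explicit
  proof (intro notI, elim exE conjE bexE)
    fix t u v assume t: "finite t" "t \<subseteq> range y" "(\<Sum>v\<in>t. u v *\<^sub>R v) = 0" "v \<in> t" "u v \<noteq> 0"
    define K where "K = y -` t"
    have yK: "t = y ` K" using t(2) by (auto simp: K_def)
    have fK: "finite K" unfolding K_def using t(1) inj by (rule finite_vimageI)
    obtain k where k: "k \<in> K" "v = y k" using t(4) yK by auto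
    have "(\<Sum>k\<in>K. u (y k) *\<^sub>R y k) = 0"
      using t(3) inj unfolding yK by (subst (asm) sum.reindex) (auto intro: inj_on_subset)
    then show False using assms(1) assms(2)[OF fK k(1), of "\<lambda>k. u (y k)"] k t(5)
      by (simp add: mult_le_0_iff)
  qed
  then have "finite (range y)"
    using independent_span_bound[OF B(1)] assms(3) B(2) by blast
  then show False using inj finite_imageD by blast
qed

text \<open>The kernel has codimension at most one, so a finite spanning set of it would need only
  one further vector to span \<open>Y\<close>.\<close>

lemma infinite_dimensional_kernel:
  fixes \<phi> :: "'b::real_normed_vector \<Rightarrow> real"
  assumes Y: "subspace Y" "infinite_dimensional Y"
    and \<phi>: "\<And>x y a b. x \<in> Y \<Longrightarrow> y \<in> Y \<Longrightarrow> \<phi> (a *\<^sub>R x + b *\<^sub>R y) = a * \<phi> x + b * \<phi> y"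
  shows "subspace {y\<in>Y. \<phi> y = 0}" "infinite_dimensional {y\<in>Y. \<phi> y = 0}"
proof -
  have z: "\<phi> 0 = 0" using \<phi>[of 0 0 0 0] subspace_0[OF Y(1)] by simp
  have add: "\<phi> (x + y) = \<phi> x + \<phi> y" if "x \<in> Y" "y \<in> Y" for x y using \<phi>[OF that, of 1 1] by simp
  have scale: "\<phi> (a *\<^sub>R x) = a * \<phi> x" if "x \<in> Y" for x a using \<phi>[OF that that, of a 0] by simp
  show "subspace {y\<in>Y. \<phi> y = 0}"
    using Y(1) z add scale by (simp add: subspace_def)
  show "infinite_dimensional {y\<in>Y. \<phi> y = 0}"
  proof (cases "\<exists>y0\<in>Y. \<phi> y0 \<noteq> 0")
    case True
    then obtain y0 where y0: "y0 \<in> Y" "\<phi> y0 \<noteq> 0" by blast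
    show ?thesis
      unfolding infinite_dimensional_def
    proof
      assume "\<exists>B. finite B \<and> {y\<in>Y. \<phi> y = 0} \<subseteq> span B"
      then obtain B where B: "finite B" "{y\<in>Y. \<phi> y = 0} \<subseteq> span B" by blast
      have "Y \<subseteq> span (insert y0 B)"
      proof
        fix y assume y: "y \<in> Y"
        have "y - (\<phi> y / \<phi> y0) *\<^sub>R y0 \<in> {y\<in>Y. \<phi> y = 0}"
          using \<phi>[OF y y0(1), of 1 "- (\<phi> y / \<phi> y0)"] y y0 Y(1)
          by (auto intro!: subspace_diff subspace_scale)
        then have "y - (\<phi> y / \<phi> y0) *\<^sub>R y0 \<in> span B" using B(2) by blast
        then show "y \<in> span (insert y0 B)" unfolding span_breakdown_eq by blast
      qed
      then show False using Y(2) B(1) unfolding infinite_dimensional_def by blast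
    qed
  next
    case False
    then have "{y\<in>Y. \<phi> y = 0} = Y" by blast
    then show ?thesis using Y(2) by simp
  qed
qed

section \<open>Perturbation of block combinations\<close>

context norming_space
begin

lemma nrm_le_sum_abs: "nrm x \<le> (\<Sum>i\<in>supp x. \<bar>x i\<bar>)"
proof (rule nrm_le)
  fix f assume "f \<in> Wp"
  then show "pairing f (abs_vec x) \<le> (\<Sum>i\<in>supp x. \<bar>x i\<bar>)"
    using pairing_W_le[OF Wp_W, of f "abs_vec x"] unfolding supp_abs by (simp add: abs_vec_def)
qed

lemma comb_c00: "(\<And>k. v k \<in> c00) \<Longrightarrow> (\<lambda>i. \<Sum>k\<in>K. r k * v k i) \<in> c00"
  by (intro c00_sum c00_scale)

text \<open>Along a block sequence a single term is dominated pointwise by the modulus of the sum,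
  and the norm is monotone in moduli.\<close>

lemma coeff_le_nrm:
  assumes v: "successive K v" "\<And>k. v k \<in> c00" and K: "finite K" "k \<in> K"
  shows "\<bar>r k\<bar> * nrm (v k) \<le> nrm (\<lambda>i. \<Sum>k\<in>K. r k * v k i)"
proof -
  have s: "successive K (\<lambda>k i. r k * v k i)"
    using v(1) by (rule successive_subset) (auto simp: supp_def)
  have "nrm (\<lambda>i. r k * v k i) \<le> nrm (\<lambda>i. \<Sum>k\<in>K. r k * v k i)"
  proof (rule nrm_mono)
    fix i
    have "\<bar>r k * v k i\<bar> \<le> (\<Sum>k\<in>K. \<bar>r k * v k i\<bar>)"
      using K member_le_sum[of k K "\<lambda>k. \<bar>r k * v k i\<bar>"] by simp
    then show "\<bar>r k * v k i\<bar> \<le> \<bar>\<Sum>k\<in>K. r k * v k i\<bar>"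
      using successive_abs_sum[OF s K(1), of i] by simp
  qed (use v(2) in \<open>auto intro: comb_c00 c00_scale\<close>)
  then show ?thesis using nrm_scale[OF v(2)] by simp
qed

text \<open>For a block sequence the modulus of a combination is the combination of the moduli with
  coefficients \<open>\<bar>r k\<bar>\<close>. Comparing \<open>v k\<close> and \<open>w k\<close>
  one at a time under nonnegative functionals is therefore enough, even though their supports may
  differ.\<close>

lemma nrm_comb_close:
  assumes v: "successive K v" "\<And>k. v k \<in> c00" and w: "successive K w" "\<And>k. w k \<in> c00"
    and K: "finite K"
    and close: "\<And>k f. f \<in> Wp \<Longrightarrow> \<bar>pairing f (abs_vec (v k)) - pairing f (abs_vec (w k))\<bar> \<le> \<epsilon> k"
  shows "nrm (\<lambda>i. \<Sum>k\<in>K. r k * w k i) \<le> nrm (\<lambda>i. \<Sum>k\<in>K. r k * v k i) + (\<Sum>k\<in>K. \<bar>r k\<bar> * \<epsilon> k)"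
proof (rule nrm_le)
  fix f assume f: "f \<in> Wp"
  have e: "pairing f (abs_vec (\<lambda>i. \<Sum>k\<in>K. r k * x k i)) = (\<Sum>k\<in>K. \<bar>r k\<bar> * pairing f (abs_vec (x k)))"
    if x: "successive K x" "\<And>k. x k \<in> c00" for x
  proof -
    have "successive K (\<lambda>k i. r k * x k i)"
      using x(1) by (rule successive_subset) (auto simp: supp_def)
    then have "abs_vec (\<lambda>i. \<Sum>k\<in>K. r k * x k i) = (\<lambda>i. \<Sum>k\<in>K. \<bar>r k\<bar> * abs_vec (x k) i)"
      using successive_abs_sum[of K "\<lambda>k i. r k * x k i"] K by (simp add: abs_vec_def abs_mult)
    then show ?thesis
      using x(2) by (simp add: pairing_sum_right pairing_scale_right c00_scale)
  qed
  have "(\<Sum>k\<in>K. \<bar>r k\<bar> * pairing f (abs_vec (w k))) \<le>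
      (\<Sum>k\<in>K. \<bar>r k\<bar> * pairing f (abs_vec (v k)) + \<bar>r k\<bar> * \<epsilon> k)"
  proof (rule sum_mono)
    fix k
    have "pairing f (abs_vec (w k)) \<le> pairing f (abs_vec (v k)) + \<epsilon> k"
      using close[OF f, of k] by linarith
    then have "\<bar>r k\<bar> * pairing f (abs_vec (w k)) \<le> \<bar>r k\<bar> * (pairing f (abs_vec (v k)) + \<epsilon> k)"
      by (intro mult_left_mono) auto
    then show "\<bar>r k\<bar> * pairing f (abs_vec (w k)) \<le> \<bar>r k\<bar> * pairing f (abs_vec (v k)) + \<bar>r k\<bar> * \<epsilon> k"
      by (simp add: distrib_left)
  qed
  also have "\<dots> = pairing f (abs_vec (\<lambda>i. \<Sum>k\<in>K. r k * v k i)) + (\<Sum>k\<in>K. \<bar>r k\<bar> * \<epsilon> k)"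
    using e[OF v] by (simp add: sum.distrib)
  finally show "pairing f (abs_vec (\<lambda>i. \<Sum>k\<in>K. r k * w k i)) \<le>
      nrm (\<lambda>i. \<Sum>k\<in>K. r k * v k i) + (\<Sum>k\<in>K. \<bar>r k\<bar> * \<epsilon> k)"
    using e[OF w] pairing_abs_le_nrm[OF f, of "\<lambda>i. \<Sum>k\<in>K. r k * v k i"] by linarith
qed

end

section \<open>Coordinates and subspaces of the completion\<close>

locale completed_space = coded_space N1 \<sigma> N2 for N1 :: "nat set" and \<sigma> N2 +
  fixes J :: "vec \<Rightarrow> 'a::real_normed_vector" and X :: "'a set"
  assumes completion: "is_c00_completion nrm J X"
begin

lemma X: "subspace X" "complete X" "X \<subseteq> closure (J ` c00)"
  and J_lincomb: "x \<in> c00 \<Longrightarrow> y \<in> c00 \<Longrightarrow> J (\<lambda>i. a * x i + b * y i) = a *\<^sub>R J x + b *\<^sub>R J y"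
  and norm_J: "x \<in> c00 \<Longrightarrow> norm (J x) = nrm x"
  using completion unfolding is_c00_completion_def by auto

lemma J_diff: "x \<in> c00 \<Longrightarrow> y \<in> c00 \<Longrightarrow> J (\<lambda>i. x i - y i) = J x - J y"
  using J_lincomb[of x y 1 "-1"] by simp

lemma J_sum:
  assumes "\<And>k. v k \<in> c00" "finite K"
  shows "J (\<lambda>i. \<Sum>k\<in>K. r k * v k i) = (\<Sum>k\<in>K. r k *\<^sub>R J (v k))"
  using assms(2)
proof induction
  case empty
  show ?case using J_lincomb[OF c00_zero c00_zero, of 0 0] by simp
next
  case (insert k K)
  then show ?case
    using J_lincomb[OF assms(1) comb_c00[OF assms(1), where K = K and r = r], where a = "r k" and b = 1]
    by simp
qed

lemma approx_J: "x \<in> X \<Longrightarrow> 0 < \<delta> \<Longrightarrow> \<exists>u\<in>c00. norm (J u - x) < \<delta>"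
  using X(3) closure_approachable[of x "J ` c00"] by (force simp: dist_norm)

text \<open>The continuous extension of the \<open>i\<close>-th coordinate. It exists because the intervals of radius
  \<open>norm (J u - x)\<close> about \<open>u i\<close> meet pairwise.\<close>

definition coord :: "nat \<Rightarrow> 'a \<Rightarrow> real" where
  "coord i x = (SUP u\<in>c00. u i - norm (J u - x))"

lemma coord_approx:
  assumes u: "u \<in> c00"
  shows "\<bar>u i - coord i x\<bar> \<le> norm (J u - x)"
proof -
  have le: "v i - norm (J v - x) \<le> w i + norm (J w - x)" if "v \<in> c00" "w \<in> c00" for v w
  proof -
    have "(\<lambda>i. v i - w i) \<in> c00" using c00_lincomb[OF that, of 1 "-1"] by simp
    then have "\<bar>v i - w i\<bar> \<le> norm (J v - J w)"
      using coord_le_nrm[of "\<lambda>i. v i - w i" i] norm_J[of "\<lambda>i. v i - w i"] J_diff[OF that] by simp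
    also have "\<dots> \<le> norm (J v - x) + norm (J w - x)"
      using norm_triangle_ineq4[of "J v - x" "J w - x"] by simp
    finally show ?thesis by linarith
  qed
  have "bdd_above ((\<lambda>v. v i - norm (J v - x)) ` c00)"
    using le[OF _ u] by (intro bdd_aboveI2[of _ _ "u i + norm (J u - x)"])
  then have "u i - norm (J u - x) \<le> coord i x"
    unfolding coord_def using u by (intro cSUP_upper)
  moreover have "coord i x \<le> u i + norm (J u - x)"
    unfolding coord_def using le[OF _ u] u by (intro cSUP_least) auto
  ultimately show ?thesis by linarith
qed

lemma coord_linear:
  assumes "x \<in> X" "y \<in> X"
  shows "coord i (a *\<^sub>R x + b *\<^sub>R y) = a * coord i x + b * coord i y"
proof -
  let ?D = "\<bar>coord i (a *\<^sub>R x + b *\<^sub>R y) - (a * coord i x + b * coord i y)\<bar>"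
  have "?D \<le> e" if e: "0 < e" for e
  proof -
    \<comment> \<open>The error \<open>\<bar>a\<bar> * \<delta> + \<bar>b\<bar> * \<delta>\<close>
      occurs twice, once for the combination and once for the separate coordinates; the summand 1
      keeps the denominator positive.\<close>
    define \<delta> where "\<delta> = e / (2 * (\<bar>a\<bar> + \<bar>b\<bar> + 1))"
    have \<delta>: "0 < \<delta>" "2 * (\<bar>a\<bar> + \<bar>b\<bar>) * \<delta> \<le> e"
    proof -
      have p: "0 < 2 * (\<bar>a\<bar> + \<bar>b\<bar> + 1)" by simp
      show "0 < \<delta>" unfolding \<delta>_def using e p by (rule divide_pos_pos)
      then have "2 * (\<bar>a\<bar> + \<bar>b\<bar>) * \<delta> \<le> 2 * (\<bar>a\<bar> + \<bar>b\<bar> + 1) * \<delta>" by (intro mult_right_mono) auto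
      also have "\<dots> = e" unfolding \<delta>_def using p by (metis less_irrefl nonzero_mult_div_cancel_left times_divide_eq_right)
      finally show "2 * (\<bar>a\<bar> + \<bar>b\<bar>) * \<delta> \<le> e" .
    qed
    obtain u v where u: "u \<in> c00" "norm (J u - x) < \<delta>" and v: "v \<in> c00" "norm (J v - y) < \<delta>"
      using approx_J[OF assms(1) \<delta>(1)] approx_J[OF assms(2) \<delta>(1)] by blast
    let ?w = "\<lambda>i. a * u i + b * v i"
    have "J ?w - (a *\<^sub>R x + b *\<^sub>R y) = a *\<^sub>R (J u - x) + b *\<^sub>R (J v - y)"
      using J_lincomb[OF u(1) v(1)] by (simp add: algebra_simps)
    then have "norm (J ?w - (a *\<^sub>R x + b *\<^sub>R y)) \<le> \<bar>a\<bar> * norm (J u - x) + \<bar>b\<bar> * norm (J v - y)"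
      using norm_triangle_ineq[of "a *\<^sub>R (J u - x)" "b *\<^sub>R (J v - y)"] by simp
    also have "\<dots> \<le> \<bar>a\<bar> * \<delta> + \<bar>b\<bar> * \<delta>" using u v by (intro add_mono mult_left_mono) auto
    finally have 1: "\<bar>?w i - coord i (a *\<^sub>R x + b *\<^sub>R y)\<bar> \<le> \<bar>a\<bar> * \<delta> + \<bar>b\<bar> * \<delta>"
      using coord_approx[OF c00_lincomb[OF u(1) v(1), of a b], of i "a *\<^sub>R x + b *\<^sub>R y"] by linarith
    have 2: "\<bar>a * u i - a * coord i x\<bar> \<le> \<bar>a\<bar> * \<delta>"
      using coord_approx[OF u(1), of i x] u(2)
      by (simp add: abs_mult mult_left_mono flip: right_diff_distrib)
    have 3: "\<bar>b * v i - b * coord i y\<bar> \<le> \<bar>b\<bar> * \<delta>"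
      using coord_approx[OF v(1), of i y] v(2)
      by (simp add: abs_mult mult_left_mono flip: right_diff_distrib)
    have tri: "\<bar>t - (q + r)\<bar> \<le> C + (A + B)"
      if "\<bar>q' + r' - t\<bar> \<le> C" "\<bar>q' - q\<bar> \<le> A" "\<bar>r' - r\<bar> \<le> B" for q q' r r' t A B C :: real
      using that by linarith
    have "?D \<le> 2 * (\<bar>a\<bar> * \<delta> + \<bar>b\<bar> * \<delta>)" using tri[OF 1 2 3] by (simp only: mult_2)
    also have "\<dots> \<le> e" using \<delta>(2) by (simp add: algebra_simps)
    finally show ?thesis .
  qed
  then have "?D \<le> 0" using field_le_epsilon[of ?D 0] by simp
  then show ?thesis by simp
qed

lemma tail_kernel:
  assumes "subspace Y" "infinite_dimensional Y" "Y \<subseteq> X"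
  shows "subspace {y\<in>Y. \<forall>i<N. coord i y = 0} \<and> infinite_dimensional {y\<in>Y. \<forall>i<N. coord i y = 0}"
proof (induction N)
  case 0
  then show ?case using assms by simp
next
  case (Suc N)
  let ?Y = "{y\<in>Y. \<forall>i<N. coord i y = 0}"
  have "{y\<in>Y. \<forall>i<Suc N. coord i y = 0} = {y\<in>?Y. coord N y = 0}"
    by (auto simp: less_Suc_eq)
  moreover have "coord N (a *\<^sub>R x + b *\<^sub>R y) = a * coord N x + b * coord N y"
    if "x \<in> ?Y" "y \<in> ?Y" for x y a b
    using that assms(3) by (intro coord_linear) auto
  note infinite_dimensional_kernel[of ?Y "coord N", OF conjunct1[OF Suc] conjunct2[OF Suc] this]
  ultimately show ?case by simp
qed

text \<open>Finitely many vanishing coordinates leave infinite dimension, hence a unit vector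
  \<open>y\<close>. An approximant of \<open>y\<close> has small coordinates up to \<open>N\<close>,
  and deleting these is cheap.\<close>

lemma tail_vector:
  assumes Y: "subspace Y" "infinite_dimensional Y" "Y \<subseteq> X" and "0 < \<epsilon>"
  shows "\<exists>y\<in>Y. \<exists>u\<in>c00. supp u \<subseteq> {N<..} \<and> 1 / 2 \<le> nrm u \<and> norm (y - J u) \<le> \<epsilon>"
proof -
  let ?K = "{y\<in>Y. \<forall>i<Suc N. coord i y = 0}"
  have K: "subspace ?K" "infinite_dimensional ?K" using tail_kernel[OF Y] by blast+
  have "\<not> ?K \<subseteq> {0}"
  proof
    assume "?K \<subseteq> {0}"
    then have "?K \<subseteq> span {}" by simp
    then show False using K(2) unfolding infinite_dimensional_def by blast
  qed
  then obtain y0 where y0: "y0 \<in> ?K" "y0 \<noteq> 0" by blast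
  define y where "y = (1 / norm y0) *\<^sub>R y0"
  have y: "y \<in> ?K" "norm y = 1"
    using subspace_scale[OF K(1) y0(1)] y0(2) by (simp_all add: y_def)
  \<comment> \<open>The \<open>N + 1\<close> deleted coordinates cost \<open>\<delta>\<close> each
    and the approximation one more. The cap \<open>1 / 2\<close> keeps \<open>nrm u\<close> at least
    \<open>1 / 2\<close>.\<close>
  define \<delta> where "\<delta> = min \<epsilon> (1 / 2) / (real N + 2)"
  have \<delta>: "0 < \<delta>" "(real N + 2) * \<delta> = min \<epsilon> (1 / 2)" using \<open>0 < \<epsilon>\<close> by (simp_all add: \<delta>_def)
  have "y \<in> X" using y Y by blast
  then obtain u0 where u0: "u0 \<in> c00" "norm (J u0 - y) < \<delta>" using approx_J \<delta>(1) by blast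
  define u where "u = restr {N<..} u0"
  define r where "r = restr {..N} u0"
  have uc: "u \<in> c00" and rc: "r \<in> c00"
    using c00_subset[OF u0(1)] supp_restr unfolding u_def r_def by blast+
  have "nrm r \<le> (\<Sum>i\<in>supp r. \<bar>r i\<bar>)" by (rule nrm_le_sum_abs)
  also have "\<dots> \<le> (\<Sum>i\<in>{..N}. \<delta>)"
  proof (rule order.trans[OF sum_mono2[of "{..N}"] sum_mono])
    show "supp r \<subseteq> {..N}" using supp_restr[of "{..N}" u0] unfolding r_def by blast
    show "\<bar>r i\<bar> \<le> \<delta>" if "i \<in> {..N}" for i
      using coord_approx[OF u0(1), of i y] u0(2) y(1) that by (simp add: r_def restr_def)
  qed auto
  also have "\<dots> = (real N + 1) * \<delta>" by simp
  finally have r: "norm (J r) \<le> (real N + 1) * \<delta>" using norm_J[OF rc] by simp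
  have "u = (\<lambda>i. u0 i - r i)" by (auto simp: u_def r_def restr_def)
  then have Ju: "J u = J u0 - J r" using J_diff[OF u0(1) rc] by simp
  have "y - J u = (y - J u0) + J r" unfolding Ju by simp
  then have "norm (y - J u) \<le> norm (J u0 - y) + norm (J r)"
    using norm_triangle_ineq[of "y - J u0" "J r"] by (simp only: norm_minus_commute)
  also have "\<dots> \<le> (real N + 2) * \<delta>" using u0(2) r by (simp add: algebra_simps)
  finally have d: "norm (y - J u) \<le> min \<epsilon> (1 / 2)" using \<delta>(2) by simp
  have "1 \<le> norm (J u) + norm (y - J u)"
    using norm_triangle_ineq[of "J u" "y - J u"] y(2) by simp
  then have "1 / 2 \<le> nrm u" using d norm_J[OF uc] by simp
  moreover have "supp u \<subseteq> {N<..}" using supp_restr[of "{N<..}" u0] unfolding u_def by blast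
  ultimately show ?thesis using y(1) uc d by auto
qed

text \<open>A gliding hump, with an error relative to the norm on the whole family. Coefficients are
  at most \<open>2 * nrm v\<close>, because \<open>nrm (u k) \<ge> 1 / 2\<close>, and the geometric
  sum is at most 2; the factor \<open>\<epsilon> / 4\<close> brings the total to
  \<open>\<epsilon> * nrm v\<close>.\<close>

lemma close_rich_space:
  assumes Y: "subspace Y" "infinite_dimensional Y" "Y \<subseteq> X" and "0 < \<epsilon>"
  shows "\<exists>U. rich U \<and> (\<forall>v\<in>U. \<exists>y\<in>Y. norm (y - J v) \<le> \<epsilon> * nrm v)"
proof -
  define P where "P n x \<longleftrightarrow> fst x \<in> Y \<and> snd x \<in> c00 \<and> 1 / 2 \<le> nrm (snd x) \<and>
    norm (fst x - J (snd x)) \<le> \<epsilon> / 4 * (1 / 2) ^ n" for n :: nat and x :: "'a \<times> vec"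
  have "\<exists>x. \<forall>n. P n (x n) \<and> supp (snd (x (Suc n))) \<subseteq> {Max (supp (snd (x n)))<..}"
  proof (rule dependent_nat_choice)
    show "\<exists>x. P 0 x"
      using tail_vector[OF Y, of "\<epsilon> / 4" 0] \<open>0 < \<epsilon>\<close> by (force simp: P_def)
    show "\<exists>x'. P (Suc n) x' \<and> supp (snd x') \<subseteq> {Max (supp (snd x))<..}" for x and n
      using tail_vector[OF Y, of "\<epsilon> / 4 * (1 / 2) ^ Suc n" "Max (supp (snd x))"] \<open>0 < \<epsilon>\<close>
      by (force simp: P_def)
  qed
  then obtain x where x: "\<And>n. P n (x n)" "\<And>n. supp (snd (x (Suc n))) \<subseteq> {Max (supp (snd (x n)))<..}"
    by blast
  define y u where "y n = fst (x n)" and "u n = snd (x n)" for n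
  have yu: "y n \<in> Y" "u n \<in> c00" "1 / 2 \<le> nrm (u n)" "norm (y n - J (u n)) \<le> \<epsilon> / 4 * (1 / 2) ^ n" for n
    using x(1)[of n] by (simp_all add: P_def y_def u_def)
  have ne: "supp (u n) \<noteq> {}" for n
  proof
    assume "supp (u n) = {}"
    then have "nrm (u n) \<le> 0" using nrm_le_sum_abs[of "u n"] by simp
    then show False using yu(3)[of n] by simp
  qed
  have suc: "successive UNIV u" using yu(2) ne x(2) unfolding u_def by (intro successive_chain)
  define U where "U = {v. \<exists>K r. finite K \<and> v = (\<lambda>i. \<Sum>k\<in>K. r k * u k i)}"
  have "rich U"
    unfolding rich_def
  proof (intro conjI ballI allI)
    show "U \<subseteq> c00" using comb_c00[OF yu(2)] by (auto simp: U_def)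
    fix v w a b assume "v \<in> U" "w \<in> U"
    then obtain K L r s where K: "finite K" "v = (\<lambda>i. \<Sum>k\<in>K. r k * u k i)"
      and L: "finite L" "w = (\<lambda>i. \<Sum>k\<in>L. s k * u k i)" by (auto simp: U_def)
    let ?r = "\<lambda>k. a * (if k \<in> K then r k else 0) + b * (if k \<in> L then s k else 0)"
    have "a * v i + b * w i = (\<Sum>k\<in>K \<union> L. ?r k * u k i)" for i
    proof -
      have "v i = (\<Sum>k\<in>K \<union> L. (if k \<in> K then r k else 0) * u k i)"
        unfolding K(2) using K(1) L(1) by (intro sum.mono_neutral_cong_left) auto
      moreover have "w i = (\<Sum>k\<in>K \<union> L. (if k \<in> L then s k else 0) * u k i)"
        unfolding L(2) using K(1) L(1) by (intro sum.mono_neutral_cong_left) auto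
      ultimately show ?thesis
        by (simp only: sum_distrib_left sum.distrib[symmetric]) (intro sum.cong refl, simp only: distrib_right mult.assoc)
    qed
    then show "(\<lambda>i. a * v i + b * w i) \<in> U"
      unfolding U_def using K(1) L(1) by (intro CollectI exI[of _ "K \<union> L"] exI[of _ ?r]) simp
  next
    fix N
    have ge: "k \<le> t" if "t \<in> supp (u k)" for k t
      using that
    proof (induction k arbitrary: t)
      case (Suc k)
      have "Max (supp (u k)) \<in> supp (u k)" using Max_in[OF finite_supp[OF yu(2)] ne] .
      then have "k \<le> Max (supp (u k))" by (rule Suc.IH)
      moreover have "Max (supp (u k)) < t" using x(2)[of k] Suc.prems by (auto simp: u_def)
      ultimately show ?case by simp
    qed simp
    have "u (Suc N) \<in> U"
      unfolding U_def by (intro CollectI exI[of _ "{Suc N}"] exI[of _ "\<lambda>k. 1"]) simp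
    moreover have "supp (u (Suc N)) \<subseteq> {N<..}" using ge[of _ "Suc N"] by fastforce
    ultimately show "\<exists>x\<in>U. supp x \<noteq> {} \<and> supp x \<subseteq> {N<..}" using ne by blast
  qed
  moreover have "\<exists>y\<in>Y. norm (y - J v) \<le> \<epsilon> * nrm v" if "v \<in> U" for v
  proof -
    obtain K r where K: "finite K" and v: "v = (\<lambda>i. \<Sum>k\<in>K. r k * u k i)"
      using \<open>v \<in> U\<close> by (auto simp: U_def)
    have vc: "v \<in> c00" unfolding v by (rule comb_c00[OF yu(2)])
    let ?y = "\<Sum>k\<in>K. r k *\<^sub>R y k"
    have "?y - J v = (\<Sum>k\<in>K. r k *\<^sub>R (y k - J (u k)))"
      unfolding v J_sum[OF yu(2) K] by (simp add: scaleR_diff_right sum_subtractf)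
    then have "norm (?y - J v) \<le> (\<Sum>k\<in>K. \<bar>r k\<bar> * norm (y k - J (u k)))"
      by (simp add: order.trans[OF norm_sum])
    also have "\<dots> \<le> (\<Sum>k\<in>K. 2 * nrm v * (\<epsilon> / 4 * (1 / 2) ^ k))"
    proof (intro sum_mono mult_mono)
      fix k assume k: "k \<in> K"
      have "\<bar>r k\<bar> * nrm (u k) \<le> nrm v"
        unfolding v using suc by (intro coeff_le_nrm yu(2) K k) (auto intro: successive_subset)
      moreover have "\<bar>r k\<bar> * (1 / 2) \<le> \<bar>r k\<bar> * nrm (u k)" using yu(3) by (intro mult_left_mono) auto
      ultimately show "\<bar>r k\<bar> \<le> 2 * nrm v" by linarith
      show "0 \<le> 2 * nrm v" using nrm_nonneg[OF vc] by simp
    qed (use yu in auto)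
    also have "\<dots> = 2 * nrm v * (\<epsilon> / 4) * (\<Sum>k\<in>K. (1 / 2) ^ k)"
      by (simp add: sum_distrib_left mult.assoc)
    also have "\<dots> \<le> 2 * nrm v * (\<epsilon> / 4) * 2"
    proof (rule mult_left_mono)
      show "(\<Sum>k\<in>K. (1 / 2) ^ k) \<le> (2 :: real)"
        using sum_le_suminf[of "\<lambda>k. (1 / 2 :: real) ^ k" K] K by (simp add: suminf_geometric)
    qed (use nrm_nonneg[OF vc] \<open>0 < \<epsilon>\<close> in simp)
    finally have "norm (?y - J v) \<le> \<epsilon> * nrm v" by simp
    moreover have "?y \<in> Y" using Y(1) yu(1) by (intro subspace_sum subspace_scale)
    ultimately show ?thesis by blast
  qed
  ultimately show ?thesis by blast
qed

lemma close_pair_in_subspaces: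
  assumes Y: "subspace Y" "infinite_dimensional Y" "Y \<subseteq> X"
    and Z: "subspace Z" "infinite_dimensional Z" "Z \<subseteq> X" and \<epsilon>: "0 < \<epsilon>" "\<epsilon> \<le> 1"
  shows "\<exists>v\<in>c00. \<exists>w\<in>c00. \<exists>y\<in>Y. \<exists>z\<in>Z. nrm v = 1 \<and> supp v \<union> supp w \<subseteq> {N<..} \<and>
    (\<forall>f\<in>Wp. \<bar>pairing f (abs_vec v) - pairing f (abs_vec w)\<bar> \<le> \<epsilon>) \<and>
    norm (y - J v) \<le> \<epsilon> \<and> norm (z - J w) \<le> 2 * \<epsilon>"
proof -
  obtain U where U: "rich U" "\<forall>v\<in>U. \<exists>y\<in>Y. norm (y - J v) \<le> \<epsilon> * nrm v"
    using close_rich_space[OF Y \<epsilon>(1)] by blast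
  obtain V where V: "rich V" "\<forall>w\<in>V. \<exists>z\<in>Z. norm (z - J w) \<le> \<epsilon> * nrm w"
    using close_rich_space[OF Z \<epsilon>(1)] by blast
  obtain v w where vw: "v \<in> U" "w \<in> V" "nrm v = 1" "supp v \<union> supp w \<subseteq> {N<..}"
    "\<forall>f\<in>Wp. \<bar>pairing f (abs_vec v) - pairing f (abs_vec w)\<bar> \<le> \<epsilon>"
    using close_pair[OF U(1) V(1) \<epsilon>(1), of N] by blast
  \<comment> \<open>Only \<open>v\<close> is normalized. Closeness under all functionals keeps the
    norm of \<open>w\<close> at most \<open>1 + \<epsilon>\<close>, which accounts for the error
    \<open>2 * \<epsilon>\<close> on \<open>z\<close>.\<close>
  have "nrm w \<le> 2"
  proof (rule nrm_le)
    fix f assume f: "f \<in> Wp"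
    then have "pairing f (abs_vec w) \<le> pairing f (abs_vec v) + \<epsilon>" using vw(5) by fastforce
    then show "pairing f (abs_vec w) \<le> 2"
      using pairing_abs_le_nrm[OF f, of v] vw(3) \<epsilon>(2) by linarith
  qed
  then have "\<epsilon> * nrm w \<le> 2 * \<epsilon>" using \<epsilon>(1) by simp
  moreover obtain y z where "y \<in> Y" "norm (y - J v) \<le> \<epsilon> * nrm v" "z \<in> Z" "norm (z - J w) \<le> \<epsilon> * nrm w"
    using U(2) V(2) vw by blast
  moreover have "v \<in> c00" "w \<in> c00" using rich_c00[OF U(1) vw(1)] rich_c00[OF V(1) vw(2)] .
  ultimately have "nrm v = 1 \<and> supp v \<union> supp w \<subseteq> {N<..} \<and>
    (\<forall>f\<in>Wp. \<bar>pairing f (abs_vec v) - pairing f (abs_vec w)\<bar> \<le> \<epsilon>) \<and>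
    norm (y - J v) \<le> \<epsilon> \<and> norm (z - J w) \<le> 2 * \<epsilon>"
    using vw by simp
  then show ?thesis using \<open>v \<in> c00\<close> \<open>w \<in> c00\<close> \<open>y \<in> Y\<close> \<open>z \<in> Z\<close> by blast
qed

lemma quasi_minimal_X: "quasi_minimal X"
  unfolding quasi_minimal_def
proof (intro allI impI)
  fix Y Z assume "inf_closed_subspace X Y" "inf_closed_subspace X Z"
  moreover have cX: "closed X" using X(2) by (rule complete_imp_closed)
  ultimately have Y: "subspace Y" "infinite_dimensional Y" "Y \<subseteq> X" "closed Y"
    and Z: "subspace Z" "infinite_dimensional Z" "Z \<subseteq> X" "closed Z"
    unfolding inf_closed_subspace_def
    by (auto dest: closedin_imp_subset intro: closedin_closed_trans)
  \<comment> \<open>The errors sum to at most \<open>1 / 16\<close>. The norms of the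
    \<open>y\<close> and \<open>w\<close> combinations then differ from that of the \<open>v\<close>
    combination by at most one sixteenth of it, and that of the \<open>z\<close> combination by at
    most three, so the equivalence constant \<open>1 / 2\<close> has room to spare.\<close>
  define \<epsilon> where "\<epsilon> k = (1 / 32) * (1 / 2 :: real) ^ k" for k :: nat
  have \<epsilon>: "0 < \<epsilon> k" "\<epsilon> k \<le> 1" for k
    using power_le_one[of "1 / 2 :: real" k] by (simp_all add: \<epsilon>_def)
  have \<epsilon>sum: "(\<Sum>k\<in>K. \<epsilon> k) \<le> 1 / 16" if "finite K" for K
  proof -
    have "(\<Sum>k\<in>K. (1 / 2) ^ k) \<le> (2 :: real)"
      using sum_le_suminf[of "\<lambda>k. (1 / 2 :: real) ^ k" K] that by (simp add: suminf_geometric)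
    then show ?thesis unfolding \<epsilon>_def sum_distrib_left[symmetric] by simp
  qed
  define P where "P k q \<longleftrightarrow> (case q of (v, w, y, z) \<Rightarrow> v \<in> c00 \<and> w \<in> c00 \<and> y \<in> Y \<and> z \<in> Z \<and>
    nrm v = 1 \<and> (\<forall>f\<in>Wp. \<bar>pairing f (abs_vec v) - pairing f (abs_vec w)\<bar> \<le> \<epsilon> k) \<and>
    norm (y - J v) \<le> \<epsilon> k \<and> norm (z - J w) \<le> 2 * \<epsilon> k)"
    for k :: nat and q :: "vec \<times> vec \<times> 'a \<times> 'a"
  define Q where "Q q q' \<longleftrightarrow> (case q of (v, w, y, z) \<Rightarrow> case q' of (v', w', y', z') \<Rightarrow>
    supp v' \<union> supp w' \<subseteq> {Max (supp v \<union> supp w)<..})" for q q' :: "vec \<times> vec \<times> 'a \<times> 'a"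
  have ex: "\<exists>q. P k q \<and> supp (fst q) \<union> supp (fst (snd q)) \<subseteq> {N<..}" for k N
  proof -
    obtain v w y z where "v \<in> c00" "w \<in> c00" "y \<in> Y" "z \<in> Z" "nrm v = 1"
      "supp v \<union> supp w \<subseteq> {N<..}" "\<forall>f\<in>Wp. \<bar>pairing f (abs_vec v) - pairing f (abs_vec w)\<bar> \<le> \<epsilon> k"
      "norm (y - J v) \<le> \<epsilon> k" "norm (z - J w) \<le> 2 * \<epsilon> k"
      using close_pair_in_subspaces[OF Y(1-3) Z(1-3) \<epsilon>(1)[of k] \<epsilon>(2)[of k], of N] by blast
    then show ?thesis by (intro exI[of _ "(v, w, y, z)"]) (simp add: P_def)
  qed
  have "\<exists>q. \<forall>k. P k (q k) \<and> Q (q k) (q (Suc k))"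
  proof (rule dependent_nat_choice)
    show "\<exists>q. P 0 q" using ex by blast
    show "\<exists>q'. P (Suc k) q' \<and> Q q q'" for q k
    proof -
      obtain q' where "P (Suc k) q'"
        "supp (fst q') \<union> supp (fst (snd q')) \<subseteq> {Max (supp (fst q) \<union> supp (fst (snd q)))<..}"
        using ex by blast
      moreover from this(2) have "Q q q'" by (cases q; cases q') (simp add: Q_def)
      ultimately show ?thesis by blast
    qed
  qed
  then obtain q where q: "\<And>k. P k (q k)" "\<And>k. Q (q k) (q (Suc k))" by blast
  define v w y z where "v k = fst (q k)" and "w k = fst (snd (q k))" and
    "y k = fst (snd (snd (q k)))" and "z k = snd (snd (snd (q k)))" for k
  have qe: "q k = (v k, w k, y k, z k)" for k by (simp add: v_def w_def y_def z_def)
  have p: "v k \<in> c00" "w k \<in> c00" "y k \<in> Y" "z k \<in> Z" "nrm (v k) = 1"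
    "\<And>f. f \<in> Wp \<Longrightarrow> \<bar>pairing f (abs_vec (v k)) - pairing f (abs_vec (w k))\<bar> \<le> \<epsilon> k"
    "norm (y k - J (v k)) \<le> \<epsilon> k" "norm (z k - J (w k)) \<le> 2 * \<epsilon> k" for k
    using q(1)[of k] unfolding P_def qe by simp_all
  have vne: "supp (v k) \<noteq> {}" for k
    using nrm_le_sum_abs[of "v k"] p(5)[of k] by force
  \<comment> \<open>Separating the joint supports makes both \<open>v\<close> and \<open>w\<close>
    successive in one application of \<open>successive_chain\<close>.\<close>
  let ?x = "\<lambda>k i. \<bar>v k i\<bar> + \<bar>w k i\<bar>"
  have sx: "supp (?x k) = supp (v k) \<union> supp (w k)" for k by (auto simp: supp_def)
  have "successive UNIV ?x"
  proof (rule successive_chain)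
    show "?x k \<in> c00" for k
      using c00_lincomb[of "abs_vec (v k)" "abs_vec (w k)" 1 1] p(1,2) by (simp add: abs_vec_def[of "v k"] abs_vec_def[of "w k"] c00_abs[unfolded abs_vec_def])
    show "supp (?x k) \<noteq> {}" for k unfolding sx using vne by blast
    show "supp (?x (Suc k)) \<subseteq> {Max (supp (?x k))<..}" for k
      unfolding sx using q(2)[of k] unfolding Q_def qe by simp
  qed
  then have sv: "successive K v" and sw: "successive K w" for K
    using sx by (auto elim!: successive_subset)
  define G where "G = {(\<Sum>k\<in>K. r k *\<^sub>R y k, \<Sum>k\<in>K. r k *\<^sub>R z k) | K r. finite K}"
  have est: "(1 / 2) * norm (\<Sum>k\<in>K. r k *\<^sub>R z k) \<le> norm (\<Sum>k\<in>K. r k *\<^sub>R y k) \<and>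
      (1 / 2) * norm (\<Sum>k\<in>K. r k *\<^sub>R y k) \<le> norm (\<Sum>k\<in>K. r k *\<^sub>R z k) \<and>
      (\<forall>k\<in>K. (1 / 2) * \<bar>r k\<bar> \<le> norm (\<Sum>k\<in>K. r k *\<^sub>R y k)) \<and>
      (\<forall>k\<in>K. (1 / 2) * \<bar>r k\<bar> \<le> norm (\<Sum>k\<in>K. r k *\<^sub>R z k))" if K: "finite K" for K r
  proof -
    define s where "s = nrm (\<lambda>i. \<Sum>k\<in>K. r k * v k i)"
    define t where "t = nrm (\<lambda>i. \<Sum>k\<in>K. r k * w k i)"
    have s0: "0 \<le> s" unfolding s_def by (intro nrm_nonneg comb_c00 p(1))
    have rs: "\<bar>r k\<bar> \<le> s" if "k \<in> K" for k
      using coeff_le_nrm[OF sv p(1) K that, of r] p(5) by (simp add: s_def)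
    have err: "(\<Sum>k\<in>K. \<bar>r k\<bar> * \<epsilon> k) \<le> s / 16"
    proof -
      have "(\<Sum>k\<in>K. \<bar>r k\<bar> * \<epsilon> k) \<le> (\<Sum>k\<in>K. s * \<epsilon> k)"
        using rs \<epsilon>(1) by (intro sum_mono mult_right_mono) (auto intro: less_imp_le)
      also have "\<dots> = s * (\<Sum>k\<in>K. \<epsilon> k)" by (simp add: sum_distrib_left)
      also have "\<dots> \<le> s * (1 / 16)" using s0 \<epsilon>sum[OF K] by (rule mult_left_mono[rotated])
      finally show ?thesis by simp
    qed
    have "t \<le> s + (\<Sum>k\<in>K. \<bar>r k\<bar> * \<epsilon> k)"
      unfolding s_def t_def using p(6) by (intro nrm_comb_close sv sw p(1,2) K)
    moreover have "s \<le> t + (\<Sum>k\<in>K. \<bar>r k\<bar> * \<epsilon> k)"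
      unfolding s_def t_def using p(6)
      by (intro nrm_comb_close sv sw p(1,2) K) (simp add: abs_minus_commute)
    moreover have "\<bar>norm (\<Sum>k\<in>K. r k *\<^sub>R y k) - s\<bar> \<le> (\<Sum>k\<in>K. \<bar>r k\<bar> * \<epsilon> k)"
    proof -
      have "s = norm (\<Sum>k\<in>K. r k *\<^sub>R J (v k))"
        unfolding s_def using J_sum[OF p(1) K, of r] norm_J[OF comb_c00[OF p(1), where K = K and r = r]] by simp
      then have "\<bar>norm (\<Sum>k\<in>K. r k *\<^sub>R y k) - s\<bar> \<le> norm (\<Sum>k\<in>K. r k *\<^sub>R (y k - J (v k)))"
        using norm_triangle_ineq3[of "\<Sum>k\<in>K. r k *\<^sub>R y k" "\<Sum>k\<in>K. r k *\<^sub>R J (v k)"]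
        by (simp add: scaleR_diff_right sum_subtractf)
      also have "\<dots> \<le> (\<Sum>k\<in>K. \<bar>r k\<bar> * \<epsilon> k)"
        using p(7) by (intro order.trans[OF norm_sum] sum_mono) (simp add: mult_left_mono)
      finally show ?thesis .
    qed
    moreover have "\<bar>norm (\<Sum>k\<in>K. r k *\<^sub>R z k) - t\<bar> \<le> 2 * (\<Sum>k\<in>K. \<bar>r k\<bar> * \<epsilon> k)"
    proof -
      have "t = norm (\<Sum>k\<in>K. r k *\<^sub>R J (w k))"
        unfolding t_def using J_sum[OF p(2) K, of r] norm_J[OF comb_c00[OF p(2), where K = K and r = r]] by simp
      then have "\<bar>norm (\<Sum>k\<in>K. r k *\<^sub>R z k) - t\<bar> \<le> norm (\<Sum>k\<in>K. r k *\<^sub>R (z k - J (w k)))"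
        using norm_triangle_ineq3[of "\<Sum>k\<in>K. r k *\<^sub>R z k" "\<Sum>k\<in>K. r k *\<^sub>R J (w k)"]
        by (simp add: scaleR_diff_right sum_subtractf)
      also have "\<dots> \<le> (\<Sum>k\<in>K. \<bar>r k\<bar> * (2 * \<epsilon> k))"
        using p(8) by (intro order.trans[OF norm_sum] sum_mono) (simp only: norm_scaleR mult_left_mono abs_ge_zero)
      also have "\<dots> = 2 * (\<Sum>k\<in>K. \<bar>r k\<bar> * \<epsilon> k)" by (simp add: sum_distrib_left mult.left_commute)
      finally show ?thesis .
    qed
    ultimately have b: "15 / 16 * s \<le> norm (\<Sum>k\<in>K. r k *\<^sub>R y k)" "norm (\<Sum>k\<in>K. r k *\<^sub>R y k) \<le> 17 / 16 * s"
      "13 / 16 * s \<le> norm (\<Sum>k\<in>K. r k *\<^sub>R z k)" "norm (\<Sum>k\<in>K. r k *\<^sub>R z k) \<le> 19 / 16 * s"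
      using err by linarith+
    show ?thesis
    proof (intro conjI ballI)
      fix k assume "k \<in> K"
      then show "(1 / 2) * \<bar>r k\<bar> \<le> norm (\<Sum>k\<in>K. r k *\<^sub>R y k)" "(1 / 2) * \<bar>r k\<bar> \<le> norm (\<Sum>k\<in>K. r k *\<^sub>R z k)"
        using rs[of k] b s0 by linarith+
    qed (use b s0 in linarith)+
  qed
  have Gsub: "subspace G"
    unfolding subspace_def
  proof (intro conjI ballI allI)
    show "0 \<in> G" unfolding G_def by (intro CollectI exI[of _ "{}"]) (simp add: zero_prod_def)
    fix g assume "g \<in> G"
    then obtain K r where K: "finite K" "g = (\<Sum>k\<in>K. r k *\<^sub>R y k, \<Sum>k\<in>K. r k *\<^sub>R z k)"
      by (auto simp: G_def)
    show "c *\<^sub>R g \<in> G" for c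
      unfolding G_def K(2) using K(1)
      by (intro CollectI exI[of _ K] exI[of _ "\<lambda>k. c * r k"]) (simp add: scaleR_sum_right)
    fix h assume "h \<in> G"
    then obtain L s where L: "finite L" "h = (\<Sum>k\<in>L. s k *\<^sub>R y k, \<Sum>k\<in>L. s k *\<^sub>R z k)"
      by (auto simp: G_def)
    let ?r = "\<lambda>k. (if k \<in> K then r k else 0) + (if k \<in> L then s k else 0)"
    have "(\<Sum>k\<in>K. r k *\<^sub>R x k) + (\<Sum>k\<in>L. s k *\<^sub>R x k) = (\<Sum>k\<in>K \<union> L. ?r k *\<^sub>R x k)" for x :: "nat \<Rightarrow> 'a"
    proof -
      have "(\<Sum>k\<in>K. r k *\<^sub>R x k) = (\<Sum>k\<in>K \<union> L. (if k \<in> K then r k else 0) *\<^sub>R x k)"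
        using K(1) L(1) by (intro sum.mono_neutral_cong_left) auto
      moreover have "(\<Sum>k\<in>L. s k *\<^sub>R x k) = (\<Sum>k\<in>K \<union> L. (if k \<in> L then s k else 0) *\<^sub>R x k)"
        using K(1) L(1) by (intro sum.mono_neutral_cong_left) auto
      ultimately show ?thesis by (simp only: scaleR_add_left sum.distrib)
    qed
    then show "g + h \<in> G"
      unfolding G_def K(2) L(2) using K(1) L(1)
      by (intro CollectI exI[of _ "K \<union> L"] exI[of _ ?r]) simp
  qed
  have GY: "fst ` G \<subseteq> Y" using p(3) Y(1) by (auto simp: G_def intro!: subspace_sum subspace_scale)
  have GZ: "snd ` G \<subseteq> Z" using p(4) Z(1) by (auto simp: G_def intro!: subspace_sum subspace_scale)
  have single: "(y k, z k) \<in> G" for k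
    unfolding G_def by (intro CollectI exI[of _ "{k}"] exI[of _ "\<lambda>k. 1"]) simp
  have iso: "isomorphic_subspaces (closure (fst ` G)) (closure (snd ` G))"
  proof (rule graph_isomorphism[OF Gsub, of "1 / 2" "1 / 2" X])
    show "1 / 2 * norm (snd g) \<le> norm (fst g)" "1 / 2 * norm (fst g) \<le> norm (snd g)" if "g \<in> G" for g
      using that est by (auto simp: G_def)
  qed (use X GY GZ Y Z in auto)
  have cY: "closure (fst ` G) \<subseteq> Y" using GY Y(4) by (rule closure_minimal)
  have cZ: "closure (snd ` G) \<subseteq> Z" using GZ Z(4) by (rule closure_minimal)
  have "inf_closed_subspace X (closure (fst ` G))"
    unfolding inf_closed_subspace_def
  proof (intro conjI)
    show "subspace (closure (fst ` G))"
      using linear_subspace_image[OF linear_fst Gsub] by (rule subspace_closure)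
    show "closedin (top_of_set X) (closure (fst ` G))"
      using cY Y(3) by (intro closed_subset) auto
    show "infinite_dimensional (closure (fst ` G))"
    proof (rule infinite_dimensional_sequence[of "1 / 2" y])
      show "range y \<subseteq> closure (fst ` G)"
        using single closure_subset[of "fst ` G"] by force
    qed (use est in auto)
  qed
  moreover have "inf_closed_subspace X (closure (snd ` G))"
    unfolding inf_closed_subspace_def
  proof (intro conjI)
    show "subspace (closure (snd ` G))"
      using linear_subspace_image[OF linear_snd Gsub] by (rule subspace_closure)
    show "closedin (top_of_set X) (closure (snd ` G))"
      using cZ Z(3) by (intro closed_subset) auto
    show "infinite_dimensional (closure (snd ` G))"
    proof (rule infinite_dimensional_sequence[of "1 / 2" z])
      show "range z \<subseteq> closure (snd ` G)"
        using single closure_subset[of "snd ` G"] by force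
    qed (use est in auto)
  qed
  ultimately show "\<exists>Y' Z'. inf_closed_subspace X Y' \<and> Y' \<subseteq> Y \<and> inf_closed_subspace X Z' \<and> Z' \<subseteq> Z \<and>
      isomorphic_subspaces Y' Z'"
    using iso cY cZ by blast
qed

end

theorem theorem3p9:
  fixes N1 N2 :: "nat set"
    and \<sigma> :: "vec list \<Rightarrow> nat"
    and J :: "vec \<Rightarrow> 'a::real_normed_vector"
    and X4 :: "'a set"
  assumes "N1 \<union> N2 = {1..}" and "N1 \<inter> N2 = {}" and "infinite N1" and "infinite N2"
    and "coding_function N2 \<sigma>"
    and "is_c00_completion (W_norm N1 \<sigma>) J X4"
  shows "quasi_minimal X4"
proof -
  interpret completed_space N1 \<sigma> N2 J X4
    by unfold_locales (use assms in auto)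
  show ?thesis by (rule quasi_minimal_X)
qed

end
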